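(* Let $G$ be a chordal multigraph. Then $\lambda(G)=\nu(G)-1=\mathrm{rd}(G)\in\{\mathrm{tw}(G)-1,\mathrm{tw}(G)\}$. Moreover, $\mathrm{rd}(G)=\mathrm{tw}(G)$ holds if and only if there is a maximum clique of $G$ in which each pair of vertices is either linked by parallel edges or is contained in another maximal clique.
   Context: A multigraph is a finite undirected graph that may contain parallel edges but no loops; its simplified graph $\mathrm{si}(G)$ replaces each class of parallel edges by a single edge. $G$ is chordal if $\mathrm{si}(G)$ has no induced cycle of length more than three. A clique is a vertex set inducing a complete graph in $\mathrm{si}(G)$; maximal/maximum cliques as usual. $\mathrm{tw}(G)$ is the treewidth of $\mathrm{si}(G)$. Tensegrities: a tensegrity realization of $G$ in $\mathbb{R}^m$ is $(G,\sigma,p)$ with $\sigma:E(G)\to\{+,-\}$, $p:V(G)\to\mathbb{R}^m$ (not necessarily injective). A deformation of it is $(G,\sigma,q)$, $q:V(G)\to\mathbb{R}^m$, with $\|q(i)-q(j)\|\le\|p(i)-p(j)\|$ for edges $ij$ with $\sigma=+$ and $\|q(i)-q(j)\|\ge\|p(i)-p(j)\|$ for edges with $\sigma=-$. $G$ is $d$-realizable if every tensegrity realization of $G$ has a deformation whose points have affine span of dimension at most $d$; $\mathrm{rd}(G)$ is the minimum $d\ge0$ with $G$ $d$-realizable. With $V(G)=\{1,\dots,n\}$, standard basis $\mathbf{e}_i$, $L_{G,\omega}=\sum_{e}\omega(e)(\mathbf{e}_i-\mathbf{e}_j)(\mathbf{e}_i-\mathbf{e}_j)^\top$; $\omega$ is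 an equilibrium stress if $\sum_{e \text{ joins } i,j}\omega(e)(p(j)-p(i))=0$ at every vertex $i$, strictly proper if $\sigma(e)\omega(e)>0$ for all $e$. $(G,\sigma,p)$ with points affinely spanning $\mathbb{R}^d$ is $d$-dimensional super stable if (i) some strictly proper equilibrium stress has $L_{G,\omega}\succeq0$, $\dim\ker L_{G,\omega}=d+1$, and (ii) no nonzero symmetric $d\times d$ $S$ has $(p(j)-p(i))^\top S(p(j)-p(i))=0$ for all edges. $\lambda(G)$: for connected $G$ the maximum $d$ with a $d$-dimensional super stable realization, in general the maximum over components. $\nu(G)=\max\{\dim\ker A: A\in\mathcal{A}^*(G), A\succeq0, A \text{ has SAP}\}$, where $\mathcal{A}^*(G)$ consists of symmetric $n\times n$ $A$ with $A[i,j]=0$ if $i\neq j$ non-adjacent, $A[i,j]\ne0$ if exactly one edge joins $i,j$, arbitrary if $i=j$ or at least two edges join $i,j$; SAP means no nonzero symmetric $X$ with $XA=0$ and $X[i,j]=0$ whenever $i=j$ or $i,j$ adjacent.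
   Formalization: The formal theorem adds: if tw(G)=1 then G has a pair of parallel edges. This excludes exactly simple forests with an edge, where the claim fails (a single edge has λ=ν−1=0 but rd=tw=1, and its only maximum clique violates the condition). *)

theory Defs
  imports "HOL-Analysis.Analysis" "HOL-Library.Function_Algebras"
begin

section \<open>Multigraphs\<close>

text \<open>An edge is an abstract object with a two-element set of end vertices, so that
  parallel edges are distinct edges with the same ends.\<close>

record ('v, 'e) pre_multigraph =
  verts :: "'v set"
  edges :: "'e set"
  ends :: "'e \<Rightarrow> 'v set"

locale multigraph =
  fixes G :: "('v, 'e) pre_multigraph"
  assumes finite_verts: "finite (verts G)"
    and verts_nonempty: "verts G \<noteq> {}"
    and finite_edges: "finite (edges G)"
    and ends_subset: "e \<in> edges G \<Longrightarrow> ends G e \<subseteq> verts G"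
    and loopfree: "e \<in> edges G \<Longrightarrow> card (ends G e) = 2"

definition joining :: "('v, 'e) pre_multigraph \<Rightarrow> 'v \<Rightarrow> 'v \<Rightarrow> 'e set" where
  "joining G i j = {e \<in> edges G. ends G e = {i, j}}"

definition adjacent :: "('v, 'e) pre_multigraph \<Rightarrow> 'v \<Rightarrow> 'v \<Rightarrow> bool" where
  "adjacent G i j \<longleftrightarrow> joining G i j \<noteq> {}"

definition parallel :: "('v, 'e) pre_multigraph \<Rightarrow> 'v \<Rightarrow> 'v \<Rightarrow> bool" where
  "parallel G i j \<longleftrightarrow> card (joining G i j) \<ge> 2"

definition si :: "('v, 'e) pre_multigraph \<Rightarrow> ('v, 'v set) pre_multigraph" where
  "si G = \<lparr>verts = verts G, edges = ends G ` edges G, ends = (\<lambda>a. a)\<rparr>"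

definition induced :: "('v, 'e) pre_multigraph \<Rightarrow> 'v set \<Rightarrow> ('v, 'e) pre_multigraph" where
  "induced G U = \<lparr>verts = verts G \<inter> U, edges = {e \<in> edges G. ends G e \<subseteq> U}, ends = ends G\<rparr>"

definition connected_graph :: "('v, 'e) pre_multigraph \<Rightarrow> bool" where
  "connected_graph G \<longleftrightarrow> (\<forall>u\<in>verts G. \<forall>v\<in>verts G. (adjacent G)\<^sup>*\<^sup>* u v)"

definition graph_components :: "('v, 'e) pre_multigraph \<Rightarrow> ('v, 'e) pre_multigraph set" where
  "graph_components G = (\<lambda>u. induced G {v. (adjacent G)\<^sup>*\<^sup>* u v}) ` verts G"

definition graph_cycle :: "('v, 'e) pre_multigraph \<Rightarrow> 'v list \<Rightarrow> bool" where
  "graph_cycle G cs \<longleftrightarrow> length cs \<ge> 3 \<and> distinct cs \<and> set cs \<subseteq> verts G \<and>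
     (\<forall>k < length cs. adjacent G (cs ! k) (cs ! (Suc k mod length cs)))"

definition induced_cycle :: "('v, 'e) pre_multigraph \<Rightarrow> 'v list \<Rightarrow> bool" where
  "induced_cycle G cs \<longleftrightarrow> graph_cycle G cs \<and>
     (\<forall>k < length cs. \<forall>l < length cs. adjacent G (cs ! k) (cs ! l) \<longrightarrow>
        l = Suc k mod length cs \<or> k = Suc l mod length cs)"

definition chordal :: "('v, 'e) pre_multigraph \<Rightarrow> bool" where
  "chordal G \<longleftrightarrow> \<not> (\<exists>cs. induced_cycle (si G) cs \<and> length cs > 3)"

definition clique :: "('v, 'e) pre_multigraph \<Rightarrow> 'v set \<Rightarrow> bool" where
  "clique G C \<longleftrightarrow> C \<subseteq> verts G \<and> (\<forall>u\<in>C. \<forall>v\<in>C. u \<noteq> v \<longrightarrow> adjacent (si G) u v)"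

definition maximal_clique :: "('v, 'e) pre_multigraph \<Rightarrow> 'v set \<Rightarrow> bool" where
  "maximal_clique G C \<longleftrightarrow> clique G C \<and> (\<forall>D. clique G D \<and> C \<subseteq> D \<longrightarrow> D = C)"

definition maximum_clique :: "('v, 'e) pre_multigraph \<Rightarrow> 'v set \<Rightarrow> bool" where
  "maximum_clique G C \<longleftrightarrow> clique G C \<and> (\<forall>D. clique G D \<longrightarrow> card D \<le> card C)"

subsection \<open>Treewidth\<close>

definition tree :: "('v, 'e) pre_multigraph \<Rightarrow> bool" where
  "tree T \<longleftrightarrow> multigraph T \<and> connected_graph T \<and>
     (\<forall>u v. \<not> parallel T u v) \<and> (\<forall>cs. \<not> graph_cycle T cs)"

definition tree_decomposition ::
  "('v, 'e) pre_multigraph \<Rightarrow> ('t, 'f) pre_multigraph \<Rightarrow> ('t \<Rightarrow> 'v set) \<Rightarrow> bool" where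
  "tree_decomposition H T B \<longleftrightarrow> tree T \<and>
     (\<Union>t\<in>verts T. B t) = verts H \<and>
     (\<forall>e\<in>edges H. \<exists>t\<in>verts T. ends H e \<subseteq> B t) \<and>
     (\<forall>v\<in>verts H. connected_graph (induced T {t. v \<in> B t}))"

definition decomposition_width :: "('t, 'f) pre_multigraph \<Rightarrow> ('t \<Rightarrow> 'v set) \<Rightarrow> nat" where
  "decomposition_width T B = Max ((\<lambda>t. card (B t)) ` verts T) - 1"

text \<open>Every finite tree is isomorphic to one whose nodes are natural numbers and whose edges
  are pairs of nodes, so the quantification over decomposition trees loses nothing.\<close>

definition treewidth :: "('v, 'e) pre_multigraph \<Rightarrow> nat" where
  "treewidth H = (LEAST w. \<exists>(T :: (nat, nat set) pre_multigraph) B.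
     tree_decomposition H T B \<and> w = decomposition_width T B)"

definition tw :: "('v, 'e) pre_multigraph \<Rightarrow> nat" where
  "tw G = treewidth (si G)"

section \<open>Coordinate vectors and matrices\<close>

text \<open>The dimension of the ambient space varies inside the definitions below, and matrices are
  indexed by vertex sets of components. Hence \<open>\<real>\<^sup>I\<close> is the space of functions vanishing outside
  \<open>I\<close>; in particular \<open>\<real>\<^sup>m\<close> is \<open>coord_space {..<m}\<close>. A matrix indexed by \<open>I\<close> is a function of
  two arguments of which only the values on \<open>I\<close> matter.\<close>

definition scale_fun :: "real \<Rightarrow> ('i \<Rightarrow> real) \<Rightarrow> 'i \<Rightarrow> real" where
  "scale_fun c x = (\<lambda>i. c * x i)"

interpretation fun_space: vector_space scale_fun
  by unfold_locales (auto simp: scale_fun_def algebra_simps)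

definition coord_space :: "'i set \<Rightarrow> ('i \<Rightarrow> real) set" where
  "coord_space I = {x. \<forall>i. i \<notin> I \<longrightarrow> x i = 0}"

definition symmetric_on :: "'i set \<Rightarrow> ('i \<Rightarrow> 'i \<Rightarrow> real) \<Rightarrow> bool" where
  "symmetric_on I A \<longleftrightarrow> (\<forall>i\<in>I. \<forall>j\<in>I. A i j = A j i)"

definition nonzero_on :: "'i set \<Rightarrow> ('i \<Rightarrow> 'i \<Rightarrow> real) \<Rightarrow> bool" where
  "nonzero_on I A \<longleftrightarrow> (\<exists>i\<in>I. \<exists>j\<in>I. A i j \<noteq> 0)"

definition quad_form :: "'i set \<Rightarrow> ('i \<Rightarrow> 'i \<Rightarrow> real) \<Rightarrow> ('i \<Rightarrow> real) \<Rightarrow> real" where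
  "quad_form I A x = (\<Sum>i\<in>I. \<Sum>j\<in>I. x i * A i j * x j)"

definition psd_on :: "'i set \<Rightarrow> ('i \<Rightarrow> 'i \<Rightarrow> real) \<Rightarrow> bool" where
  "psd_on I A \<longleftrightarrow> symmetric_on I A \<and> (\<forall>x\<in>coord_space I. quad_form I A x \<ge> 0)"

definition matrix_kernel :: "'i set \<Rightarrow> ('i \<Rightarrow> 'i \<Rightarrow> real) \<Rightarrow> ('i \<Rightarrow> real) set" where
  "matrix_kernel I A = {x \<in> coord_space I. \<forall>i\<in>I. (\<Sum>j\<in>I. A i j * x j) = 0}"

definition corank_on :: "'i set \<Rightarrow> ('i \<Rightarrow> 'i \<Rightarrow> real) \<Rightarrow> nat" where
  "corank_on I A = fun_space.dim (matrix_kernel I A)"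

text \<open>The dimension of the affine span of \<open>S\<close> is that of its direction space, which the
  differences of points of \<open>S\<close> span (and 0 rather than \<open>-1\<close> for the empty set).\<close>

definition affine_dim :: "('i \<Rightarrow> real) set \<Rightarrow> nat" where
  "affine_dim S = fun_space.dim {x - y | x y. x \<in> S \<and> y \<in> S}"

section \<open>Tensegrities\<close>

definition tensegrity ::
  "('v, 'e) pre_multigraph \<Rightarrow> nat \<Rightarrow> ('e \<Rightarrow> real) \<Rightarrow> ('v \<Rightarrow> nat \<Rightarrow> real) \<Rightarrow> bool" where
  "tensegrity G m \<sigma> p \<longleftrightarrow>
     (\<forall>e\<in>edges G. \<sigma> e \<in> {1, -1}) \<and> (\<forall>v\<in>verts G. p v \<in> coord_space {..<m})"

definition point_dist :: "nat \<Rightarrow> (nat \<Rightarrow> real) \<Rightarrow> (nat \<Rightarrow> real) \<Rightarrow> real" where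
  "point_dist m x y = L2_set (\<lambda>k. x k - y k) {..<m}"

definition deformation ::
  "('v, 'e) pre_multigraph \<Rightarrow> nat \<Rightarrow> ('e \<Rightarrow> real) \<Rightarrow> ('v \<Rightarrow> nat \<Rightarrow> real) \<Rightarrow> ('v \<Rightarrow> nat \<Rightarrow> real) \<Rightarrow> bool"
  where
  "deformation G m \<sigma> p q \<longleftrightarrow> (\<forall>v\<in>verts G. q v \<in> coord_space {..<m}) \<and>
     (\<forall>i j. \<forall>e\<in>joining G i j.
        (\<sigma> e = 1 \<longrightarrow> point_dist m (q i) (q j) \<le> point_dist m (p i) (p j)) \<and>
        (\<sigma> e = -1 \<longrightarrow> point_dist m (q i) (q j) \<ge> point_dist m (p i) (p j)))"

definition d_realizable :: "nat \<Rightarrow> ('v, 'e) pre_multigraph \<Rightarrow> bool" where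
  "d_realizable d G \<longleftrightarrow> (\<forall>m \<sigma> p. tensegrity G m \<sigma> p \<longrightarrow>
     (\<exists>q. deformation G m \<sigma> p q \<and> affine_dim (q ` verts G) \<le> d))"

definition rd :: "('v, 'e) pre_multigraph \<Rightarrow> nat" where
  "rd G = (LEAST d. d_realizable d G)"

text \<open>A negative edge keeps distinct ends apart, so \<open>rd G \<ge> 1\<close> as soon as \<open>G\<close> has an edge. If in
  addition \<open>si G\<close> is a forest and no edges are parallel, then \<open>\<lambda>\<close> and \<open>\<nu> - 1\<close> below are nonetheless
  0. These graphs, which are exactly those with \<open>tw G = 1\<close> and no parallel edges, have to be
  excluded when the three parameters are claimed to agree.\<close>

subsection \<open>Super stability\<close>

text \<open>The summand of an edge \<open>e\<close> with ends \<open>i\<close>, \<open>j\<close> is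
  \<open>\<omega>(e) (\<e>\<^sub>i - \<e>\<^sub>j) (\<e>\<^sub>i - \<e>\<^sub>j)\<^sup>T\<close>, where \<open>\<e>\<^sub>i\<close> is a standard basis vector; it does not
  depend on the order of the two ends.\<close>

definition laplacian :: "('v, 'e) pre_multigraph \<Rightarrow> ('e \<Rightarrow> real) \<Rightarrow> 'v \<Rightarrow> 'v \<Rightarrow> real" where
  "laplacian G \<omega> a b = (\<Sum>e\<in>edges G. \<omega> e *
     (if a \<in> ends G e \<and> b \<in> ends G e then (if a = b then 1 else -1) else 0))"

definition equilibrium_stress ::
  "('v, 'e) pre_multigraph \<Rightarrow> nat \<Rightarrow> ('v \<Rightarrow> nat \<Rightarrow> real) \<Rightarrow> ('e \<Rightarrow> real) \<Rightarrow> bool" where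
  "equilibrium_stress G m p \<omega> \<longleftrightarrow> (\<forall>i\<in>verts G. \<forall>k<m.
     (\<Sum>j\<in>verts G. \<Sum>e\<in>joining G i j. \<omega> e * (p j k - p i k)) = 0)"

definition strictly_proper ::
  "('v, 'e) pre_multigraph \<Rightarrow> ('e \<Rightarrow> real) \<Rightarrow> ('e \<Rightarrow> real) \<Rightarrow> bool" where
  "strictly_proper G \<sigma> \<omega> \<longleftrightarrow> (\<forall>e\<in>edges G. \<sigma> e * \<omega> e > 0)"

definition super_stable ::
  "nat \<Rightarrow> ('v, 'e) pre_multigraph \<Rightarrow> ('e \<Rightarrow> real) \<Rightarrow> ('v \<Rightarrow> nat \<Rightarrow> real) \<Rightarrow> bool" where
  "super_stable d G \<sigma> p \<longleftrightarrow> tensegrity G d \<sigma> p \<and> affine_dim (p ` verts G) = d \<and>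
     (\<exists>\<omega>. equilibrium_stress G d p \<omega> \<and> strictly_proper G \<sigma> \<omega> \<and>
        psd_on (verts G) (laplacian G \<omega>) \<and> corank_on (verts G) (laplacian G \<omega>) = d + 1) \<and>
     \<not> (\<exists>S. symmetric_on {..<d} S \<and> nonzero_on {..<d} S \<and>
        (\<forall>i j. adjacent G i j \<longrightarrow> quad_form {..<d} S (p j - p i) = 0))"

definition lambda_connected :: "('v, 'e) pre_multigraph \<Rightarrow> nat" where
  "lambda_connected G = Max {d. \<exists>\<sigma> p. super_stable d G \<sigma> p}"

definition lambda_number :: "('v, 'e) pre_multigraph \<Rightarrow> nat" where
  "lambda_number G = Max (lambda_connected ` graph_components G)"

section \<open>The parameter \<open>\<nu>\<close>\<close>

definition A_star :: "('v, 'e) pre_multigraph \<Rightarrow> ('v \<Rightarrow> 'v \<Rightarrow> real) set" where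
  "A_star G = {A. symmetric_on (verts G) A \<and>
     (\<forall>i\<in>verts G. \<forall>j\<in>verts G. i \<noteq> j \<longrightarrow>
        (\<not> adjacent G i j \<longrightarrow> A i j = 0) \<and> (card (joining G i j) = 1 \<longrightarrow> A i j \<noteq> 0))}"

definition SAP :: "('v, 'e) pre_multigraph \<Rightarrow> ('v \<Rightarrow> 'v \<Rightarrow> real) \<Rightarrow> bool" where
  "SAP G A \<longleftrightarrow> \<not> (\<exists>X. symmetric_on (verts G) X \<and> nonzero_on (verts G) X \<and>
     (\<forall>i\<in>verts G. \<forall>j\<in>verts G. (\<Sum>k\<in>verts G. X i k * A k j) = 0) \<and>
     (\<forall>i\<in>verts G. \<forall>j\<in>verts G. i = j \<or> adjacent G i j \<longrightarrow> X i j = 0))"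

definition nu_number :: "('v, 'e) pre_multigraph \<Rightarrow> nat" where
  "nu_number G = Max {corank_on (verts G) A | A. A \<in> A_star G \<and> psd_on (verts G) A \<and> SAP G A}"

end

theory Submission
  imports Defs
begin

text \<open>Let \<open>t = tw G\<close>, which is the clique number minus one, and call a clique \<open>K\<close> thick if each of
  its pairs is linked by parallel edges or has a common neighbour outside \<open>K\<close>. A maximum clique as in
  the theorem is thick; if there is none, a maximum clique minus any vertex still is. Eliminating
  simplicial vertices, \<open>G\<close> is built from any clique \<open>K\<close> by adding vertices with clique
  neighbourhoods.

  Lower bounds: placing each added vertex at the average of its neighbours, with generic weights,
  gives a positive semidefinite matrix whose kernel restricts isomorphically to \<open>\<real>\<^sup>K\<close>. It has the
  strong Arnold property, and it is a stress matrix of a super stable realization of dimension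
  \<open>|K| - 1\<close> if \<open>G\<close> is connected and \<open>K\<close> is thick. Super stable tensegrities only deform by congruences, so
  \<open>rd G\<close> is at least their dimension.

  Upper bounds: placements of cliques glue along the elimination order, so \<open>rd G \<le> t\<close>; if each
  maximum clique has a single edge that lies in no other maximal clique, then each maximum clique can first be
  folded about the remaining vertices by one dimension. For \<open>\<nu>\<close>, the strong Arnold property yields
  a clique \<open>C\<close> such that the kernel of \<open>A\<close> injects into \<open>\<real>\<^sup>C\<close>. If the corank is \<open>|C|\<close>, then
  no summand of the decomposition of \<open>A\<close> into positive semidefinite matrices supported on cliques
  lives on \<open>C\<close>, so each single edge in \<open>C\<close> lies in another maximal clique.\<close>

section \<open>Chordal graphs and simplicial elimination\<close>

text \<open>Thickness is where matrices and placements meet. In the matrix built around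
  \<open>K\<close>, an entry for two vertices of \<open>K\<close> starts at 0 and becomes nonzero
  only through a vertex outside \<open>K\<close> adjacent to both; parallel edges can do without,
  since nonzero stresses of both signs may add up to 0. Conversely, a pair of a maximum clique with
  neither property is constrained by one sign only, and its length enters no other maximal clique.
  It may be changed on its own, and this is the freedom that folding spends. The parameters are
  sandwiched: a thick clique bounds all three from below, rigidity turns an upper bound on
  \<open>rd G\<close> into one on \<open>lambda_number G\<close>, and only
  \<open>nu_number G\<close> needs a separate upper bound. Elimination must be able to stop at a
  prescribed clique, because that clique carries the kernel; hence the search for simplicial
  vertices outside \<open>K\<close>. Folding needs a nonempty hinge, so a maximum clique of at least
  three vertices; if \<open>tw G = 1\<close>, the hypothesis on parallel edges supplies a tight
  maximum clique instead.\<close>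

definition cliq :: "('v \<Rightarrow> 'v \<Rightarrow> bool) \<Rightarrow> 'v set \<Rightarrow> bool" where
  "cliq adj C \<longleftrightarrow> (\<forall>u\<in>C. \<forall>v\<in>C. u \<noteq> v \<longrightarrow> adj u v)"

text \<open>Connectedness by cuts instead of walks. In this form it passes to \<open>V\<close>
  without a simplicial vertex by inspecting two cuts, with no walk to be rerouted.\<close>

definition cut_connected :: "('v \<Rightarrow> 'v \<Rightarrow> bool) \<Rightarrow> 'v set \<Rightarrow> bool" where
  "cut_connected adj V \<longleftrightarrow> (\<forall>U. U \<subset> V \<and> U \<noteq> {} \<longrightarrow> (\<exists>x\<in>U. \<exists>y\<in>V - U. adj x y))"

text \<open>Phrased for a bare relation on a vertex set, so that inductions can shrink the set
  without building subgraphs.\<close>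

definition chordal_on :: "('v \<Rightarrow> 'v \<Rightarrow> bool) \<Rightarrow> 'v set \<Rightarrow> bool" where
  "chordal_on adj V \<longleftrightarrow> \<not> (\<exists>cs. length cs > 3 \<and> distinct cs \<and> set cs \<subseteq> V \<and>
     (\<forall>k < length cs. adj (cs ! k) (cs ! (Suc k mod length cs))) \<and>
     (\<forall>k < length cs. \<forall>l < length cs. adj (cs ! k) (cs ! l) \<longrightarrow>
        l = Suc k mod length cs \<or> k = Suc l mod length cs))"

lemma cut_connectedD:
  "cut_connected adj V \<Longrightarrow> U \<subset> V \<Longrightarrow> U \<noteq> {} \<Longrightarrow> \<exists>x\<in>U. \<exists>y\<in>V - U. adj x y"
  by (simp add: cut_connected_def)

lemma cliqI: "(\<And>u v. u \<in> C \<Longrightarrow> v \<in> C \<Longrightarrow> u \<noteq> v \<Longrightarrow> adj u v) \<Longrightarrow> cliq adj C"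
  by (simp add: cliq_def)

lemma cliqD: "cliq adj C \<Longrightarrow> u \<in> C \<Longrightarrow> v \<in> C \<Longrightarrow> u \<noteq> v \<Longrightarrow> adj u v"
  by (simp add: cliq_def)

lemma cliq_mono: "cliq adj C \<Longrightarrow> D \<subseteq> C \<Longrightarrow> cliq adj D"
  unfolding cliq_def by blast

lemma chordal_on_mono: "chordal_on adj V \<Longrightarrow> U \<subseteq> V \<Longrightarrow> chordal_on adj U"
  unfolding chordal_on_def by (meson order_trans)

lemma rtranclp_leaves:
  assumes "R\<^sup>*\<^sup>* a b" "a \<in> U" "b \<notin> U"
  shows "\<exists>x\<in>U. \<exists>y. y \<notin> U \<and> R x y \<and> R\<^sup>*\<^sup>* a y"
  using assms
proof (induction rule: rtranclp_induct)
  case (step y z)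
  then show ?case
    by (metis rtranclp.rtrancl_into_rtrancl)
qed simp

lemma cut_connected_reachable:
  assumes "symp R"
  shows "cut_connected R {z. R\<^sup>*\<^sup>* w z}"
  unfolding cut_connected_def
proof (intro allI impI)
  fix U assume U: "U \<subset> {z. R\<^sup>*\<^sup>* w z} \<and> U \<noteq> {}"
  show "\<exists>x\<in>U. \<exists>y\<in>{z. R\<^sup>*\<^sup>* w z} - U. R x y"
  proof (cases "w \<in> U")
    case True
    obtain b where "R\<^sup>*\<^sup>* w b" "b \<notin> U" using U by blast
    from rtranclp_leaves[OF this(1) True this(2)] show ?thesis by blast
  next
    case False
    obtain b where "R\<^sup>*\<^sup>* w b" "b \<in> U" using U by blast
    \<comment> \<open>The walk starts outside \<open>U\<close>, so it leaves the complement of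
      \<open>U\<close>; symmetry reverses that edge.\<close>
    from rtranclp_leaves[OF this(1), of "- U"] this False
    obtain x y where xy: "x \<notin> U" "y \<in> U" "R x y" "R\<^sup>*\<^sup>* w y" by auto
    moreover have "R y x" using xy(3) assms by (simp add: symp_def)
    ultimately have "x \<in> {z. R\<^sup>*\<^sup>* w z} - U" by (simp add: rtranclp.rtrancl_into_rtrancl)
    then show ?thesis using xy(2) \<open>R y x\<close> by blast
  qed
qed

lemma cut_connected_weaken:
  "cut_connected R V \<Longrightarrow> (\<And>x y. x \<in> V \<Longrightarrow> y \<in> V \<Longrightarrow> R x y \<Longrightarrow> Q x y) \<Longrightarrow> cut_connected Q V"
  unfolding cut_connected_def by (meson Diff_iff psubsetD)

lemma cut_connected_walk:
  assumes "cut_connected adj A" "a \<in> A" "b \<in> A" "adj x a"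
  shows "\<exists>as. set as \<subseteq> A \<and> successively adj (x # as @ [b])"
proof -
  \<comment> \<open>\<open>U\<close> collects the ends of walks through \<open>A\<close>; if it were
    not all of \<open>A\<close>, an edge across the cut would extend one of them.\<close>
  define U where "U = {z\<in>A. \<exists>as. set as \<subseteq> A \<and> successively adj (x # as @ [z])}"
  have "a \<in> U" unfolding U_def using assms by (auto intro!: exI[of _ "[]"])
  have "U = A"
  proof (rule ccontr)
    assume "U \<noteq> A"
    then have "U \<subset> A" unfolding U_def by blast
    moreover have "U \<noteq> {}" using \<open>a \<in> U\<close> by blast
    ultimately obtain y z where yz: "y \<in> U" "z \<in> A - U" "adj y z"
      using cut_connectedD[OF assms(1)] by metis
    from yz(1) obtain as where as: "set as \<subseteq> A" "successively adj (x # as @ [y])" "y \<in> A"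
      unfolding U_def by blast
    then have "set (as @ [y]) \<subseteq> A" by simp
    moreover have "successively adj (x # (as @ [y]) @ [z])"
      using as(2) yz(3) by (cases as) (auto simp: successively_append_iff successively_Cons hd_append)
    ultimately have "z \<in> U" using yz(2) unfolding U_def by blast
    then show False using yz by blast
  qed
  then show ?thesis using assms(3) unfolding U_def by blast
qed

text \<open>A shortest walk from \<open>x\<close> to \<open>y\<close> through \<open>A\<close> closes up over \<open>v\<close> to an induced cycle.\<close>

lemma common_neighbours_adjacent:
  assumes ch: "chordal_on adj V" and sym: "symp adj" and irr: "\<And>x. \<not> adj x x"
    and V: "v \<in> V" "A \<subseteq> V" "x \<in> V" "y \<in> V"
    and A: "cut_connected adj A" "\<And>a. a \<in> A \<Longrightarrow> a \<noteq> v \<and> \<not> adj v a"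
    and xy: "x \<noteq> y" "adj v x" "adj v y" "a \<in> A" "adj x a" "b \<in> A" "adj b y"
  shows "adj x y"
proof (rule ccontr)
  assume nxy: "\<not> adj x y"
  define P where "P as \<longleftrightarrow> set as \<subseteq> A \<and> successively adj (x # as @ [y])" for as
  have "\<exists>as. P as"
  proof -
    obtain as where "set as \<subseteq> A" "successively adj (x # as @ [b])"
      using cut_connected_walk[OF A(1) xy(4) xy(6) xy(5)] by blast
    then have "P (as @ [b])" unfolding P_def
      using xy by (cases as) (auto simp: successively_append_iff successively_Cons hd_append)
    then show ?thesis by blast
  qed
  \<comment> \<open>\<open>as\<close> lists the inner vertices of a walk with as few of them as
    possible.\<close>
  then obtain as where as: "P as" and min: "\<And>bs. length bs < length as \<Longrightarrow> \<not> P bs"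
    by (metis (no_types, lifting) arg_min_nat_lemma linorder_not_less)
  define xs n where "xs = x # as @ [y]" and "n = length xs"
  have n: "n = length as + 2" by (simp add: n_def xs_def)
  then have n0: "0 < n" by simp
  have asne: "as \<noteq> []" using as nxy unfolding P_def by auto
  have xs0: "xs ! 0 = x" and xsn: "xs ! (n - 1) = y"
    by (auto simp: xs_def n nth_append)
  have xsi: "xs ! i \<in> A" if "0 < i" "i < n - 1" for i
    using that as n unfolding P_def xs_def by (auto simp: nth_Cons' nth_append)
  have succ: "adj (xs ! i) (xs ! Suc i)" if "Suc i < n" for i
    using as that unfolding P_def successively_conv_nth xs_def[symmetric] n_def by blast
  \<comment> \<open>A chord would bypass the vertices between its ends and give a shorter
    walk.\<close>
  have chord: "j = Suc i" if ij: "i < j" "j < n" "adj (xs ! i) (xs ! j)" for i j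
  proof (rule ccontr)
    assume "j \<noteq> Suc i"
    then have j: "i + 2 \<le> j" using ij by simp
    \<comment> \<open>Indices refer to \<open>xs\<close>, which has \<open>x\<close> in front of
      \<open>as\<close>; hence \<open>j - 1\<close>. The new walk keeps \<open>xs ! 0\<close> up to
      \<open>xs ! i\<close> and resumes at \<open>xs ! j\<close>.\<close>
    define bs where "bs = take i as @ drop (j - 1) as"
    have eq: "x # bs @ [y] = take (Suc i) xs @ drop j xs"
      using ij j n by (cases j) (auto simp: bs_def xs_def)
    have "successively adj (take (Suc i) xs @ drop j xs)"
    proof -
      have s: "successively adj xs" using as unfolding P_def xs_def by blast
      have "successively adj (take (Suc i) xs)" "successively adj (drop j xs)"
        using s by (metis append_take_drop_id successively_append_iff)+
      moreover have "last (take (Suc i) xs) = xs ! i" "hd (drop j xs) = xs ! j"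
        using ij by (auto simp: n_def hd_drop_conv_nth take_Suc_conv_app_nth)
      ultimately show ?thesis using ij(3) by (simp add: successively_append_iff)
    qed
    moreover have "set bs \<subseteq> A"
      using as set_take_subset[of i as] set_drop_subset[of "j - 1" as]
      unfolding bs_def P_def by auto
    ultimately have "P bs" unfolding P_def using eq by simp
    moreover have "length bs < length as" using j ij n by (simp add: bs_def)
    ultimately show False using min by blast
  qed
  have yA: "y \<notin> A" using A(2) xy by blast
  \<comment> \<open>If position \<open>j\<close> repeats position \<open>i\<close>, the successor of
    \<open>xs ! j\<close> is adjacent to \<open>xs ! i\<close>, a chord. At the last position the
    repeated vertex would be \<open>y\<close>, which is neither \<open>x\<close> nor in
    \<open>A\<close>.\<close>
  have dist: "xs ! i \<noteq> xs ! j" if ij: "i < j" "j < n" for i j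
  proof
    assume eq: "xs ! i = xs ! j"
    show False
    proof (cases "Suc j < n")
      case True
      then show False using chord[of i "Suc j"] succ[of j] eq ij by simp
    next
      case False
      then have "j = n - 1" using ij by simp
      then show False using eq ij xsn xs0 xy(1) yA xsi[of i] by (cases "i = 0") auto
    qed
  qed
  define cs where "cs = v # xs"
  have len: "length cs = Suc n" by (simp add: cs_def n_def)
  have vA: "v \<noteq> xs ! i" if "i < n" for i
  proof -
    consider "i = 0" | "i = n - 1" | "0 < i" "i < n - 1" using \<open>i < n\<close> by linarith
    then show ?thesis using A(2) xsi[of i] xs0 xsn irr xy by cases metis+
  qed
  have "distinct xs"
    unfolding distinct_conv_nth using dist by (metis n_def nat_neq_iff)
  then have c1: "distinct cs" using vA by (auto simp: cs_def in_set_conv_nth n_def)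
  have c2: "set cs \<subseteq> V"
    using V as by (auto simp: cs_def xs_def P_def)
  have c3: "length cs > 3" using asne len n by (cases as) auto
  have c4: "adj (cs ! k) (cs ! (Suc k mod length cs))" if "k < length cs" for k
  proof (cases "k = n")
    case True
    then show ?thesis using xsn xy sym len n by (auto simp: cs_def symp_def)
  next
    case False
    then show ?thesis using succ[of "k - 1"] xs0 xy that len by (cases k) (auto simp: cs_def)
  qed
  have c5: "l = Suc k mod length cs \<or> k = Suc l mod length cs"
    if kl: "k < length cs" "l < length cs" "adj (cs ! k) (cs ! l)" for k l
  proof -
    have v: "i = 0 \<or> i = n - 1" if "adj v (xs ! i)" "i < n" for i
      using that xsi[of i] A(2) by (cases "i = 0"; cases "i = n - 1") auto
    consider "k = 0" | "l = 0" | "k > 0" "l > 0" by auto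
    then show ?thesis
    proof cases
      case 1
      then have "l > 0" using kl irr by (auto simp: cs_def intro!: gr0I)
      then have "l - 1 = 0 \<or> l - 1 = n - 1" using v[of "l - 1"] kl 1 len by (auto simp: cs_def)
      then have "l = 1 \<or> l = n" using \<open>l > 0\<close> n by auto
      then show ?thesis using 1 len n0 by auto
    next
      case 2
      then have "k > 0" using kl irr by (auto simp: cs_def intro!: gr0I)
      then have "k - 1 = 0 \<or> k - 1 = n - 1" using v[of "k - 1"] kl 2 len sym
        by (auto simp: cs_def symp_def)
      then have "k = 1 \<or> k = n" using \<open>k > 0\<close> n by auto
      then show ?thesis using 2 len n0 by auto
    next
      case 3
      then have a: "adj (xs ! (k - 1)) (xs ! (l - 1))" using kl by (simp add: cs_def)
      then have "k \<noteq> l" using irr by auto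
      have a': "adj (xs ! (l - 1)) (xs ! (k - 1))" using a sym by (simp add: symp_def)
      have "l - 1 = Suc (k - 1) \<or> k - 1 = Suc (l - 1)"
      proof (cases "k < l")
        case True
        then show ?thesis using chord[OF _ _ a] 3 kl len by linarith
      next
        case False
        then show ?thesis using chord[OF _ _ a'] \<open>k \<noteq> l\<close> 3 kl len by linarith
      qed
      then have "l = Suc k \<or> k = Suc l" using 3 by linarith
      then show ?thesis using kl by auto
    qed
  qed
  have "\<not> chordal_on adj V"
    unfolding chordal_on_def not_not
    by (rule exI[of _ cs]) (intro conjI allI impI c1 c2 c3 c4 c5)
  then show False using ch by blast
qed

text \<open>Dirac's argument. \<open>A\<close> is a component of the non-neighbours of
  \<open>v\<close> and \<open>S\<close> its boundary. Vertices of \<open>S\<close> are adjacent to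
  \<open>v\<close> and to \<open>A\<close>, so \<open>S\<close> is a clique, and a simplicial vertex
  of \<open>A \<union> S\<close> that lies in \<open>A\<close> is simplicial in \<open>V\<close>.
  Asking for a vertex not adjacent to \<open>v\<close> lets the induction control where the
  simplicial vertex lies.\<close>

lemma exists_simplicial_nonadjacent:
  assumes "finite V" "chordal_on adj V" and sym: "symp adj" and irr: "\<And>x. \<not> adj x x"
    and "v \<in> V" "w \<in> V" "w \<noteq> v" "\<not> adj v w"
  shows "\<exists>u\<in>V. u \<noteq> v \<and> \<not> adj v u \<and> cliq adj {z\<in>V. adj u z}"
  using assms
proof (induction "card V" arbitrary: V v w rule: less_induct)
  case less
  define Z where "Z = {z\<in>V. z \<noteq> v \<and> \<not> adj v z}"
  define R where "R a b \<longleftrightarrow> adj a b \<and> a \<in> Z \<and> b \<in> Z" for a b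
  define A where "A = {z. R\<^sup>*\<^sup>* w z}"
  define S where "S = {z\<in>V. z \<notin> A \<and> (\<exists>a\<in>A. adj z a)}"
  have symR: "symp R" using sym by (auto simp: symp_def R_def)
  have wZ: "w \<in> Z" using less.prems by (simp add: Z_def)
  have AZ: "A \<subseteq> Z"
  proof
    fix z assume "z \<in> A"
    then have "R\<^sup>*\<^sup>* w z" by (simp add: A_def)
    then show "z \<in> Z" by (induction rule: rtranclp_induct) (auto simp: R_def wZ)
  qed
  have Acl: "z \<in> A" if "a \<in> A" "adj a z" "z \<in> Z" for a z
    using that AZ unfolding A_def
    by (metis (mono_tags, lifting) R_def mem_Collect_eq rtranclp.rtrancl_into_rtrancl subsetD)
  have conn: "cut_connected adj A"
    by (rule cut_connected_weaken[OF cut_connected_reachable[OF symR, of w, folded A_def]])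
      (simp add: R_def)
  have SN: "adj v s" if s: "s \<in> S" for s
  proof -
    obtain a where a: "a \<in> A" "adj s a" "s \<in> V" "s \<notin> A" using s unfolding S_def by blast
    then have "s \<notin> Z" using Acl[of a s] sym by (auto simp: symp_def)
    moreover have "s \<noteq> v" using a AZ by (auto simp: Z_def)
    ultimately show ?thesis using a by (simp add: Z_def)
  qed
  have Scl: "cliq adj S"
    unfolding cliq_def
  proof (intro ballI impI)
    fix x y assume x: "x \<in> S" and y: "y \<in> S" and ne: "x \<noteq> y"
    from x obtain a where a: "a \<in> A" "adj x a" by (auto simp: S_def)
    from y obtain b where b: "b \<in> A" "adj b y" using sym by (auto simp: S_def symp_def)
    show "adj x y"
      by (rule common_neighbours_adjacent[of adj V v A x y a b])
        (use less.prems sym irr conn AZ x y ne a b SN in \<open>auto simp: Z_def S_def\<close>)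
  qed
  define V' where "V' = A \<union> S"
  have V'V: "V' \<subseteq> V" "v \<notin> V'" using AZ irr SN by (auto simp: V'_def S_def Z_def)
  then have card: "card V' < card V"
    using less.prems by (intro psubset_card_mono) auto
  have fin': "finite V'" using V'V less.prems(1) finite_subset by blast
  have ch': "chordal_on adj V'" using chordal_on_mono less.prems V'V by blast
  note IH = less.hyps[OF card fin' ch' sym irr]
  \<comment> \<open>All neighbours of a vertex of \<open>A\<close> lie in \<open>V'\<close>.\<close>
  have good: ?case if u: "u \<in> A" "cliq adj {z\<in>V'. adj u z}" for u
  proof -
    have "{z\<in>V. adj u z} \<subseteq> {z\<in>V'. adj u z}"
      using u sym by (auto simp: V'_def S_def symp_def)
    then have "cliq adj {z\<in>V. adj u z}" using u cliq_mono by blast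
    then show ?case using u AZ unfolding Z_def by blast
  qed
  have wA: "w \<in> A" by (simp add: A_def)
  have "cliq adj V'"
    if "\<forall>s\<in>S. \<forall>z\<in>V'. z \<noteq> s \<longrightarrow> adj s z" "\<forall>a\<in>A. \<forall>z\<in>V'. z \<noteq> a \<longrightarrow> adj a z"
    unfolding cliq_def
  proof (intro ballI impI)
    fix y z assume "y \<in> V'" "z \<in> V'" "y \<noteq> z"
    then show "adj y z" using that by (cases "y \<in> S") (auto simp: V'_def)
  qed
  \<comment> \<open>The base vertex of the induction hypothesis is chosen to push the simplicial
    vertex into \<open>A\<close>. A non-neighbour of some \<open>s \<in> S\<close> is not in the
    clique \<open>S\<close>; if every \<open>s\<close> is joined to all of \<open>V'\<close>, a
    non-neighbour of any \<open>a \<in> A\<close> avoids \<open>S\<close> too.\<close>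
  then consider (a) s z where "s \<in> S" "z \<in> V'" "z \<noteq> s" "\<not> adj s z"
    | (b) a z where "a \<in> A" "z \<in> V'" "z \<noteq> a" "\<not> adj a z" "\<forall>s\<in>S. \<forall>z\<in>V'. z \<noteq> s \<longrightarrow> adj s z"
    | (c) "cliq adj V'"
    by meson
  then show ?case
  proof cases
    case a
    have s': "s \<in> V'" using a(1) by (simp add: V'_def)
    from IH[OF s' a(2,3,4)] obtain u where u: "u \<in> V'" "u \<noteq> s" "\<not> adj s u" "cliq adj {z\<in>V'. adj u z}"
      by blast
    have "u \<notin> S" using cliqD[OF Scl a(1)] u(2,3) by metis
    then have "u \<in> A" using u(1) by (simp add: V'_def)
    then show ?thesis using good u(4) by blast
  next
    case b
    have a': "a \<in> V'" using b(1) by (simp add: V'_def)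
    from IH[OF a' b(2,3,4)] obtain u where u: "u \<in> V'" "u \<noteq> a" "\<not> adj a u" "cliq adj {z\<in>V'. adj u z}"
      by blast
    have "adj a u" if "u \<in> S" using b(5) a' u(2) that sympD[OF sym] by metis
    then have "u \<notin> S" using u(3) by blast
    then have "u \<in> A" using u(1) by (simp add: V'_def)
    then show ?thesis using good u(4) by blast
  next
    case c
    then show ?thesis using good[OF wA] cliq_mono[of adj V'] by auto
  qed
qed

text \<open>A perfect elimination order read backwards, starting from \<open>K\<close>. It is used
  with \<open>K = {}\<close> for gluing and for decomposing matrices, with a clique as core, and
  with a singleton for trees.\<close>

inductive elim_from :: "('v \<Rightarrow> 'v \<Rightarrow> bool) \<Rightarrow> 'v set \<Rightarrow> 'v set \<Rightarrow> bool" for adj K where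
  base: "elim_from adj K K"
| step: "elim_from adj K V \<Longrightarrow> v \<notin> V \<Longrightarrow> cliq adj {u\<in>V. adj v u} \<Longrightarrow> elim_from adj K (insert v V)"

text \<open>The base vertex for the preceding lemma is taken in \<open>K\<close> if some vertex of
  \<open>K\<close> has a non-neighbour, because a clique contains no non-neighbour of its own
  vertices. Otherwise \<open>K\<close> is joined to everything, so no non-neighbour of another
  vertex lies in \<open>K\<close>.\<close>

lemma exists_simplicial_outside:
  assumes "finite V" "chordal_on adj V" and sym: "symp adj" and irr: "\<And>x. \<not> adj x x"
    and K: "K \<subset> V" "cliq adj K"
  shows "\<exists>u\<in>V - K. cliq adj {z\<in>V. adj u z}"
proof -
  note ex = exists_simplicial_nonadjacent[OF assms(1,2) sym irr]
  consider (a) v w where "v \<in> K" "w \<in> V" "w \<noteq> v" "\<not> adj v w"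
    | (b) v w where "v \<in> V" "w \<in> V" "w \<noteq> v" "\<not> adj v w" "\<forall>k\<in>K. \<forall>w\<in>V. w \<noteq> k \<longrightarrow> adj k w"
    | (c) "cliq adj V"
    unfolding cliq_def by metis
  then show ?thesis
  proof cases
    case a
    have "v \<in> V" using a(1) K(1) by blast
    from ex[OF this a(2,3,4)] obtain u
      where u: "u \<in> V" "u \<noteq> v" "\<not> adj v u" "cliq adj {z\<in>V. adj u z}" by blast
    then have "u \<notin> K" using cliqD[OF K(2) a(1)] by metis
    then show ?thesis using u by blast
  next
    case b
    from ex[OF b(1,2,3,4)] obtain u
      where u: "u \<in> V" "u \<noteq> v" "\<not> adj v u" "cliq adj {z\<in>V. adj u z}" by blast
    have "adj v u" if "u \<in> K" using that b(1,5) u(2) sympD[OF sym] by metis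
    then show ?thesis using u by blast
  next
    case c
    then show ?thesis using K cliq_mono[of adj V] by auto
  qed
qed

lemma chordal_elim_from:
  assumes "finite V" "chordal_on adj V" and sym: "symp adj" and irr: "\<And>x. \<not> adj x x"
    and K: "K \<subseteq> V" "cliq adj K"
  shows "elim_from adj K V"
  using assms(1,2) K
proof (induction "card V" arbitrary: V rule: less_induct)
  case less
  show ?case
  proof (cases "K = V")
    case False
    then obtain u where u: "u \<in> V - K" "cliq adj {z\<in>V. adj u z}"
      using exists_simplicial_outside[OF less.prems(1,2) sym irr, of K] less.prems by blast
    have "elim_from adj K (V - {u})"
    proof (rule less.hyps)
      show "card (V - {u}) < card V" using u less.prems by (intro psubset_card_mono) auto
    qed (use less.prems u in \<open>auto intro: chordal_on_mono\<close>)
    then have "elim_from adj K (insert u (V - {u}))"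
      by (rule elim_from.step) (use u in \<open>auto intro: cliq_mono\<close>)
    then show ?thesis using u by (simp add: insert_absorb)
  qed (simp add: elim_from.base)
qed

lemma elim_from_subset: "elim_from adj K V \<Longrightarrow> K \<subseteq> V"
  by (induction rule: elim_from.induct) auto

lemma elim_from_finite: "elim_from adj K V \<Longrightarrow> finite K \<Longrightarrow> finite V"
  by (induction rule: elim_from.induct) auto

text \<open>If no edge leaves \<open>U\<close> within \<open>V\<close>, the edges across the cuts
  \<open>U\<close> and \<open>insert v U\<close> are all incident with \<open>v\<close>. So
  \<open>v\<close> has neighbours on both sides, and these are adjacent because \<open>v\<close> is
  simplicial.\<close>

lemma cut_connected_remove:
  assumes "cut_connected adj (insert v V)" "v \<notin> V" "cliq adj {u\<in>V. adj v u}" "symp adj"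
  shows "cut_connected adj V"
  unfolding cut_connected_def
proof (intro allI impI)
  fix U assume U: "U \<subset> V \<and> U \<noteq> {}"
  show "\<exists>x\<in>U. \<exists>y\<in>V - U. adj x y"
  proof (rule ccontr)
    assume no: "\<not> ?thesis"
    have "U \<subset> insert v V" using U assms(2) by blast
    then have "\<exists>x\<in>U. \<exists>y\<in>insert v V - U. adj x y"
      using cut_connectedD[OF assms(1)] U by metis
    then obtain a where a: "a \<in> U" "adj a v" using no by blast
    have "insert v U \<subset> insert v V" using U assms(2) by auto
    then have "\<exists>x\<in>insert v U. \<exists>y\<in>insert v V - insert v U. adj x y"
      using cut_connectedD[OF assms(1)] by (metis insert_not_empty)
    then obtain b where b: "b \<in> V - U" "adj v b" using no by blast
    have "adj a b"
    proof (rule cliqD[OF assms(3)])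
      show "a \<in> {u\<in>V. adj v u}" using a U sympD[OF assms(4)] by blast
    qed (use a b in auto)
    then show False using no a b by blast
  qed
qed

lemma cut_connected_neighbour:
  assumes "cut_connected adj (insert v V)" "v \<notin> V" "V \<noteq> {}"
  shows "\<exists>u\<in>V. adj v u"
proof -
  have "{v} \<subset> insert v V" using assms by auto
  from cut_connectedD[OF assms(1) this] show ?thesis by blast
qed

section \<open>From multigraphs to adjacency relations\<close>

lemma adjacent_commute: "adjacent G i j \<longleftrightarrow> adjacent G j i"
  by (simp add: adjacent_def joining_def insert_commute)

lemma symp_adjacent: "symp (adjacent G)"
  by (simp add: symp_def adjacent_commute)

lemma (in multigraph) adjacentD:
  assumes "adjacent G i j"
  shows "i \<in> verts G" "j \<in> verts G" "i \<noteq> j"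
proof -
  obtain e where "e \<in> edges G" "ends G e = {i, j}"
    using assms by (auto simp: adjacent_def joining_def)
  then show "i \<in> verts G" "j \<in> verts G" "i \<noteq> j"
    using ends_subset[of e] loopfree[of e] by auto
qed

lemma (in multigraph) not_adjacent_self: "\<not> adjacent G i i"
  using adjacentD by blast

lemma adjacent_si: "adjacent (si G) u v \<longleftrightarrow> adjacent G u v"
  by (auto simp: adjacent_def joining_def si_def)

lemma clique_iff: "clique G C \<longleftrightarrow> C \<subseteq> verts G \<and> cliq (adjacent G) C"
  by (simp add: clique_def cliq_def adjacent_si)

lemma chordal_imp_chordal_on:
  assumes "chordal G"
  shows "chordal_on (adjacent G) (verts G)"
  unfolding chordal_on_def
proof (rule notI, elim exE conjE)
  fix cs :: "'a list"
  assume "3 < length cs" "distinct cs" "set cs \<subseteq> verts G"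
    "\<forall>k<length cs. adjacent G (cs ! k) (cs ! (Suc k mod length cs))"
    "\<forall>k<length cs. \<forall>l<length cs. adjacent G (cs ! k) (cs ! l) \<longrightarrow>
       l = Suc k mod length cs \<or> k = Suc l mod length cs"
  then have "induced_cycle (si G) cs"
    by (simp add: induced_cycle_def graph_cycle_def adjacent_si) (simp add: si_def)
  then show False using assms \<open>3 < length cs\<close> unfolding chordal_def by blast
qed

lemma adjacent_induced:
  "adjacent (induced G U) i j \<longleftrightarrow> adjacent G i j \<and> i \<in> U \<and> j \<in> U"
  by (auto simp: adjacent_def joining_def induced_def)

lemma verts_induced: "verts (induced G U) = verts G \<inter> U"
  by (simp add: induced_def)

lemma connected_graph_cut_connected:
  assumes "connected_graph G" and v: "\<And>x y. adjacent G x y \<Longrightarrow> y \<in> verts G"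
  shows "cut_connected (adjacent G) (verts G)"
  unfolding cut_connected_def
proof (intro allI impI)
  fix U assume U: "U \<subset> verts G \<and> U \<noteq> {}"
  then obtain a b where ab: "a \<in> U" "b \<in> verts G - U" by blast
  then have "(adjacent G)\<^sup>*\<^sup>* a b" using assms(1) U unfolding connected_graph_def by blast
  from rtranclp_leaves[OF this ab(1)] ab(2) v
  show "\<exists>x\<in>U. \<exists>y\<in>verts G - U. adjacent G x y" by blast
qed

section \<open>Tree decompositions\<close>

text \<open>A graph without cycles is chordal, so elimination of simplicial vertices applies; as a
  tree has no triangles, each eliminated node is a leaf of what remains.\<close>

lemma tree_elim_from:
  fixes T :: "('t, 'f) pre_multigraph"
  assumes "tree T" "r \<in> verts T"
  shows "elim_from (adjacent T) {r} (verts T)"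
proof (rule chordal_elim_from)
  interpret multigraph T using assms(1) by (simp add: tree_def)
  show "finite (verts T)" by (rule finite_verts)
  show "symp (adjacent T)" by (rule symp_adjacent)
  show "\<not> adjacent T x x" for x by (rule not_adjacent_self)
  show "chordal_on (adjacent T) (verts T)"
    unfolding chordal_on_def
  proof (rule notI, elim exE conjE)
    fix cs :: "'t list"
    assume "3 < length cs" "distinct cs" "set cs \<subseteq> verts T"
      "\<forall>k<length cs. adjacent T (cs ! k) (cs ! (Suc k mod length cs))"
    then have "graph_cycle T cs" by (simp add: graph_cycle_def)
    then show False using assms(1) by (simp add: tree_def)
  qed
qed (use assms in \<open>auto simp: cliq_def\<close>)

lemma tree_triangle_free:
  assumes "tree T" "adjacent T a b" "adjacent T b c" "adjacent T c a"
  shows False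
proof -
  interpret multigraph T using assms(1) by (simp add: tree_def)
  note D = adjacentD[OF assms(2)] adjacentD[OF assms(3)] adjacentD[OF assms(4)]
  have "adjacent T ([a, b, c] ! k) ([a, b, c] ! (Suc k mod 3))" if "k < 3" for k
  proof -
    consider "k = 0" | "k = 1" | "k = 2" using \<open>k < 3\<close> by linarith
    then show ?thesis using assms(2-4) by cases simp_all
  qed
  then have "graph_cycle T [a, b, c]" using D by (simp add: graph_cycle_def)
  then show False using assms(1) by (simp add: tree_def)
qed

text \<open>The Helly property of subtrees, by removing leaves: either a leaf can be removed, or it is
  the only node whose bag contains some element of \<open>K\<close>.\<close>

lemma bag_contains_pairwise_covered:
  assumes "elim_from adj {r} V" and sym: "symp adj"
    and tri: "\<And>a b c. adj a b \<Longrightarrow> adj b c \<Longrightarrow> adj c a \<Longrightarrow> False"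
    and "\<And>u v. u \<in> K \<Longrightarrow> v \<in> K \<Longrightarrow> \<exists>t\<in>V. u \<in> B t \<and> v \<in> B t"
    and "\<And>v. v \<in> K \<Longrightarrow> cut_connected adj {t\<in>V. v \<in> B t}"
  shows "\<exists>t\<in>V. K \<subseteq> B t"
  using assms(1,4,5)
proof (induction rule: elim_from.induct)
  case base
  then show ?case by auto
next
  case (step V l)
  define N where "N = {u\<in>V. adj l u}"
  \<comment> \<open>Two adjacent neighbours of \<open>l\<close> would close a triangle, so
    \<open>l\<close> is a leaf.\<close>
  have N1: "m = m'" if "m \<in> N" "m' \<in> N" for m m'
  proof (rule ccontr)
    assume "m \<noteq> m'"
    then have "adj m m'" using cliqD[OF step.hyps(3), of m m'] that by (simp add: N_def)
    moreover have "adj l m" "adj m' l" using that sympD[OF sym, of l m'] by (simp_all add: N_def)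
    ultimately show False using tri by blast
  qed
  show ?case
  proof (cases "\<forall>v\<in>K. v \<in> B l \<longrightarrow> (\<exists>m\<in>N. v \<in> B m)")
    \<comment> \<open>The bag of the neighbour then contains everything that the bag of
      \<open>l\<close> contributes to \<open>K\<close>, so the leaf can go.\<close>
    case True
    have "\<exists>t\<in>V. K \<subseteq> B t"
    proof (rule step.IH)
      fix u v assume uv: "u \<in> K" "v \<in> K"
      then obtain t where t: "t \<in> insert l V" "u \<in> B t" "v \<in> B t" using step.prems(1) by blast
      show "\<exists>t\<in>V. u \<in> B t \<and> v \<in> B t"
      proof (cases "t = l")
        case tl: True
        obtain m m' where m: "m \<in> N" "u \<in> B m" and m': "m' \<in> N" "v \<in> B m'"
          using True uv t unfolding tl by metis
        then show ?thesis using N1[OF m(1) m'(1)] unfolding N_def by auto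
      qed (use t in blast)
    next
      fix v assume v: "v \<in> K"
      show "cut_connected adj {t\<in>V. v \<in> B t}"
      proof (cases "v \<in> B l")
        case vl: True
        show ?thesis
        proof (rule cut_connected_remove)
          have "{t\<in>insert l V. v \<in> B t} = insert l {t\<in>V. v \<in> B t}" using vl by blast
          then show "cut_connected adj (insert l {t\<in>V. v \<in> B t})"
            using step.prems(2)[OF v] by simp
          show "cliq adj {u \<in> {t \<in> V. v \<in> B t}. adj l u}"
            by (rule cliq_mono[OF step.hyps(3)]) blast
        qed (use step.hyps sym in auto)
      next
        case False
        then have "{t\<in>insert l V. v \<in> B t} = {t\<in>V. v \<in> B t}" by blast
        then show ?thesis using step.prems(2)[OF v] by simp
      qed
    qed
    then show ?thesis by blast
  next
    case False
    then obtain v where v: "v \<in> K" "v \<in> B l" "\<And>m. m \<in> N \<Longrightarrow> v \<notin> B m" by blast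
    have only: "t = l" if "t \<in> insert l V" "v \<in> B t" for t
    proof (rule ccontr)
      assume "t \<noteq> l"
      then have "{l} \<subset> {t\<in>insert l V. v \<in> B t}" using that v(2) by blast
      from cut_connectedD[OF step.prems(2)[OF v(1)] this]
      obtain m where "m \<in> V" "v \<in> B m" "adj l m" by blast
      then show False using v(3) unfolding N_def by blast
    qed
    have "K \<subseteq> B l"
    proof
      fix u assume "u \<in> K"
      then obtain t where "t \<in> insert l V" "u \<in> B t" "v \<in> B t" using step.prems(1) v(1) by blast
      then show "u \<in> B l" using only by blast
    qed
    then show ?thesis by blast
  qed
qed

lemma tree_bag_contains_pairwise_covered:
  assumes T: "tree T"
    and pairs: "\<And>u v. u \<in> K \<Longrightarrow> v \<in> K \<Longrightarrow> \<exists>t\<in>verts T. u \<in> B t \<and> v \<in> B t"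
    and conn: "\<And>v. v \<in> K \<Longrightarrow> connected_graph (induced T {t. v \<in> B t})"
  shows "\<exists>t\<in>verts T. K \<subseteq> B t"
proof -
  interpret multigraph T using T by (simp add: tree_def)
  obtain r where "r \<in> verts T" using verts_nonempty by blast
  from bag_contains_pairwise_covered[OF tree_elim_from[OF T this] symp_adjacent]
  show ?thesis
  proof
    fix v assume "v \<in> K"
    have "cut_connected (adjacent (induced T {t. v \<in> B t})) (verts (induced T {t. v \<in> B t}))"
      by (rule connected_graph_cut_connected[OF conn[OF \<open>v \<in> K\<close>]])
        (auto simp: adjacent_induced verts_induced dest: adjacentD)
    moreover have "verts (induced T {t. v \<in> B t}) = {t \<in> verts T. v \<in> B t}"
      by (auto simp: verts_induced)
    ultimately show "cut_connected (adjacent T) {t \<in> verts T. v \<in> B t}"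
      by (auto intro: cut_connected_weaken simp: adjacent_induced)
  qed (use pairs tree_triangle_free[OF T] in blast)+
qed

text \<open>Any two vertices of a clique share a bag, so the Helly property applies. This is the
  lower bound on the width of every decomposition.\<close>

lemma decomposition_bag_contains_clique:
  assumes T: "tree_decomposition (si G) T B" and C: "clique G C"
  shows "\<exists>t\<in>verts T. C \<subseteq> B t"
proof (rule tree_bag_contains_pairwise_covered)
  show "tree T" using T by (simp add: tree_decomposition_def)
  have V: "verts (si G) = verts G" by (simp add: si_def)
  fix u assume u: "u \<in> C"
  then show "connected_graph (induced T {t. u \<in> B t})"
    using T C V by (auto simp: tree_decomposition_def clique_def)
  fix v assume v: "v \<in> C"
  show "\<exists>t\<in>verts T. u \<in> B t \<and> v \<in> B t"
  proof (cases "u = v")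
    case True
    then show ?thesis using T u C V by (auto simp: tree_decomposition_def clique_def)
  next
    case False
    then have "adjacent (si G) u v" using C u v by (simp add: clique_def)
    then obtain e where "e \<in> edges (si G)" "ends (si G) e = {u, v}"
      by (auto simp: adjacent_def joining_def)
    then show ?thesis using T by (force simp: tree_decomposition_def)
  qed
qed

section \<open>Clique trees built leaf by leaf\<close>

definition add_leaf :: "('t, 't set) pre_multigraph \<Rightarrow> 't \<Rightarrow> 't \<Rightarrow> ('t, 't set) pre_multigraph" where
  "add_leaf T s t = \<lparr>verts = insert s (verts T), edges = insert {s, t} (edges T), ends = (\<lambda>a. a)\<rparr>"

lemma adjacent_add_leaf:
  "ends T = (\<lambda>a. a) \<Longrightarrow>
    adjacent (add_leaf T s t) u v \<longleftrightarrow> adjacent T u v \<or> u = s \<and> v = t \<or> u = t \<and> v = s"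
  by (auto simp: adjacent_def joining_def add_leaf_def doubleton_eq_iff)

text \<open>\<open>U\<close> and \<open>U'\<close> stand for the nodes whose bags contain one given
  vertex, before and after \<open>s\<close> is attached to \<open>t\<close>. Every node of
  \<open>U'\<close> reaches \<open>t\<close>, either inside \<open>U\<close> or by the new
  edge.\<close>

lemma connected_add_leaf:
  assumes "ends T = (\<lambda>a. a)" "connected_graph (induced T U)" "t \<in> verts T" "t \<in> U"
    "verts T \<inter> U' = verts T \<inter> U" "s \<in> U'" "\<And>x y. adjacent T x y \<Longrightarrow> x \<in> verts T \<and> y \<in> verts T"
  shows "connected_graph (induced (add_leaf T s t) U')"
proof -
  define R where "R = adjacent (induced (add_leaf T s t) U')"
  have sym: "symp R" unfolding R_def by (rule symp_adjacent)
  have mono: "R x y" if xy: "adjacent (induced T U) x y" for x y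
  proof -
    have "adjacent T x y" "x \<in> U" "y \<in> U" using xy by (simp_all add: adjacent_induced)
    moreover from this have "x \<in> U'" "y \<in> U'" using assms(5) assms(7)[of x y] by blast+
    ultimately show ?thesis by (simp add: R_def adjacent_induced adjacent_add_leaf[OF assms(1)])
  qed
  have "t \<in> U'" using assms(3-5) by blast
  then have st: "R s t"
    using assms(6) by (simp add: R_def adjacent_induced adjacent_add_leaf[OF assms(1)])
  have reach: "R\<^sup>*\<^sup>* u t" if "u \<in> verts (induced (add_leaf T s t) U')" for u
  proof (cases "u = s")
    case False
    then have "u \<in> verts (induced T U)" "t \<in> verts (induced T U)"
      using that assms(3-5) by (auto simp: verts_induced add_leaf_def)
    then have "(adjacent (induced T U))\<^sup>*\<^sup>* u t" using assms(2) unfolding connected_graph_def by blast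
    then show ?thesis by (rule mono_rtranclp[rule_format, rotated]) (rule mono)
  qed (use st in blast)
  have "R\<^sup>*\<^sup>* u v" if "u \<in> verts (induced (add_leaf T s t) U')"
    "v \<in> verts (induced (add_leaf T s t) U')" for u v
  proof -
    have "R\<^sup>*\<^sup>* t v" using reach[OF that(2)] sym by (simp add: symp_rtranclp sympD)
    then show ?thesis using reach[OF that(1)] by simp
  qed
  then show ?thesis unfolding connected_graph_def R_def by blast
qed

lemma induced_UNIV: "induced G UNIV = G"
  by (simp add: induced_def)

lemma tree_add_leaf:
  assumes T: "tree T" "ends T = (\<lambda>a. a)" and t: "t \<in> verts T" and s: "s \<notin> verts T"
  shows "tree (add_leaf T s t)"
proof -
  interpret multigraph T using T(1) by (simp add: tree_def)
  have "t \<noteq> s" using t s by blast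
  have mg: "multigraph (add_leaf T s t)"
    using finite_verts finite_edges ends_subset loopfree t s T(2) \<open>t \<noteq> s\<close>
    by unfold_locales (auto simp: add_leaf_def card_insert_if)
  have conn: "connected_graph (add_leaf T s t)"
  proof -
    have "connected_graph (induced (add_leaf T s t) UNIV)"
      by (rule connected_add_leaf[OF T(2), of UNIV])
        (use T(1) t in \<open>auto simp: induced_UNIV tree_def dest: adjacentD\<close>)
    then show ?thesis by (simp add: induced_UNIV)
  qed
  have par: "\<not> parallel (add_leaf T s t) u v" for u v
  proof -
    have "joining (add_leaf T s t) u v \<subseteq> {{u, v}}" by (auto simp: joining_def add_leaf_def)
    then have "card (joining (add_leaf T s t) u v) \<le> card {{u, v}}" by (intro card_mono) auto
    then show ?thesis by (simp add: parallel_def)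
  qed
  have "\<not> graph_cycle (add_leaf T s t) cs" for cs
  proof
    assume c: "graph_cycle (add_leaf T s t) cs"
    define n where "n = length cs"
    have n: "n \<ge> 3" "distinct cs"
      and adj: "\<And>k. k < n \<Longrightarrow> adjacent (add_leaf T s t) (cs ! k) (cs ! (Suc k mod n))"
      using c by (auto simp: graph_cycle_def n_def)
    have nb: "x = t" if "adjacent (add_leaf T s t) s x \<or> adjacent (add_leaf T s t) x s" for x
      using that s T(2) by (auto simp: adjacent_add_leaf dest: adjacentD)
    show False
    proof (cases "s \<in> set cs")
      case False
      have "adjacent T (cs ! k) (cs ! (Suc k mod n))" if "k < n" for k
      proof -
        have "Suc k mod n < n" using n by simp
        then have "cs ! k \<noteq> s" "cs ! (Suc k mod n) \<noteq> s"
          using False that nth_mem unfolding n_def by metis+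
        then show ?thesis using adj[OF that] T(2) by (auto simp: adjacent_add_leaf)
      qed
      then have "graph_cycle T cs"
        using c False by (auto simp: graph_cycle_def n_def add_leaf_def)
      then show False using T(1) by (simp add: tree_def)
    next
      case True
      \<comment> \<open>The predecessor \<open>j\<close> and the successor of \<open>s\<close> on
        the cycle both carry \<open>t\<close>, which is impossible for at least three distinct
        vertices.\<close>
      then obtain k where k: "k < n" "cs ! k = s" unfolding n_def by (metis in_set_conv_nth)
      define j where "j = (if k = 0 then n - 1 else k - 1)"
      have j: "j < n" "Suc j mod n = k" using k n by (auto simp: j_def)
      have "cs ! (Suc k mod n) = t" using adj[OF k(1)] nb k(2) by auto
      moreover have "cs ! j = t" using adj[OF j(1)] nb k(2) j(2) by auto
      moreover have "Suc k mod n < n" using n by simp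
      ultimately have "Suc k mod n = j"
        using n(2) j(1) unfolding n_def by (metis nth_eq_iff_index_eq)
      then show False using n(1) k(1) unfolding j_def
        by (cases "Suc k = n") (auto split: if_splits)
    qed
  qed
  then show ?thesis using mg conn par by (simp add: tree_def)
qed

text \<open>Edges are their own end pairs, so a new tree edge needs no fresh name. Bags that are
  cliques keep the width below the clique number.\<close>

definition clique_tree ::
  "('v \<Rightarrow> 'v \<Rightarrow> bool) \<Rightarrow> 'v set \<Rightarrow> ('t, 't set) pre_multigraph \<Rightarrow> ('t \<Rightarrow> 'v set) \<Rightarrow> bool" where
  "clique_tree adj V T B \<longleftrightarrow> tree T \<and> ends T = (\<lambda>a. a) \<and>
    (\<Union>t\<in>verts T. B t) = V \<and> (\<forall>t\<in>verts T. cliq adj (B t)) \<and>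
    (\<forall>u\<in>V. \<forall>v\<in>V. adj u v \<longrightarrow> (\<exists>t\<in>verts T. u \<in> B t \<and> v \<in> B t)) \<and>
    (\<forall>v\<in>V. connected_graph (induced T {t. v \<in> B t}))"

lemma clique_treeD:
  assumes "clique_tree adj V T B"
  shows "tree T" "ends T = (\<lambda>a. a)" "(\<Union>t\<in>verts T. B t) = V"
    "\<And>t. t \<in> verts T \<Longrightarrow> cliq adj (B t)"
    "\<And>u v. u \<in> V \<Longrightarrow> v \<in> V \<Longrightarrow> adj u v \<Longrightarrow> \<exists>t\<in>verts T. u \<in> B t \<and> v \<in> B t"
    "\<And>v. v \<in> V \<Longrightarrow> connected_graph (induced T {t. v \<in> B t})"
  using assms by (simp_all add: clique_tree_def)

text \<open>The earlier neighbours \<open>N\<close> of an added vertex \<open>v\<close> form a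
  clique, so by the Helly property some bag contains them all; a leaf with the bag
  \<open>insert v N\<close> is attached there.\<close>

lemma clique_tree_exists:
  assumes "elim_from adj {r} V" and sym: "symp adj"
  shows "\<exists>(T :: (nat, nat set) pre_multigraph) B. clique_tree adj V T B"
  using assms(1)
proof (induction rule: elim_from.induct)
  case base
  let ?T = "\<lparr>verts = {0}, edges = {}, ends = (\<lambda>a. a)\<rparr> :: (nat, nat set) pre_multigraph"
  have [simp]: "joining ?T u v = {}" for u v by (simp add: joining_def)
  have "tree ?T"
    by (auto simp: tree_def multigraph_def connected_graph_def parallel_def graph_cycle_def adjacent_def)
      (metis gr_zeroI length_greater_0_conv list.size(3) not_numeral_le_zero)
  then show ?case
    by (intro exI[of _ ?T] exI[of _ "\<lambda>_. {r}"])
      (auto simp: clique_tree_def cliq_def connected_graph_def verts_induced)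
next
  case (step V v)
  then obtain T :: "(nat, nat set) pre_multigraph" and B where "clique_tree adj V T B" by blast
  note T = clique_treeD(1,2)[OF this] and B = clique_treeD(3-6)[OF this]
  interpret multigraph T using T(1) by (simp add: tree_def)
  define N where "N = {u\<in>V. adj v u}"
  have "\<exists>t\<in>verts T. N \<subseteq> B t"
  proof (rule tree_bag_contains_pairwise_covered[OF T(1)])
    fix u w assume uw: "u \<in> N" "w \<in> N"
    show "\<exists>t\<in>verts T. u \<in> B t \<and> w \<in> B t"
    proof (cases "u = w")
      case True
      then show ?thesis using uw B(1) unfolding N_def by blast
    next
      case False
      then have "adj u w" using cliqD[OF step.hyps(3), of u w] uw by (simp add: N_def)
      then show ?thesis using B(3) uw unfolding N_def by blast
    qed
  qed (use B(4) in \<open>auto simp: N_def\<close>)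
  then obtain t where t: "t \<in> verts T" "N \<subseteq> B t" by blast
  obtain s where s: "s \<notin> verts T" using ex_new_if_finite[OF infinite_UNIV_nat finite_verts] by blast
  define T' where "T' = add_leaf T s t"
  define B' where "B' = B(s := insert v N)"
  have V': "verts T' = insert s (verts T)" by (simp add: T'_def add_leaf_def)
  have Bs: "B' s = insert v N" by (simp add: B'_def)
  have BT: "B' x = B x" if "x \<in> verts T" for x using that s by (auto simp: B'_def)
  have vB: "v \<notin> B x" if "x \<in> verts T" for x using that B(1) step.hyps(2) by blast
  have "tree T'" unfolding T'_def by (rule tree_add_leaf[OF T t(1) s])
  moreover have "ends T' = (\<lambda>a. a)" by (simp add: T'_def add_leaf_def)
  moreover have "(\<Union>t\<in>verts T'. B' t) = insert v V"
    using B(1) BT by (auto simp: V' Bs N_def)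
  moreover have "cliq adj (B' x)" if "x \<in> verts T'" for x
  proof (cases "x = s")
    case True
    have "cliq adj (insert v N)"
    proof (rule cliqI)
      fix u w assume uw: "u \<in> insert v N" "w \<in> insert v N" "u \<noteq> w"
      show "adj u w"
        using uw cliqD[OF step.hyps(3), of u w] sympD[OF sym, of v u] by (auto simp: N_def)
    qed
    then show ?thesis using True Bs by simp
  next
    case False
    then show ?thesis using that B(2)[of x] BT[of x] by (simp add: V')
  qed
  moreover have "\<exists>t\<in>verts T'. u \<in> B' t \<and> w \<in> B' t"
    if uw: "u \<in> insert v V" "w \<in> insert v V" "adj u w" for u w
  proof (cases "u \<in> V \<and> w \<in> V")
    case True
    then obtain x where "x \<in> verts T" "u \<in> B x" "w \<in> B x" using B(3) uw(3) by blast
    then show ?thesis using BT V' by auto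
  next
    case False
    then have "u \<in> insert v N \<and> w \<in> insert v N"
      using uw sympD[OF sym uw(3)] unfolding N_def by blast
    then show ?thesis using V' Bs by blast
  qed
  moreover have "connected_graph (induced T' {t. u \<in> B' t})" if "u \<in> insert v V" for u
  proof (cases "u \<in> insert v N")
    case False
    then have "u \<in> V" using that by blast
    have eq: "verts (induced T' {t. u \<in> B' t}) = verts (induced T {t. u \<in> B t})"
      using False BT Bs s by (auto simp: verts_induced V')
    have mono: "adjacent (induced T {t. u \<in> B t}) x y \<longrightarrow> adjacent (induced T' {t. u \<in> B' t}) x y" for x y
      using BT T(2) unfolding T'_def
      by (auto simp: adjacent_induced adjacent_add_leaf dest: adjacentD)
    show ?thesis
      using B(4)[OF \<open>u \<in> V\<close>] mono_rtranclp[of "adjacent (induced T {t. u \<in> B t})"] mono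
      unfolding connected_graph_def eq by blast
  next
    case True
    show ?thesis
    proof (cases "u = v")
      case True
      then have "verts (induced T' {t. u \<in> B' t}) = {s}"
        using BT vB Bs by (auto simp: verts_induced V')
      then show ?thesis by (simp add: connected_graph_def)
    next
      case False
      then have u: "u \<in> N" using True by blast
      show ?thesis unfolding T'_def
      proof (rule connected_add_leaf[OF T(2)])
        show "connected_graph (induced T {t. u \<in> B t})" using B(4) u by (simp add: N_def)
        show "verts T \<inter> {t. u \<in> B' t} = verts T \<inter> {t. u \<in> B t}" using BT by auto
      qed (use t u Bs in \<open>auto dest: adjacentD\<close>)
    qed
  qed
  ultimately show ?case unfolding clique_tree_def
    by (intro exI[of _ T'] exI[of _ B'] conjI ballI impI) simp_all
qed

lemma (in multigraph) exists_maximum_clique: "\<exists>C. maximum_clique G C"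
proof -
  have "clique G {}" by (simp add: clique_def)
  moreover have "\<forall>D. clique G D \<longrightarrow> card D < Suc (card (verts G))"
    using finite_verts by (auto simp: clique_def less_Suc_eq_le intro: card_mono)
  ultimately have "\<exists>C. clique G C \<and> (\<forall>D. clique G D \<longrightarrow> card D \<le> card C)"
    by (rule ex_has_greatest_nat)
  then show ?thesis by (simp add: maximum_clique_def)
qed

lemma (in multigraph) chordal_elim:
  assumes "chordal G" "clique G K"
  shows "elim_from (adjacent G) K (verts G)"
  using assms chordal_elim_from[OF finite_verts chordal_imp_chordal_on symp_adjacent not_adjacent_self]
  by (simp add: clique_iff)

text \<open>A clique tree attains the bound because each of its bags is a clique, and no
  decomposition beats it because some bag contains \<open>C\<close>.\<close>

theorem (in multigraph) chordal_treewidth: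
  assumes "chordal G" "maximum_clique G C"
  shows "tw G = card C - 1"
  unfolding tw_def treewidth_def
proof (rule Least_equality)
  have C: "clique G C" using assms(2) by (simp add: maximum_clique_def)
  have le: "card D \<le> card C" if "clique G D" for D
    using assms(2) that by (simp add: maximum_clique_def)
  obtain r where r: "r \<in> verts G" using verts_nonempty by blast
  have fin: "finite D" if "clique G D" for D
    using that finite_verts finite_subset by (auto simp: clique_def)
  have "clique G {r}" using r by (simp add: clique_def)
  from clique_tree_exists[OF chordal_elim[OF assms(1) this] symp_adjacent]
  obtain T :: "(nat, nat set) pre_multigraph" and B where "clique_tree (adjacent G) (verts G) T B"
    by blast
  note T = clique_treeD(1,2)[OF this] and B = clique_treeD(3-6)[OF this]
  interpret T: multigraph T using T(1) by (simp add: tree_def)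
  have td: "tree_decomposition (si G) T B"
    unfolding tree_decomposition_def
  proof (intro conjI ballI)
    fix e assume "e \<in> edges (si G)"
    then have "e \<in> ends G ` edges G" by (simp add: si_def)
    then obtain e' where e': "e' \<in> edges G" "e = ends G e'" by blast
    obtain i j where ij: "ends G e' = {i, j}" using loopfree[OF e'(1)] by (meson card_2_iff)
    then have a: "adjacent G i j" using e' by (auto simp: adjacent_def joining_def)
    obtain t where "t \<in> verts T" "i \<in> B t" "j \<in> B t"
      using B(3)[OF adjacentD(1,2)[OF a] a] by blast
    then show "\<exists>t\<in>verts T. ends (si G) e \<subseteq> B t" using ij e' by (auto simp: si_def)
  qed (use T B in \<open>simp_all add: si_def\<close>)
  have cl: "clique G (B t)" if "t \<in> verts T" for t using B that by (auto simp: clique_iff)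
  obtain t where t: "t \<in> verts T" "C \<subseteq> B t"
    using decomposition_bag_contains_clique[OF td C] by blast
  have "Max ((\<lambda>t. card (B t)) ` verts T) = card C"
  proof (rule Max_eqI)
    fix y assume "y \<in> (\<lambda>t. card (B t)) ` verts T"
    then obtain x where "x \<in> verts T" "y = card (B x)" by blast
    then show "y \<le> card C" using le[OF cl] by simp
  next
    have "card C = card (B t)"
      using card_mono[OF fin[OF cl[OF t(1)]] t(2)] le[OF cl[OF t(1)]] by simp
    then show "card C \<in> (\<lambda>t. card (B t)) ` verts T" using t by blast
  qed (use T.finite_verts in simp)
  then show "\<exists>(T :: (nat, nat set) pre_multigraph) B. tree_decomposition (si G) T B \<and>
      card C - 1 = decomposition_width T B"
    using td unfolding decomposition_width_def by metis
next
  fix w assume "\<exists>(T :: (nat, nat set) pre_multigraph) B. tree_decomposition (si G) T B \<and>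
      w = decomposition_width T B"
  then obtain T :: "(nat, nat set) pre_multigraph" and B
    where td: "tree_decomposition (si G) T B" and w: "w = decomposition_width T B" by blast
  interpret T: multigraph T using td by (simp add: tree_decomposition_def tree_def)
  have C: "clique G C" using assms(2) by (simp add: maximum_clique_def)
  obtain t where t: "t \<in> verts T" "C \<subseteq> B t"
    using decomposition_bag_contains_clique[OF td C] by blast
  have "B t \<subseteq> verts G" using td t(1) by (auto simp: tree_decomposition_def si_def)
  then have "card C \<le> card (B t)" using t(2) finite_verts finite_subset card_mono by metis
  also have "\<dots> \<le> Max ((\<lambda>t. card (B t)) ` verts T)" using t(1) T.finite_verts by (intro Max_ge) auto
  finally show "card C - 1 \<le> w" by (simp add: w decomposition_width_def)
qed

section \<open>Isometric placements of cliques\<close>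

definition ip :: "nat \<Rightarrow> (nat \<Rightarrow> real) \<Rightarrow> (nat \<Rightarrow> real) \<Rightarrow> real" where
  "ip m x y = (\<Sum>k<m. x k * y k)"

definition sqd :: "nat \<Rightarrow> (nat \<Rightarrow> real) \<Rightarrow> (nat \<Rightarrow> real) \<Rightarrow> real" where
  "sqd m x y = (\<Sum>k<m. (x k - y k)\<^sup>2)"

lemma point_dist_sqd: "point_dist m x y = sqrt (sqd m x y)"
  by (simp add: point_dist_def L2_set_def sqd_def)

lemma sqd_commute: "sqd m x y = sqd m y x"
  by (simp add: sqd_def power2_commute)

lemma sqd_self: "sqd m x x = 0"
  by (simp add: sqd_def)

lemma coord_spaceD: "x \<in> coord_space I \<Longrightarrow> i \<notin> I \<Longrightarrow> x i = 0"
  by (simp add: coord_space_def)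

lemma coord_space_mono: "x \<in> coord_space I \<Longrightarrow> I \<subseteq> J \<Longrightarrow> x \<in> coord_space J"
  by (auto simp: coord_space_def)

lemma sqd_pos:
  assumes "x \<in> coord_space {..<m}" "y \<in> coord_space {..<m}" "x \<noteq> y"
  shows "0 < sqd m x y"
proof -
  obtain k where k: "x k \<noteq> y k" using assms(3) by blast
  then have "k < m" using coord_spaceD[OF assms(1)] coord_spaceD[OF assms(2)]
    by (metis lessThan_iff)
  then show ?thesis unfolding sqd_def
    by (intro sum_pos2[of _ k]) (use k in auto)
qed

lemma sqd_cong_dim:
  assumes "x \<in> coord_space {..<r}" "y \<in> coord_space {..<r}" "r \<le> m"
  shows "sqd m x y = sqd r x y"
  unfolding sqd_def using assms
  by (intro sum.mono_neutral_right) (auto simp: coord_space_def)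

text \<open>An isometry for \<open>S\<close> is corrected for one more point by the reflection that
  exchanges \<open>f (a s)\<close> and \<open>b s\<close>. The points \<open>b i\<close> with
  \<open>i \<in> S\<close> have the same distance from both, so they lie on the mirror and stay
  fixed.\<close>

lemma congruent_families_extension:
  assumes "finite S"
    and "\<And>i. i \<in> S \<Longrightarrow> a i \<in> coord_space {..<D} \<and> b i \<in> coord_space {..<D}"
    and "\<And>i j. i \<in> S \<Longrightarrow> j \<in> S \<Longrightarrow> sqd D (a i) (a j) = sqd D (b i) (b j)"
  shows "\<exists>f. (\<forall>x\<in>coord_space {..<D}. f x \<in> coord_space {..<D}) \<and>
    (\<forall>x\<in>coord_space {..<D}. \<forall>y\<in>coord_space {..<D}. sqd D (f x) (f y) = sqd D x y) \<and>
    (\<forall>i\<in>S. f (a i) = b i)"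
  using assms
proof (induction S rule: finite_induct)
  case empty
  show ?case by (intro exI[of _ id]) simp
next
  case (insert s S)
  define E where "E = coord_space {..<D}"
  have "\<exists>f. (\<forall>x\<in>E. f x \<in> E) \<and> (\<forall>x\<in>E. \<forall>y\<in>E. sqd D (f x) (f y) = sqd D x y) \<and>
    (\<forall>i\<in>S. f (a i) = b i)"
    unfolding E_def using insert.prems by (intro insert.IH) simp_all
  then obtain f where f: "\<And>x. x \<in> E \<Longrightarrow> f x \<in> E" "\<And>i. i \<in> S \<Longrightarrow> f (a i) = b i"
    and iso: "\<And>x y. x \<in> E \<Longrightarrow> y \<in> E \<Longrightarrow> sqd D (f x) (f y) = sqd D x y"
    by metis
  have E: "a s \<in> E" "b s \<in> E" using insert.prems(1)[of s] by (simp_all add: E_def)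
  define u v where "u = f (a s)" and "v = b s"
  have uv: "u \<in> E" "v \<in> E" using f(1) E by (simp_all add: u_def v_def)
  show ?case
  proof (cases "u = v")
    case True
    then show ?thesis using f iso
      by (intro exI[of _ f]) (auto simp: u_def v_def E_def)
  next
    case False
    then have pos: "sqd D u v > 0" using sqd_pos uv unfolding E_def by blast
    \<comment> \<open>\<open>r\<close> is the reflection in the perpendicular bisector of
      \<open>u\<close> and \<open>v\<close>; \<open>c x\<close> is its coefficient along
      \<open>u - v\<close>, written with squared distances.\<close>
    define c where "c x = (sqd D x v - sqd D x u) / sqd D u v" for x
    define r where "r x = (\<lambda>k. x k - c x * (u k - v k))" for x
    have rE: "r x \<in> E" if "x \<in> E" for x
      using that uv by (auto simp: E_def coord_space_def r_def)
    have r_iso: "sqd D (r x) (r y) = sqd D x y" for x y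
    proof -
      define d where "d = c x - c y"
      define n where "n = (\<lambda>k. u k - v k)"
      define z where "z = (\<lambda>k. x k - y k)"
      have "d * sqd D u v = (sqd D x v - sqd D x u) - (sqd D y v - sqd D y u)"
        using pos by (simp add: d_def c_def field_simps)
      also have "\<dots> = (\<Sum>k<D. 2 * (z k * n k))"
        unfolding sqd_def sum_subtractf[symmetric]
        by (intro sum.cong refl) (simp add: z_def n_def power2_eq_square algebra_simps)
      finally have dn: "d * sqd D u v = 2 * (\<Sum>k<D. z k * n k)" by (simp add: sum_distrib_left)
      have "sqd D (r x) (r y) = (\<Sum>k<D. (z k)\<^sup>2 - 2 * d * (z k * n k) + d\<^sup>2 * (n k)\<^sup>2)"
        unfolding sqd_def
        by (intro sum.cong refl) (simp add: r_def z_def n_def d_def power2_eq_square algebra_simps)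
      also have "\<dots> = sqd D x y - 2 * d * (\<Sum>k<D. z k * n k) + d\<^sup>2 * sqd D u v"
        by (simp add: sum.distrib sum_subtractf sum_distrib_left sqd_def z_def n_def)
      also have "\<dots> = sqd D x y - d * (d * sqd D u v) + d\<^sup>2 * sqd D u v" using dn by simp
      finally show ?thesis by (simp add: power2_eq_square)
    qed
    have "c u = 1" using pos by (simp add: c_def sqd_self)
    then have "r u = v" by (auto simp: r_def)
    moreover have "r (b i) = b i" if i: "i \<in> S" for i
    proof -
      have "a i \<in> E" using insert.prems(1)[of i] i by (simp add: E_def)
      then have "sqd D (b i) u = sqd D (a i) (a s)"
        using iso[of "a i" "a s"] E f(2)[OF i] by (simp add: u_def)
      also have "\<dots> = sqd D (b i) v" using insert.prems(2)[of i s] i by (simp add: v_def)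
      finally show ?thesis by (simp add: r_def c_def)
    qed
    ultimately show ?thesis
      using f iso rE r_iso
      by (intro exI[of _ "r \<circ> f"]) (auto simp: u_def v_def E_def)
  qed
qed

definition placeable :: "nat \<Rightarrow> ('v \<Rightarrow> 'v \<Rightarrow> real) \<Rightarrow> 'v set \<Rightarrow> bool" where
  "placeable D \<delta> C \<longleftrightarrow> (\<exists>q. (\<forall>i\<in>C. q i \<in> coord_space {..<D}) \<and>
     (\<forall>i\<in>C. \<forall>j\<in>C. sqd D (q i) (q j) = \<delta> i j))"

lemma placeable_mono: "placeable D \<delta> C \<Longrightarrow> C' \<subseteq> C \<Longrightarrow> placeable D \<delta> C'"
  unfolding placeable_def by (meson subsetD)

text \<open>The clique formed by the new vertex and its neighbours \<open>N\<close> is placed on its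
  own and then moved by an isometry that takes its copy of \<open>N\<close> to the one already
  present; the two copies are congruent since both realize \<open>\<delta>\<close>.\<close>

lemma glue_clique_placements:
  assumes "elim_from adj {} V"
    and "\<forall>C. C \<subseteq> V \<longrightarrow> cliq adj C \<longrightarrow> placeable D \<delta> C" and sym: "symp adj"
  shows "\<exists>q. (\<forall>i\<in>V. q i \<in> coord_space {..<D}) \<and>
     (\<forall>i\<in>V. \<forall>j\<in>V. adj i j \<longrightarrow> sqd D (q i) (q j) = \<delta> i j)"
  using assms(1,2)
proof (induction rule: elim_from.induct)
  case base
  show ?case by simp
next
  case (step V v)
  define E where "E = coord_space {..<D}"
  define N where "N = {u\<in>V. adj v u}"
  have "\<forall>C. C \<subseteq> V \<longrightarrow> cliq adj C \<longrightarrow> placeable D \<delta> C" using step.prems by auto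
  from step.IH[OF this] obtain q where
    "(\<forall>i\<in>V. q i \<in> E) \<and> (\<forall>i\<in>V. \<forall>j\<in>V. adj i j \<longrightarrow> sqd D (q i) (q j) = \<delta> i j)"
    unfolding E_def by (elim exE) simp
  then have q: "\<And>i. i \<in> V \<Longrightarrow> q i \<in> E"
    "\<And>i j. i \<in> V \<Longrightarrow> j \<in> V \<Longrightarrow> adj i j \<Longrightarrow> sqd D (q i) (q j) = \<delta> i j"
    by simp_all
  have "cliq adj (insert v N)"
  proof (rule cliqI)
    fix u w assume uw: "u \<in> insert v N" "w \<in> insert v N" "u \<noteq> w"
    show "adj u w"
      using uw cliqD[OF step.hyps(3), of u w] sympD[OF sym, of v u] by (auto simp: N_def)
  qed
  moreover have "insert v N \<subseteq> insert v V" by (auto simp: N_def)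
  ultimately have "placeable D \<delta> (insert v N)" using step.prems by blast
  then obtain r where "(\<forall>i\<in>insert v N. r i \<in> E) \<and>
    (\<forall>i\<in>insert v N. \<forall>j\<in>insert v N. sqd D (r i) (r j) = \<delta> i j)"
    unfolding placeable_def E_def by (elim exE) simp
  then have r: "\<And>i. i \<in> insert v N \<Longrightarrow> r i \<in> E"
    "\<And>i j. i \<in> insert v N \<Longrightarrow> j \<in> insert v N \<Longrightarrow> sqd D (r i) (r j) = \<delta> i j"
    by blast+
  have "finite N" using elim_from_finite[OF step.hyps(1)] by (simp add: N_def)
  moreover have "sqd D (r i) (r j) = sqd D (q i) (q j)" if "i \<in> N" "j \<in> N" for i j
  proof (cases "i = j")
    case False
    then have "adj i j" using cliqD[OF step.hyps(3), of i j] that by (simp add: N_def)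
    then show ?thesis using q(2)[of i j] r(2)[of i j] that by (simp add: N_def)
  qed (simp add: sqd_self)
  moreover have "r i \<in> coord_space {..<D} \<and> q i \<in> coord_space {..<D}" if "i \<in> N" for i
    using r(1) q(1) that by (simp add: E_def N_def)
  ultimately have "\<exists>f. (\<forall>x\<in>coord_space {..<D}. f x \<in> coord_space {..<D}) \<and>
    (\<forall>x\<in>coord_space {..<D}. \<forall>y\<in>coord_space {..<D}. sqd D (f x) (f y) = sqd D x y) \<and>
    (\<forall>i\<in>N. f (r i) = q i)"
    using congruent_families_extension[of N r D q] by blast
  then obtain f where "(\<forall>x\<in>E. f x \<in> E) \<and> (\<forall>x\<in>E. \<forall>y\<in>E. sqd D (f x) (f y) = sqd D x y) \<and>
    (\<forall>i\<in>N. f (r i) = q i)"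
    unfolding E_def by (elim exE) simp
  then have f: "\<And>x. x \<in> E \<Longrightarrow> f x \<in> E" "\<And>i. i \<in> N \<Longrightarrow> f (r i) = q i"
    and iso: "\<And>x y. x \<in> E \<Longrightarrow> y \<in> E \<Longrightarrow> sqd D (f x) (f y) = sqd D x y"
    by simp_all
  define q' where "q' = q(v := f (r v))"
  have q'V: "q' i = q i" if "i \<in> V" for i using that step.hyps(2) by (auto simp: q'_def)
  have q'v: "q' v = f (r v)" by (simp add: q'_def)
  have vi: "sqd D (q' v) (q' i) = \<delta> v i" "sqd D (q' i) (q' v) = \<delta> i v" if i: "i \<in> N" for i
  proof -
    have "q' i = f (r i)" using q'V[of i] f(2)[OF i] i by (simp add: N_def)
    then show "sqd D (q' v) (q' i) = \<delta> v i" "sqd D (q' i) (q' v) = \<delta> i v"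
      using q'v iso r i by simp_all
  qed
  have vv: "sqd D (q' v) (q' v) = \<delta> v v" using r(2)[of v v] by (simp add: sqd_self)
  have "sqd D (q' i) (q' j) = \<delta> i j" if ij: "i \<in> insert v V" "j \<in> insert v V" "adj i j" for i j
  proof -
    consider "i = v" "j = v" | "i = v" "j \<in> N" | "j = v" "i \<in> N" | "i \<in> V" "j \<in> V"
      using ij sympD[OF sym ij(3)] by (auto simp: N_def)
    then show ?thesis using vi vv q(2)[OF _ _ ij(3)] q'V by cases simp_all
  qed
  moreover have "q' i \<in> E" if "i \<in> insert v V" for i
    using that q(1) q'V q'v f(1) r(1)[of v] by (cases "i = v") auto
  ultimately show ?case unfolding E_def by (intro exI[of _ q']) simp
qed

section \<open>Orthogonal coordinates along a hinge\<close>

definition orthonormal_expansion ::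
  "nat \<Rightarrow> (nat \<Rightarrow> real) set \<Rightarrow> nat \<Rightarrow> (nat \<Rightarrow> nat \<Rightarrow> real) \<Rightarrow> bool" where
  "orthonormal_expansion m F r b \<longleftrightarrow> (\<forall>k<r. b k \<in> coord_space {..<m}) \<and>
    (\<forall>k<r. \<forall>l<r. ip m (b k) (b l) = (if k = l then 1 else 0)) \<and>
    (\<forall>x\<in>F. \<forall>j. x j = (\<Sum>k<r. ip m x (b k) * b k j))"

text \<open>Gram-Schmidt: the residual \<open>e\<close> of a new vector either vanishes or is
  normalized and appended, so at most one basis vector is spent per element of
  \<open>F\<close>.\<close>

lemma orthonormal_system:
  assumes "finite F" "F \<subseteq> coord_space {..<m}"
  shows "\<exists>r b. r \<le> card F \<and> orthonormal_expansion m F r b"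
  using assms
proof (induction F rule: finite_induct)
  case empty
  show ?case by (intro exI[of _ 0]) (simp add: orthonormal_expansion_def)
next
  case (insert x F)
  then obtain r b where r: "r \<le> card F" and *: "orthonormal_expansion m F r b" by auto
  from * have bE: "\<And>k. k < r \<Longrightarrow> b k \<in> coord_space {..<m}"
    and orth: "\<And>k l. k < r \<Longrightarrow> l < r \<Longrightarrow> ip m (b k) (b l) = (if k = l then 1 else 0)"
    and sp: "\<And>y j. y \<in> F \<Longrightarrow> y j = (\<Sum>k<r. ip m y (b k) * b k j)"
    by (simp_all only: orthonormal_expansion_def)
  define e where "e = (\<lambda>j. x j - (\<Sum>k<r. ip m x (b k) * b k j))"
  have eE: "e \<in> coord_space {..<m}"
    using insert.prems bE by (auto simp: e_def coord_space_def)
  have eb: "ip m e (b l) = 0" if "l < r" for l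
  proof -
    have "ip m e (b l) = ip m x (b l) - (\<Sum>j<m. \<Sum>k<r. ip m x (b k) * (b k j * b l j))"
      by (simp add: e_def ip_def left_diff_distrib sum_subtractf sum_distrib_right mult.assoc)
    also have "(\<Sum>j<m. \<Sum>k<r. ip m x (b k) * (b k j * b l j)) = (\<Sum>k<r. ip m x (b k) * ip m (b k) (b l))"
      by (subst sum.swap) (simp add: ip_def sum_distrib_left)
    also have "\<dots> = (\<Sum>k<r. if k = l then ip m x (b k) else 0)"
      using orth that by (intro sum.cong) auto
    also have "\<dots> = ip m x (b l)" using that by simp
    finally show ?thesis by simp
  qed
  have ye: "ip m y e = (\<Sum>k<r. c k * ip m (b k) e)" if "\<And>j. y j = (\<Sum>k<r. c k * b k j)" for y c
  proof -
    have "ip m y e = (\<Sum>j<m. \<Sum>k<r. c k * (b k j * e j))"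
      by (simp add: ip_def that sum_distrib_right mult.assoc)
    then show ?thesis by (subst (asm) sum.swap) (simp add: ip_def sum_distrib_left)
  qed
  have ipc: "ip m y z = ip m z y" for y z by (simp add: ip_def mult.commute)
  have z0: "ip m y e = 0" if "\<And>j. y j = (\<Sum>k<r. c k * b k j)" for y c
    using ye[of y c] that eb ipc by simp
  show ?case
  proof (cases "\<forall>j. e j = 0")
    case True
    then have "x j = (\<Sum>k<r. ip m x (b k) * b k j)" for j by (simp add: e_def)
    then have "orthonormal_expansion m (insert x F) r b"
      using * by (auto simp only: orthonormal_expansion_def)
    then show ?thesis using r insert.hyps
      by (intro exI[of _ r] exI[of _ b]) simp
  next
    case False
    have "ip m e e \<noteq> 0"
    proof
      assume "ip m e e = 0"
      then have "e j = 0" if "j < m" for j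
        using that by (simp add: ip_def sum_nonneg_eq_0_iff)
      then show False using False eE by (metis coord_spaceD lessThan_iff)
    qed
    moreover have "ip m e e \<ge> 0" by (simp add: ip_def sum_nonneg)
    ultimately have pos: "ip m e e > 0" by simp
    define n where "n = sqrt (ip m e e)"
    have n: "n > 0" "n * n = ip m e e" using pos by (simp_all add: n_def)
    define b' where "b' = b(r := (\<lambda>j. e j / n))"
    have b'b: "b' k = b k" if "k < r" for k using that by (simp add: b'_def)
    have b'r: "b' r = (\<lambda>j. e j / n)" by (simp add: b'_def)
    have ipr: "ip m y (b' r) = ip m y e / n" for y
      by (simp add: b'r ip_def sum_divide_distrib)
    have xe: "ip m x e = ip m e e"
    proof -
      have "ip m e e = ip m x e - ip m (\<lambda>j. \<Sum>k<r. ip m x (b k) * b k j) e"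
        unfolding ip_def[of m e e] ip_def[of m x e] ip_def[of m "\<lambda>j. \<Sum>k<r. ip m x (b k) * b k j"]
        by (simp add: e_def left_diff_distrib sum_subtractf)
      then show ?thesis using z0[of "\<lambda>j. \<Sum>k<r. ip m x (b k) * b k j"] by simp
    qed
    show ?thesis
      unfolding orthonormal_expansion_def
    proof (intro exI[of _ "Suc r"] exI[of _ b'] conjI allI impI ballI)
      show "Suc r \<le> card (insert x F)" using r insert.hyps by simp
    next
      fix k assume "k < Suc r"
      then show "b' k \<in> coord_space {..<m}"
        using bE b'b eE by (cases "k = r") (auto simp: b'r coord_space_def less_Suc_eq)
    next
      fix k l assume kl: "k < Suc r" "l < Suc r"
      have br: "ip m (b k) (b' r) = 0" if "k < r" for k
        unfolding ipr ipc[of "b k" e] using eb[OF that] by simp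
      then have rb: "ip m (b' r) (b k) = 0" if "k < r" for k
        using that unfolding ipc[of "b' r" "b k"] by blast
      have rr: "ip m (b' r) (b' r) = 1"
        unfolding ipr ipc[of "b' r" e] n(2)[symmetric] using n(1) by simp
      consider "k < r" "l < r" | "k = r" "l < r" | "k < r" "l = r" | "k = r" "l = r"
        using kl by linarith
      then show "ip m (b' k) (b' l) = (if k = l then 1 else 0)"
        using orth b'b br rb rr by cases simp_all
    next
      fix y j assume y: "y \<in> insert x F"
      show "y j = (\<Sum>k<Suc r. ip m y (b' k) * b' k j)"
      proof (cases "y \<in> F")
        case True
        then have "ip m y e = 0" using z0[of y "\<lambda>k. ip m y (b k)"] sp by blast
        then show ?thesis using sp[OF True, of j] by (simp add: b'b ipr)
      next
        case False
        then have "y = x" using y by simp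
        have "ip m x (b' r) * b' r j = (n * n) / n * (e j / n)" by (simp only: ipr xe n(2)) (simp add: b'r)
        also have "\<dots> = e j" using n(1) by simp
        finally show ?thesis using \<open>y = x\<close> by (simp add: b'b) (simp add: e_def)
      qed
    qed
  qed
qed

text \<open>\<open>c\<close> holds coordinates along the affine span of \<open>H\<close> and
  \<open>e\<close> the orthogonal residual, so Pythagoras splits the squared distances. The bound on
  \<open>r\<close> is strict because distances are measured from \<open>h0\<close>, which leaves
  only \<open>card H - 1\<close> differences to be spanned.\<close>

lemma orthogonal_decomposition:
  fixes x :: "'v \<Rightarrow> nat \<Rightarrow> real"
  assumes "finite H" "h0 \<in> H" "H \<subseteq> I" and x: "\<forall>i\<in>I. x i \<in> coord_space {..<m}"
  shows "\<exists>c e r. r < card H \<and> (\<forall>i\<in>I. c i \<in> coord_space {..<r}) \<and> (\<forall>h\<in>H. e h = (\<lambda>_. 0)) \<and>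
    (\<forall>i\<in>I. \<forall>j\<in>I. sqd m (x i) (x j) = sqd r (c i) (c j) + sqd m (e i) (e j))"
proof -
  define y where "y i = (\<lambda>k. x i k - x h0 k)" for i
  define F where "F = y ` (H - {h0})"
  have "y h \<in> coord_space {..<m}" if "h \<in> H" for h
  proof -
    have "x h \<in> coord_space {..<m}" "x h0 \<in> coord_space {..<m}" using x assms(2,3) that by auto
    then show ?thesis by (simp add: y_def coord_space_def)
  qed
  then have "F \<subseteq> coord_space {..<m}" by (auto simp: F_def)
  moreover have finF: "finite F" using assms(1) by (simp add: F_def)
  ultimately obtain r b where r: "r \<le> card F" and "orthonormal_expansion m F r b"
    using orthonormal_system by blast
  then have orth: "\<And>k l. k < r \<Longrightarrow> l < r \<Longrightarrow> ip m (b k) (b l) = (if k = l then 1 else 0)"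
    and sp: "\<And>y j. y \<in> F \<Longrightarrow> y j = (\<Sum>k<r. ip m y (b k) * b k j)"
    by (simp_all only: orthonormal_expansion_def)
  have "card F \<le> card (H - {h0})" unfolding F_def using assms(1) by (intro card_image_le) simp
  also have "\<dots> < card H" using assms(1,2) by (meson card_Diff1_less)
  finally have rc: "r < card H" using r by simp
  define c where "c i = (\<lambda>k. if k < r then ip m (y i) (b k) else 0)" for i
  define e where "e i = (\<lambda>j. y i j - (\<Sum>k<r. ip m (y i) (b k) * b k j))" for i
  have e0: "e h = (\<lambda>_. 0)" if "h \<in> H" for h
  proof (cases "h = h0")
    case True
    then show ?thesis by (simp add: e_def y_def ip_def)
  next
    case False
    then have "y h \<in> F" using that by (simp add: F_def)
    then show ?thesis using sp by (auto simp: e_def)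
  qed
  have "sqd m (x i) (x j) = sqd r (c i) (c j) + sqd m (e i) (e j)" for i j
  proof -
    define z where "z k = x i k - x j k" for k
    define d where "d k = ip m z (b k)" for k
    have d: "ip m (y i) (b k) - ip m (y j) (b k) = d k" for k
      by (simp add: d_def ip_def y_def z_def left_diff_distrib sum_subtractf)
    have eij: "e i l - e j l = z l - (\<Sum>k<r. d k * b k l)" for l
      unfolding d[symmetric]
      by (simp add: e_def z_def y_def left_diff_distrib sum_subtractf)
    define P where "P l = (\<Sum>k<r. d k * b k l)" for l
    have zP: "(\<Sum>l<m. z l * P l) = (\<Sum>k<r. (d k)\<^sup>2)"
    proof -
      have "(\<Sum>l<m. z l * P l) = (\<Sum>l<m. \<Sum>k<r. d k * (z l * b k l))"
        by (simp add: P_def sum_distrib_left mult.left_commute)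
      also have "\<dots> = (\<Sum>k<r. d k * ip m z (b k))"
        by (subst sum.swap) (simp add: ip_def sum_distrib_left)
      finally show ?thesis by (simp add: d_def[symmetric] power2_eq_square)
    qed
    have PP: "(\<Sum>l<m. P l * P l) = (\<Sum>k<r. (d k)\<^sup>2)"
    proof -
      have "ip m P (b k) = d k" if "k < r" for k
      proof -
        have "ip m P (b k) = (\<Sum>l<m. \<Sum>k'<r. d k' * (b k' l * b k l))"
          by (simp add: P_def ip_def sum_distrib_right mult.assoc)
        also have "\<dots> = (\<Sum>k'<r. d k' * ip m (b k') (b k))"
          by (subst sum.swap) (simp add: ip_def sum_distrib_left)
        also have "\<dots> = (\<Sum>k'<r. if k' = k then d k' else 0)"
          using orth that by (intro sum.cong) auto
        finally show ?thesis using that by simp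
      qed
      moreover have "(\<Sum>l<m. P l * P l) = (\<Sum>k<r. d k * ip m P (b k))"
      proof -
        have "(\<Sum>l<m. P l * P l) = (\<Sum>l<m. \<Sum>k<r. d k * (P l * b k l))"
          by (subst (2) P_def) (simp add: sum_distrib_left mult.left_commute)
        then show ?thesis by (subst (asm) sum.swap) (simp add: ip_def sum_distrib_left)
      qed
      ultimately show ?thesis by (simp add: power2_eq_square)
    qed
    have "sqd m (e i) (e j) = (\<Sum>l<m. z l * z l - 2 * (z l * P l) + P l * P l)"
      unfolding sqd_def eij P_def[symmetric]
      by (intro sum.cong refl) (simp add: power2_eq_square algebra_simps)
    also have "\<dots> = (\<Sum>l<m. z l * z l) - (\<Sum>k<r. (d k)\<^sup>2)"
      using zP PP by (simp add: sum.distrib sum_subtractf sum_distrib_left[symmetric])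
    finally have "sqd m (e i) (e j) = sqd m (x i) (x j) - (\<Sum>k<r. (d k)\<^sup>2)"
      by (simp add: sqd_def z_def power2_eq_square)
    moreover have "sqd r (c i) (c j) = (\<Sum>k<r. (d k)\<^sup>2)"
      unfolding sqd_def by (intro sum.cong refl) (simp add: c_def d)
    ultimately show ?thesis by simp
  qed
  then show ?thesis
    using rc e0 by (intro exI[of _ c] exI[of _ e] exI[of _ r]) (simp add: c_def coord_space_def)
qed

text \<open>With the hinge \<open>H = C\<close> all residuals vanish, and \<open>card C\<close>
  points have an affine span of dimension at most \<open>card C - 1\<close>.\<close>

lemma placeable_small:
  assumes "finite C" "card C \<le> Suc D" "\<forall>i\<in>C. x i \<in> coord_space {..<m}"
  shows "placeable D (\<lambda>i j. sqd m (x i) (x j)) C"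
proof (cases "C = {}")
  case True
  then show ?thesis by (simp add: placeable_def)
next
  case False
  then obtain h0 where "h0 \<in> C" by blast
  from orthogonal_decomposition[OF assms(1) this subset_refl assms(3)]
  obtain c e r where "r < card C \<and> (\<forall>i\<in>C. c i \<in> coord_space {..<r}) \<and> (\<forall>h\<in>C. e h = (\<lambda>_. 0)) \<and>
    (\<forall>i\<in>C. \<forall>j\<in>C. sqd m (x i) (x j) = sqd r (c i) (c j) + sqd m (e i) (e j))"
    by (elim exE)
  then have *: "r < card C" "\<forall>i\<in>C. c i \<in> coord_space {..<r}" "\<forall>h\<in>C. e h = (\<lambda>_. 0)"
    "\<forall>i\<in>C. \<forall>j\<in>C. sqd m (x i) (x j) = sqd r (c i) (c j) + sqd m (e i) (e j)"
    by simp_all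
  have "r \<le> D" using *(1) assms(2) by simp
  have "sqd D (c i) (c j) = sqd m (x i) (x j)" if "i \<in> C" "j \<in> C" for i j
    using * that sqd_cong_dim[OF _ _ \<open>r \<le> D\<close>, of "c i" "c j"] by (simp add: sqd_self)
  moreover have "c i \<in> coord_space {..<D}" if "i \<in> C" for i
    using *(2) that \<open>r \<le> D\<close> coord_space_mono[of "c i" "{..<r}" "{..<D}"] by auto
  ultimately show ?thesis unfolding placeable_def by (intro exI[of _ c]) simp
qed

text \<open>\<open>u\<close> and \<open>v\<close> are rotated about the span of \<open>H\<close> into a common hyperplane, to the same side
  of \<open>H\<close> or to opposite sides.\<close>

lemma hinge_folding:
  fixes x :: "'v \<Rightarrow> nat \<Rightarrow> real"
  assumes H: "finite H" "H \<noteq> {}" "card H \<le> D" and uv: "u \<notin> H" "v \<notin> H" "u \<noteq> v"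
    and x: "\<forall>i\<in>insert u (insert v H). x i \<in> coord_space {..<m}"
  shows "\<exists>q. (\<forall>i\<in>insert u (insert v H). q i \<in> coord_space {..<D}) \<and>
    (\<forall>i\<in>insert u (insert v H). \<forall>j\<in>insert u (insert v H). {i, j} \<noteq> {u, v} \<longrightarrow>
       sqd D (q i) (q j) = sqd m (x i) (x j)) \<and>
    (if s then sqd D (q u) (q v) \<le> sqd m (x u) (x v) else sqd m (x u) (x v) \<le> sqd D (q u) (q v))"
proof -
  define I where "I = insert u (insert v H)"
  obtain h0 where "h0 \<in> H" using H(2) by blast
  have "H \<subseteq> I" by (auto simp: I_def)
  from orthogonal_decomposition[OF H(1) \<open>h0 \<in> H\<close> this x[folded I_def]]
  obtain c :: "'v \<Rightarrow> nat \<Rightarrow> real" and e :: "'v \<Rightarrow> nat \<Rightarrow> real" and r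
    where *: "r < card H \<and> (\<forall>i\<in>I. c i \<in> coord_space {..<r}) \<and> (\<forall>h\<in>H. e h = (\<lambda>_. 0)) \<and>
    (\<forall>i\<in>I. \<forall>j\<in>I. sqd m (x i) (x j) = sqd r (c i) (c j) + sqd m (e i) (e j))"
    by (elim exE)
  then have r: "r < card H" and c: "\<And>i. i \<in> I \<Longrightarrow> c i \<in> coord_space {..<r}"
    and e0: "\<And>h. h \<in> H \<Longrightarrow> e h = (\<lambda>_. 0)"
    and dec: "\<And>i j. i \<in> I \<Longrightarrow> j \<in> I \<Longrightarrow> sqd m (x i) (x j) = sqd r (c i) (c j) + sqd m (e i) (e j)"
    by simp_all
  \<comment> \<open>\<open>l i\<close> is the distance of \<open>x i\<close> from the hinge. The
    folded point keeps its coordinates along the hinge and gets this distance, with a sign, as a new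
    coordinate of index \<open>r\<close>; it fits since \<open>r < card H\<close> and
    \<open>card H \<le> D\<close>.\<close>
  define l where "l i = L2_set (e i) {..<m}" for i
  define \<rho> where "\<rho> i = (if i = v \<and> \<not> s then - l i else l i)" for i
  define q where "q i = (c i)(r := \<rho> i)" for i
  have q: "q i \<in> coord_space {..<Suc r}" if "i \<in> I" for i
    using c[OF that] by (auto simp: q_def coord_space_def)
  have qD: "q i \<in> coord_space {..<D}" if "i \<in> I" for i
    using coord_space_mono[OF q[OF that]] r H(3) by simp
  have sq: "sqd D (q i) (q j) = sqd r (c i) (c j) + (\<rho> i - \<rho> j)\<^sup>2" if "i \<in> I" "j \<in> I" for i j
  proof -
    have "sqd D (q i) (q j) = sqd (Suc r) (q i) (q j)"
      using q that r H(3) by (intro sqd_cong_dim) simp_all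
    also have "\<dots> = sqd r (c i) (c j) + (\<rho> i - \<rho> j)\<^sup>2" by (simp add: sqd_def q_def)
    finally show ?thesis .
  qed
  have l2: "(l i)\<^sup>2 = (\<Sum>k<m. (e i k)\<^sup>2)" for i
    by (simp add: l_def L2_set_def sum_nonneg)
  have lH: "l h = 0" "\<rho> h = 0" if "h \<in> H" for h
    using e0[OF that] that uv(2) by (auto simp: l_def \<rho>_def L2_set_def)
  have \<rho>2: "(\<rho> i)\<^sup>2 = (l i)\<^sup>2" for i by (simp add: \<rho>_def)
  have "sqd D (q i) (q j) = sqd m (x i) (x j)" if ij: "i \<in> I" "j \<in> I" "{i, j} \<noteq> {u, v}" for i j
  proof -
    consider "i = j" | "i \<in> H" | "j \<in> H" using ij by (auto simp: I_def)
    then have "(\<rho> i - \<rho> j)\<^sup>2 = sqd m (e i) (e j)"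
    proof cases
      case 1
      then show ?thesis by (simp add: sqd_self)
    next
      case 2
      then show ?thesis using e0 lH \<rho>2 l2 by (simp add: sqd_def)
    next
      case 3
      then show ?thesis using e0 lH \<rho>2 l2 by (simp add: sqd_def)
    qed
    then show ?thesis using sq dec ij by simp
  qed
  moreover have "if s then sqd D (q u) (q v) \<le> sqd m (x u) (x v)
    else sqd m (x u) (x v) \<le> sqd D (q u) (q v)"
  proof -
    \<comment> \<open>The triangle inequality puts the distance \<open>w\<close> of the two
      residuals between the difference and the sum of \<open>l u\<close> and \<open>l v\<close>,
      which are the two values reached by folding.\<close>
    define w where "w = L2_set (\<lambda>k. e u k - e v k) {..<m}"
    have w2: "w\<^sup>2 = sqd m (e u) (e v)"
      by (simp add: w_def L2_set_def sqd_def sum_nonneg)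
    have w0: "w \<ge> 0" by (simp add: w_def)
    have "l u \<le> w + l v"
      using L2_set_triangle_ineq[of "\<lambda>k. e u k - e v k" "e v" "{..<m}"] by (simp add: l_def w_def)
    moreover have "l v \<le> w + l u"
      using L2_set_triangle_ineq[of "\<lambda>k. e v k - e u k" "e u" "{..<m}"]
      by (simp add: l_def w_def L2_set_def power2_commute)
    moreover have "w \<le> l u + l v"
      using L2_set_triangle_ineq[of "e u" "\<lambda>k. - e v k" "{..<m}"]
      by (simp add: l_def w_def L2_set_def)
    ultimately have "(l u - l v)\<^sup>2 \<le> w\<^sup>2" "w\<^sup>2 \<le> (l u + l v)\<^sup>2"
      using w0 by (simp_all add: abs_le_square_iff[symmetric] abs_if)
    then show ?thesis
      using sq[of u v] dec[of u v] w2 uv by (simp add: I_def \<rho>_def)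
  qed
  ultimately show ?thesis using qD unfolding I_def by (intro exI[of _ q]) blast
qed

section \<open>Dimensions of spaces of functions\<close>

interpretation fun_pair: vector_space_pair scale_fun scale_fun ..

lemma sum_fun_apply: "(\<Sum>x\<in>A. f x) i = (\<Sum>x\<in>A. f x i :: real)"
  by (induction A rule: infinite_finite_induct) auto

lemma subspace_coord_space: "fun_space.subspace (coord_space I)"
  by (auto simp: fun_space.subspace_def coord_space_def scale_fun_def)

text \<open>Restriction to \<open>K\<close> is linear and injective on \<open>M\<close>. The
  subspace \<open>M\<close> stands beside \<open>S\<close> because \<open>S\<close> may be an
  arbitrary set, such as a set of differences.\<close>

lemma dim_le_card_restriction:
  assumes "finite K" "fun_space.subspace M" "S \<subseteq> M"
    and inj: "\<And>x. x \<in> M \<Longrightarrow> (\<And>i. i \<in> K \<Longrightarrow> x i = 0) \<Longrightarrow> x = 0"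
  shows "fun_space.dim S \<le> card K"
proof -
  obtain B where B: "B \<subseteq> S" "fun_space.independent B" "S \<subseteq> fun_space.span B"
    "card B = fun_space.dim S"
    using fun_space.basis_exists[of S] by blast
  define \<phi> :: "('a \<Rightarrow> real) \<Rightarrow> 'a \<Rightarrow> real" where "\<phi> x = (\<lambda>i. if i \<in> K then x i else 0)" for x
  have lin: "Vector_Spaces.linear scale_fun scale_fun \<phi>"
    by unfold_locales (auto simp: \<phi>_def scale_fun_def algebra_simps)
  have spM: "fun_space.span B \<subseteq> M"
    using B(1) assms(2,3) by (intro fun_space.span_minimal) auto
  have inj\<phi>: "inj_on \<phi> (fun_space.span B)"
  proof (rule inj_onI)
    fix x y assume xy: "x \<in> fun_space.span B" "y \<in> fun_space.span B" "\<phi> x = \<phi> y"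
    have "(x - y) i = 0" if "i \<in> K" for i
      using fun_cong[OF xy(3), of i] that by (simp add: \<phi>_def)
    moreover have "x - y \<in> M"
      using spM xy fun_space.subspace_diff[OF assms(2)] by blast
    ultimately have "x - y = 0" using inj by blast
    then show "x = y" by simp
  qed
  have ind: "fun_space.independent (\<phi> ` B)"
    by (rule fun_pair.linear_independent_injective_image[OF lin B(2) inj\<phi>])
  define e :: "'a \<Rightarrow> 'a \<Rightarrow> real" where "e k = (\<lambda>i. if i = k then 1 else 0)" for k
  have "\<phi> x = (\<Sum>k\<in>K. scale_fun (x k) (e k))" for x
    using assms(1) by (auto simp: fun_eq_iff sum_fun_apply scale_fun_def e_def \<phi>_def if_distrib cong: if_cong)
  then have "\<phi> ` B \<subseteq> fun_space.span (e ` K)"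
    by (auto intro!: fun_space.span_sum fun_space.span_scale intro: fun_space.span_base)
  then have "card (\<phi> ` B) \<le> card (e ` K)"
    using fun_space.independent_span_bound[OF _ ind] assms(1) by blast
  also have "\<dots> \<le> card K" by (rule card_image_le[OF assms(1)])
  also have "card (\<phi> ` B) = card B"
    using inj\<phi> fun_space.span_superset[of B] inj_on_subset by (intro card_image) blast
  finally show ?thesis using B(4) by simp
qed

lemma independent_family:
  assumes "finite K"
    and zero: "\<And>c l. (\<Sum>k\<in>K. scale_fun (c k) (\<beta> k)) = 0 \<Longrightarrow> l \<in> K \<Longrightarrow> c l = 0"
  shows "fun_space.independent (\<beta> ` K)" "inj_on \<beta> K"
proof -
  show inj: "inj_on \<beta> K"
  proof (rule inj_onI, rule ccontr)
    fix k l assume kl: "k \<in> K" "l \<in> K" "\<beta> k = \<beta> l" "k \<noteq> l"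
    \<comment> \<open>If \<open>\<beta> k = \<beta> l\<close>, these coefficients give a nontrivial
      vanishing combination.\<close>
    define c where "c j = (if j = k then 1 else 0) - (if j = l then 1 else 0 :: real)" for j
    have "(\<Sum>j\<in>K. scale_fun (c j) (\<beta> j)) i = 0" for i
    proof -
      have "(\<Sum>j\<in>K. scale_fun (c j) (\<beta> j)) i =
        (\<Sum>j\<in>K. (if j = k then \<beta> k i else 0) - (if j = l then \<beta> l i else 0))"
        unfolding sum_fun_apply by (intro sum.cong) (auto simp: scale_fun_def c_def)
      also have "\<dots> = \<beta> k i - \<beta> l i" using kl assms(1) by (simp add: sum_subtractf)
      finally show ?thesis using kl(3) by simp
    qed
    then have "(\<Sum>j\<in>K. scale_fun (c j) (\<beta> j)) = 0" by (simp add: fun_eq_iff)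
    then have "c k = 0" using zero kl(1) by blast
    then show False using kl(4) by (simp add: c_def)
  qed
  show "fun_space.independent (\<beta> ` K)"
  proof (rule fun_space.independent_if_scalars_zero)
    fix f x assume f: "(\<Sum>x\<in>\<beta> ` K. scale_fun (f x) x) = 0" and "x \<in> \<beta> ` K"
    then obtain l where l: "l \<in> K" "x = \<beta> l" by blast
    have "(\<Sum>k\<in>K. scale_fun (f (\<beta> k)) (\<beta> k)) = 0" using f by (simp add: sum.reindex[OF inj])
    then show "f x = 0" using zero[of "\<lambda>k. f (\<beta> k)" l] l by simp
  qed (use assms(1) in simp)
qed

text \<open>Evaluation at \<open>l\<close> reads off the coefficient of
  \<open>\<beta> l\<close>.\<close>

lemma independent_dual_family:
  assumes "finite K" and \<beta>: "\<And>k l. k \<in> K \<Longrightarrow> l \<in> K \<Longrightarrow> \<beta> k l = (if k = l then 1 else 0 :: real)"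
  shows "fun_space.independent (\<beta> ` K)" "inj_on \<beta> K"
proof -
  have "c l = 0" if c: "(\<Sum>k\<in>K. scale_fun (c k) (\<beta> k)) = 0" and l: "l \<in> K" for c l
  proof -
    have "0 = (\<Sum>k\<in>K. scale_fun (c k) (\<beta> k)) l" using c by simp
    also have "\<dots> = (\<Sum>k\<in>K. if k = l then c k else 0)"
      unfolding sum_fun_apply using \<beta> l by (intro sum.cong) (auto simp: scale_fun_def)
    also have "\<dots> = c l" using assms(1) l by simp
    finally show ?thesis by simp
  qed
  then show "fun_space.independent (\<beta> ` K)" "inj_on \<beta> K"
    using independent_family[OF assms(1), of \<beta>] by blast+
qed

lemma dim_eq_card_restriction:
  assumes "finite K" "fun_space.subspace M" "S \<subseteq> M"
    and inj: "\<And>x. x \<in> M \<Longrightarrow> (\<And>i. i \<in> K \<Longrightarrow> x i = 0) \<Longrightarrow> x = 0"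
    and \<beta>: "\<And>k. k \<in> K \<Longrightarrow> \<beta> k \<in> S"
      "\<And>k l. k \<in> K \<Longrightarrow> l \<in> K \<Longrightarrow> \<beta> k l = (if k = l then 1 else 0)"
  shows "fun_space.dim S = card K"
proof -
  note ind = independent_dual_family[OF assms(1) \<beta>(2)]
  have "S \<subseteq> fun_space.span (\<beta> ` K)"
  proof
    fix x assume x: "x \<in> S"
    define y where "y = (\<Sum>k\<in>K. scale_fun (x k) (\<beta> k))"
    have y: "y \<in> fun_space.span (\<beta> ` K)"
      unfolding y_def by (auto intro!: fun_space.span_sum fun_space.span_scale intro: fun_space.span_base)
    have "y \<in> M"
      unfolding y_def using \<beta>(1) assms(2,3)
      by (auto intro!: fun_space.subspace_sum fun_space.subspace_scale)
    then have "x - y \<in> M" using x assms(2,3) fun_space.subspace_diff by blast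
    moreover have "(x - y) l = 0" if l: "l \<in> K" for l
    proof -
      have "y l = (\<Sum>k\<in>K. if k = l then x k else 0)"
        unfolding y_def sum_fun_apply using \<beta>(2) l by (intro sum.cong) (auto simp: scale_fun_def)
      then show ?thesis using assms(1) l by simp
    qed
    ultimately have "x - y = 0" using inj by blast
    then show "x \<in> fun_space.span (\<beta> ` K)" using y by simp
  qed
  moreover have "\<beta> ` K \<subseteq> S" using \<beta>(1) by blast
  ultimately have "fun_space.span (\<beta> ` K) = fun_space.span S"
    by (meson fun_space.span_mono fun_space.span_minimal fun_space.subspace_span subset_antisym)
  then have "fun_space.dim S = card (\<beta> ` K)" by (rule fun_space.dim_eq_card[OF _ ind(1)])
  then show ?thesis using card_image[OF ind(2)] by simp
qed

text \<open>The space of all functions may be infinite-dimensional, so finiteness has to come from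
  the injective restriction to \<open>K\<close>.\<close>

lemma finite_independent_restriction:
  assumes "finite K" "fun_space.subspace M"
    and inj: "\<And>x. x \<in> M \<Longrightarrow> (\<And>i. i \<in> K \<Longrightarrow> x i = 0) \<Longrightarrow> x = 0"
    and A: "A \<subseteq> M" "fun_space.independent A"
  shows "finite A"
proof (rule ccontr)
  assume inf: "infinite A"
  then obtain A' where A': "A' \<subseteq> A" "finite A'" "card A' = Suc (card K)"
    by (meson infinite_arbitrarily_large)
  have "fun_space.independent A'" using A(2) A'(1) fun_space.independent_mono by blast
  then have "fun_space.dim A' = card A'" by (rule fun_space.dim_eq_card_independent)
  moreover have "fun_space.dim A' \<le> card K"
    by (rule dim_le_card_restriction[OF assms(1,2) _ inj]) (use A A' in auto)
  ultimately show False using A'(3) by simp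
qed

lemma subset_span_if_card_eq_dim:
  assumes "finite K" "fun_space.subspace M"
    and inj: "\<And>x. x \<in> M \<Longrightarrow> (\<And>i. i \<in> K \<Longrightarrow> x i = 0) \<Longrightarrow> x = 0"
    and B: "B \<subseteq> M" "fun_space.independent B" "card B = fun_space.dim M" "finite B"
  shows "M \<subseteq> fun_space.span B"
proof
  fix x assume x: "x \<in> M"
  show "x \<in> fun_space.span B"
  proof (rule ccontr)
    assume nx: "x \<notin> fun_space.span B"
    then have xB: "x \<notin> B" using fun_space.span_base by blast
    have ind: "fun_space.independent (insert x B)"
      using nx B(2) by (simp add: fun_space.independent_insert)
    obtain A where A: "A \<subseteq> M" "fun_space.independent A" "M \<subseteq> fun_space.span A"
      "card A = fun_space.dim M"
      using fun_space.basis_exists[of M] by blast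
    have "finite A" using finite_independent_restriction[OF assms(1,2) inj A(1,2)] by blast
    moreover have "insert x B \<subseteq> fun_space.span A" using A(3) B(1) x by auto
    ultimately have "card (insert x B) \<le> card A"
      using fun_space.independent_span_bound[OF _ ind] by blast
    then show False using A(4) B(3,4) xB by simp
  qed
qed

lemma dim_linear_image_le:
  assumes lin: "Vector_Spaces.linear scale_fun scale_fun \<phi>"
    and S: "S \<subseteq> coord_space I" "finite I" and S': "S' \<subseteq> \<phi> ` S"
  shows "fun_space.dim S' \<le> fun_space.dim S"
proof -
  obtain B where B: "B \<subseteq> S" "fun_space.independent B" "S \<subseteq> fun_space.span B"
    "card B = fun_space.dim S"
    using fun_space.basis_exists[of S] by blast
  have "x = 0" if "x \<in> coord_space I" "\<And>i. i \<in> I \<Longrightarrow> x i = 0" for x :: "'a \<Rightarrow> real"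
    using that by (auto simp: coord_space_def fun_eq_iff)
  then have finB: "finite B"
    using finite_independent_restriction[OF S(2) subspace_coord_space _ _ B(2)] B(1) S(1) by blast
  have "S' \<subseteq> \<phi> ` fun_space.span B" using S' B(3) by blast
  also have "\<phi> ` fun_space.span B = fun_space.span (\<phi> ` B)"
    using fun_pair.linear_span_image[OF lin] by simp
  finally have "fun_space.dim S' \<le> card (\<phi> ` B)"
    by (rule fun_space.dim_le_card) (use finB in simp)
  also have "\<dots> \<le> card B" by (rule card_image_le[OF finB])
  finally show ?thesis using B(4) by simp
qed

lemma affine_dim_le:
  assumes "S \<subseteq> coord_space {..<D}"
  shows "affine_dim S \<le> D"
proof -
  have "fun_space.dim {x - y | x y. x \<in> S \<and> y \<in> S} \<le> card {..<D}"
  proof (rule dim_le_card_restriction[OF finite_lessThan subspace_coord_space])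
    show "{x - y | x y. x \<in> S \<and> y \<in> S} \<subseteq> coord_space {..<D}"
      using assms by (auto intro!: fun_space.subspace_diff[OF subspace_coord_space])
    fix x :: "nat \<Rightarrow> real" assume "x \<in> coord_space {..<D}" "\<And>i. i \<in> {..<D} \<Longrightarrow> x i = 0"
    then show "x = 0" by (auto simp: coord_space_def fun_eq_iff)
  qed
  then show ?thesis by (simp add: affine_dim_def)
qed

section \<open>Upper bounds for the realizable dimension\<close>

lemma (in multigraph) joiningD:
  assumes "e \<in> joining G i j"
  shows "i \<in> verts G" "j \<in> verts G" "i \<noteq> j" "adjacent G i j" "e \<in> edges G"
proof -
  show "adjacent G i j" using assms by (auto simp: adjacent_def)
  then show "i \<in> verts G" "j \<in> verts G" "i \<noteq> j" using adjacentD by auto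
  show "e \<in> edges G" using assms by (simp add: joining_def)
qed

lemma (in multigraph) finite_joining: "finite (joining G i j)"
  using finite_edges by (simp add: joining_def)

definition respects_signs ::
  "('v, 'e) pre_multigraph \<Rightarrow> nat \<Rightarrow> ('e \<Rightarrow> real) \<Rightarrow> ('v \<Rightarrow> nat \<Rightarrow> real) \<Rightarrow> ('v \<Rightarrow> 'v \<Rightarrow> real) \<Rightarrow> bool"
  where "respects_signs G m \<sigma> p \<delta> \<longleftrightarrow> (\<forall>i j. \<forall>e\<in>joining G i j.
    (\<sigma> e = 1 \<longrightarrow> \<delta> i j \<le> sqd m (p i) (p j)) \<and> (\<sigma> e = -1 \<longrightarrow> sqd m (p i) (p j) \<le> \<delta> i j))"

text \<open>Clique placements glue, so new edge lengths only have to be consistent within each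
  clique and with the signs.\<close>

lemma (in multigraph) d_realizable_if_cliques_placeable:
  assumes ch: "chordal G"
    and \<delta>: "\<And>m \<sigma> p. tensegrity G m \<sigma> p \<Longrightarrow>
      \<exists>\<delta>. (\<forall>C. clique G C \<longrightarrow> placeable D \<delta> C) \<and> respects_signs G m \<sigma> p \<delta>"
  shows "d_realizable D G"
  unfolding d_realizable_def
proof (intro allI impI)
  fix m \<sigma> p assume T: "tensegrity G m \<sigma> p"
  have pE: "p ` verts G \<subseteq> coord_space {..<m}" using T by (auto simp: tensegrity_def)
  show "\<exists>q. deformation G m \<sigma> p q \<and> affine_dim (q ` verts G) \<le> D"
  proof (cases "m \<le> D")
    \<comment> \<open>A deformation stays in the ambient space of \<open>p\<close>. For
      \<open>m \<le> D\<close> the span of \<open>p\<close> is small enough already; otherwise the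
      \<open>D\<close> coordinates of \<open>q\<close> fit into \<open>m\<close>.\<close>
    case True
    have "deformation G m \<sigma> p p" using T by (simp add: deformation_def tensegrity_def)
    then show ?thesis using affine_dim_le[OF pE] True by (intro exI[of _ p]) simp
  next
    case False
    obtain \<delta> where pl: "\<forall>C. clique G C \<longrightarrow> placeable D \<delta> C" and rs: "respects_signs G m \<sigma> p \<delta>"
      using \<delta>[OF T] by blast
    have "elim_from (adjacent G) {} (verts G)" using chordal_elim[OF ch, of "{}"] by (simp add: clique_def)
    moreover have "\<forall>C. C \<subseteq> verts G \<longrightarrow> cliq (adjacent G) C \<longrightarrow> placeable D \<delta> C"
      using pl by (simp add: clique_iff)
    ultimately obtain q where "(\<forall>i\<in>verts G. q i \<in> coord_space {..<D}) \<and>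
      (\<forall>i\<in>verts G. \<forall>j\<in>verts G. adjacent G i j \<longrightarrow> sqd D (q i) (q j) = \<delta> i j)"
      using glue_clique_placements[OF _ _ symp_adjacent] by (metis (no_types, lifting))
    then have q: "\<And>i. i \<in> verts G \<Longrightarrow> q i \<in> coord_space {..<D}"
      "\<And>i j. i \<in> verts G \<Longrightarrow> j \<in> verts G \<Longrightarrow> adjacent G i j \<Longrightarrow> sqd D (q i) (q j) = \<delta> i j"
      by simp_all
    have "affine_dim (q ` verts G) \<le> D" using q(1) by (intro affine_dim_le) auto
    moreover have "deformation G m \<sigma> p q"
      unfolding deformation_def
    proof (intro conjI ballI allI)
      show "q v \<in> coord_space {..<m}" if "v \<in> verts G" for v
        using coord_space_mono[OF q(1)[OF that]] False by auto
      fix i j e assume e: "e \<in> joining G i j"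
      note ij = joiningD[OF e]
      have "sqd m (q i) (q j) = \<delta> i j"
        using sqd_cong_dim[OF q(1)[OF ij(1)] q(1)[OF ij(2)], of m] q(2)[OF ij(1,2,4)] False by simp
      then show "\<sigma> e = 1 \<longrightarrow> point_dist m (q i) (q j) \<le> point_dist m (p i) (p j)"
        "\<sigma> e = -1 \<longrightarrow> point_dist m (p i) (p j) \<le> point_dist m (q i) (q j)"
        using rs e by (auto simp: point_dist_sqd respects_signs_def)
    qed
    ultimately show ?thesis by blast
  qed
qed

lemma (in multigraph) clique_finite: "clique G C \<Longrightarrow> finite C"
  using finite_verts finite_subset by (auto simp: clique_def)

lemma (in multigraph) clique_mono: "clique G C \<Longrightarrow> D \<subseteq> C \<Longrightarrow> clique G D"
  using cliq_mono by (auto simp: clique_iff)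

lemma (in multigraph) d_realizable_clique_bound:
  assumes "chordal G" "\<And>C. clique G C \<Longrightarrow> card C \<le> Suc D"
  shows "d_realizable D G"
proof (rule d_realizable_if_cliques_placeable[OF assms(1)])
  fix m \<sigma> p assume T: "tensegrity G m \<sigma> p"
  have "placeable D (\<lambda>i j. sqd m (p i) (p j)) C" if C: "clique G C" for C
    by (rule placeable_small[OF clique_finite[OF C] assms(2)[OF C]])
      (use T C in \<open>auto simp: tensegrity_def clique_def\<close>)
  then show "\<exists>\<delta>. (\<forall>C. clique G C \<longrightarrow> placeable D \<delta> C) \<and> respects_signs G m \<sigma> p \<delta>"
    by (intro exI[of _ "\<lambda>i j. sqd m (p i) (p j)"]) (simp add: respects_signs_def)
qed

lemma (in multigraph) maximal_clique_extension:
  assumes "clique G K"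
  shows "\<exists>C. maximal_clique G C \<and> K \<subseteq> C"
proof -
  have "clique G K \<and> K \<subseteq> K" using assms by simp
  moreover have "\<forall>C. clique G C \<and> K \<subseteq> C \<longrightarrow> card C < Suc (card (verts G))"
    using finite_verts by (auto simp: clique_def less_Suc_eq_le intro: card_mono)
  ultimately have "\<exists>C. (clique G C \<and> K \<subseteq> C) \<and> (\<forall>D. clique G D \<and> K \<subseteq> D \<longrightarrow> card D \<le> card C)"
    by (rule ex_has_greatest_nat)
  then obtain C where C: "clique G C" "K \<subseteq> C" "\<And>D. clique G D \<Longrightarrow> K \<subseteq> D \<Longrightarrow> card D \<le> card C"
    by blast
  have "D = C" if "clique G D" "C \<subseteq> D" for D
    using C that card_seteq[OF clique_finite[OF that(1)] that(2)] by (metis order_trans)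
  then show ?thesis using C unfolding maximal_clique_def by blast
qed

text \<open>Cliques of size \<open>D + 2\<close> have one vertex too many for a distance-preserving
  copy in dimension \<open>D\<close>. Each of them gives up the length of one loose pair: no other
  maximal clique sees that pair, and its single edge bounds the length on one side only.\<close>

lemma (in multigraph) d_realizable_loose_cliques:
  assumes ch: "chordal G" and D: "1 \<le> D" and bound: "\<And>C. clique G C \<Longrightarrow> card C \<le> D + 2"
    and loose: "\<And>C. clique G C \<Longrightarrow> card C = D + 2 \<Longrightarrow> \<exists>u v. u \<in> C \<and> v \<in> C \<and> u \<noteq> v \<and>
      \<not> parallel G u v \<and> (\<forall>C'. maximal_clique G C' \<and> {u, v} \<subseteq> C' \<longrightarrow> C' = C)"
  shows "d_realizable D G"
proof (rule d_realizable_if_cliques_placeable[OF ch])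
  fix m \<sigma> p assume T: "tensegrity G m \<sigma> p"
  define big where "big C \<longleftrightarrow> clique G C \<and> card C = D + 2" for C
  have "\<exists>uv. fst uv \<in> C \<and> snd uv \<in> C \<and> fst uv \<noteq> snd uv \<and> \<not> parallel G (fst uv) (snd uv) \<and>
    (\<forall>C'. maximal_clique G C' \<and> {fst uv, snd uv} \<subseteq> C' \<longrightarrow> C' = C)" if "big C" for C
    using loose[of C] that unfolding big_def by auto
  then obtain f where f: "\<And>C. big C \<Longrightarrow> fst (f C) \<in> C \<and> snd (f C) \<in> C \<and> fst (f C) \<noteq> snd (f C) \<and>
    \<not> parallel G (fst (f C)) (snd (f C)) \<and>
    (\<forall>C'. maximal_clique G C' \<and> {fst (f C), snd (f C)} \<subseteq> C' \<longrightarrow> C' = C)"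
    by metis
  define U W pr where "U C = fst (f C)" and "W C = snd (f C)" and "pr C = {U C, W C}" for C
  have UW: "U C \<in> C" "W C \<in> C" "U C \<noteq> W C" "\<not> parallel G (U C) (W C)"
    and uniq: "\<And>C'. maximal_clique G C' \<Longrightarrow> pr C \<subseteq> C' \<Longrightarrow> C' = C" if "big C" for C
    using f[OF that] by (simp_all add: U_def W_def pr_def)
  have bigmax: "maximal_clique G C" if "big C" for C
  proof -
    have "clique G C" using that by (simp add: big_def)
    then obtain M where M: "maximal_clique G M" "C \<subseteq> M"
      using maximal_clique_extension by blast
    then have "M = C" using uniq[OF that M(1)] UW[OF that] by (auto simp: pr_def)
    then show ?thesis using M by simp
  qed
  \<comment> \<open>A positive edge allows its ends to come closer, so both go to the same side of
    the hinge; otherwise they go to opposite sides.\<close>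
  define s where "s C \<longleftrightarrow> (\<exists>e\<in>joining G (U C) (W C). \<sigma> e = 1)" for C
  have "\<exists>q. (\<forall>i\<in>C. q i \<in> coord_space {..<D}) \<and>
    (\<forall>i\<in>C. \<forall>j\<in>C. {i, j} \<noteq> pr C \<longrightarrow> sqd D (q i) (q j) = sqd m (p i) (p j)) \<and>
    (if s C then sqd D (q (U C)) (q (W C)) \<le> sqd m (p (U C)) (p (W C))
     else sqd m (p (U C)) (p (W C)) \<le> sqd D (q (U C)) (q (W C)))" if C: "big C" for C
  proof -
    define H where "H = C - {U C, W C}"
    have fin: "finite C" using C clique_finite by (simp add: big_def)
    have CH: "insert (U C) (insert (W C) H) = C" using UW[OF C] by (auto simp: H_def)
    have cH: "card H = D" using UW[OF C] C fin by (simp add: H_def big_def card_Diff_subset)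
    then have "H \<noteq> {}" using D by auto
    from hinge_folding[of H D "U C" "W C" p m "s C", unfolded CH, folded pr_def]
    show ?thesis
      using fin cH \<open>H \<noteq> {}\<close> UW[OF C] T C
      by (simp add: H_def tensegrity_def big_def clique_def subset_iff)
  qed
  then obtain r where r: "\<And>C. big C \<Longrightarrow> (\<forall>i\<in>C. r C i \<in> coord_space {..<D}) \<and>
    (\<forall>i\<in>C. \<forall>j\<in>C. {i, j} \<noteq> pr C \<longrightarrow> sqd D (r C i) (r C j) = sqd m (p i) (p j)) \<and>
    (if s C then sqd D (r C (U C)) (r C (W C)) \<le> sqd m (p (U C)) (p (W C))
     else sqd m (p (U C)) (p (W C)) \<le> sqd D (r C (U C)) (r C (W C)))"
    by metis
  \<comment> \<open>Only loose pairs change their length. The choice by \<open>SOME\<close> is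
    unambiguous: by \<open>uniq\<close> a loose pair belongs to one big clique only.\<close>
  define \<delta> where "\<delta> i j = (if \<exists>C. big C \<and> pr C = {i, j}
    then sqd D (r (SOME C. big C \<and> pr C = {i, j}) i) (r (SOME C. big C \<and> pr C = {i, j}) j)
    else sqd m (p i) (p j))" for i j
  have unpaired: "\<delta> i j = sqd m (p i) (p j)" if "\<And>C. \<not> (big C \<and> pr C = {i, j})" for i j
    unfolding \<delta>_def using that by (subst if_not_P) blast+
  have pair: "\<delta> i j = sqd D (r C i) (r C j)" if C: "big C" "pr C = {i, j}" for C i j
  proof -
    define C' where "C' = (SOME C. big C \<and> pr C = {i, j})"
    have C': "big C'" "pr C' = {i, j}" unfolding C'_def using someI[of "\<lambda>C. big C \<and> pr C = {i, j}" C] C by auto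
    have "pr C' \<subseteq> C'" using UW[OF C'(1)] by (simp add: pr_def)
    then have "C' = C" using uniq[OF C(1) bigmax[OF C'(1)]] C(2) C'(2) by simp
    then show ?thesis using C unfolding \<delta>_def C'_def[symmetric] by auto
  qed
  have \<delta>big: "\<delta> i j = sqd D (r C i) (r C j)" if C: "big C" "i \<in> C" "j \<in> C" for C i j
  proof (cases "pr C = {i, j}")
    case True
    then show ?thesis using pair[OF C(1)] by simp
  next
    case False
    have "\<not> (big C' \<and> pr C' = {i, j})" for C'
    proof
      assume b: "big C' \<and> pr C' = {i, j}"
      then have "C = C'" using uniq[OF conjunct1[OF b] bigmax[OF C(1)]] C(2,3) by simp
      then show False using b False by simp
    qed
    then have "\<delta> i j = sqd m (p i) (p j)" by (rule unpaired)
    moreover have "{i, j} \<noteq> pr C" using False by simp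
    ultimately show ?thesis using conjunct1[OF conjunct2[OF r[OF C(1)]]] C(2,3) by simp
  qed
  have "placeable D \<delta> K" if K: "clique G K" for K
  proof -
    obtain M where M: "maximal_clique G M" "K \<subseteq> M" using maximal_clique_extension[OF K] by blast
    have clM: "clique G M" using M(1) by (simp add: maximal_clique_def)
    have "placeable D \<delta> M"
    proof (cases "big M")
      case True
      show ?thesis unfolding placeable_def
        by (intro exI[of _ "r M"]) (use r[OF True] \<delta>big[OF True] in simp)
    next
      case False
      then have "card M \<le> Suc D" using bound[OF clM] clM by (simp add: big_def)
      then have "placeable D (\<lambda>i j. sqd m (p i) (p j)) M"
        by (rule placeable_small[OF clique_finite[OF clM]])
          (use T clM in \<open>auto simp: tensegrity_def clique_def\<close>)
      moreover have "\<delta> i j = sqd m (p i) (p j)" if "i \<in> M" "j \<in> M" for i j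
      proof -
        have "\<not> (big C \<and> pr C = {i, j})" for C
        proof
          assume b: "big C \<and> pr C = {i, j}"
          then have "M = C" using uniq[OF conjunct1[OF b] M(1)] that by simp
          then show False using b False by simp
        qed
        then show ?thesis by (rule unpaired)
      qed
      ultimately show ?thesis by (simp add: placeable_def)
    qed
    then show ?thesis using M(2) placeable_mono by blast
  qed
  moreover have "respects_signs G m \<sigma> p \<delta>"
    unfolding respects_signs_def
  proof (intro allI ballI)
    fix i j e assume e: "e \<in> joining G i j"
    show "(\<sigma> e = 1 \<longrightarrow> \<delta> i j \<le> sqd m (p i) (p j)) \<and> (\<sigma> e = -1 \<longrightarrow> sqd m (p i) (p j) \<le> \<delta> i j)"
    proof (cases "\<exists>C. big C \<and> pr C = {i, j}")
      case False
      then have "\<delta> i j = sqd m (p i) (p j)" by (intro unpaired) blast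
      then show ?thesis by simp
    next
      case True
      then obtain C where C: "big C" "pr C = {i, j}" by blast
      have J: "joining G (U C) (W C) = joining G i j"
        using C(2) by (simp add: joining_def pr_def)
      \<comment> \<open>With a single edge, the sign recorded by \<open>s C\<close> is that of
        \<open>e\<close>; parallel edges of opposite signs would fix the length.\<close>
      have "card (joining G i j) \<le> 1" using UW(4)[OF C(1)] J by (simp add: parallel_def)
      then have single: "e' = e" if "e' \<in> joining G i j" for e'
        using e that finite_joining card_le_Suc0_iff_eq[of "joining G i j"] by simp
      have sC: "s C \<longleftrightarrow> \<sigma> e = 1" unfolding s_def J using single e by metis
      have "U C = i \<and> W C = j \<or> U C = j \<and> W C = i"
        using C(2) by (simp add: pr_def doubleton_eq_iff)
      then have "sqd D (r C (U C)) (r C (W C)) = \<delta> i j" "sqd m (p (U C)) (p (W C)) = sqd m (p i) (p j)"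
        using pair[OF C] by (auto simp: sqd_commute)
      then show ?thesis using r[OF C(1)] sC by (cases "s C") auto
    qed
  qed
  ultimately show "\<exists>\<delta>. (\<forall>C. clique G C \<longrightarrow> placeable D \<delta> C) \<and> respects_signs G m \<sigma> p \<delta>"
    by blast
qed

section \<open>Positive semidefinite matrices supported on chordal graphs\<close>

lemma symmetric_onD: "symmetric_on I A \<Longrightarrow> i \<in> I \<Longrightarrow> j \<in> I \<Longrightarrow> A i j = A j i"
  unfolding symmetric_on_def by blast

lemma quad_form_altdef: "quad_form I A x = (\<Sum>i\<in>I. x i * (\<Sum>j\<in>I. A i j * x j))"
  by (simp add: quad_form_def sum_distrib_left mult.assoc)

lemma quad_form_cong: "(\<And>i. i \<in> I \<Longrightarrow> x i = y i) \<Longrightarrow> quad_form I A x = quad_form I A y"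
  by (simp add: quad_form_def)

lemma psd_on_nonneg:
  assumes "psd_on I A"
  shows "0 \<le> quad_form I A x"
proof -
  have "quad_form I A x = quad_form I A (\<lambda>i. if i \<in> I then x i else 0)"
    by (rule quad_form_cong) simp
  then show ?thesis using assms by (simp add: psd_on_def coord_space_def)
qed

lemma quad_form_add_unit:
  assumes I: "finite I" "symmetric_on I A" "i \<in> I"
  shows "quad_form I A (\<lambda>k. x k + (if k = i then s else 0)) =
    quad_form I A x + 2 * s * (\<Sum>j\<in>I. A i j * x j) + s\<^sup>2 * A i i"
proof -
  have a: "(\<Sum>j\<in>I. A k j * (x j + (if j = i then s else 0))) = (\<Sum>j\<in>I. A k j * x j) + A k i * s" for k
    using I by (simp add: distrib_left sum.distrib if_distrib[of "(*) _"] cong: if_cong)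
  have "(\<Sum>k\<in>I. x k * A k i) = (\<Sum>j\<in>I. A i j * x j)"
    using I unfolding symmetric_on_def by (intro sum.cong) auto
  moreover have "(\<Sum>k\<in>I. (x k + (if k = i then s else 0)) * ((\<Sum>j\<in>I. A k j * x j) + A k i * s)) =
    (\<Sum>k\<in>I. x k * (\<Sum>j\<in>I. A k j * x j)) + s * (\<Sum>k\<in>I. x k * A k i)
     + (\<Sum>k\<in>I. if k = i then s * ((\<Sum>j\<in>I. A k j * x j) + A k i * s) else 0)"
    unfolding sum_distrib_left[of s] sum.distrib[symmetric]
    by (intro sum.cong refl) (simp add: algebra_simps)
  ultimately show ?thesis unfolding quad_form_altdef a
    using I by (simp add: power2_eq_square algebra_simps)
qed

text \<open>\<open>x\<close> minimizes a nonnegative form, so the gradient vanishes there.\<close>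

lemma psd_on_kernel:
  assumes I: "finite I" "psd_on I A" "i \<in> I" and x: "quad_form I A x = 0"
  shows "(\<Sum>j\<in>I. A i j * x j) = 0"
proof (rule ccontr)
  define b where "b = (\<Sum>j\<in>I. A i j * x j)"
  assume "\<not> ?thesis"
  then have b: "b \<noteq> 0" by (simp add: b_def)
  have sym: "symmetric_on I A" using I(2) by (simp add: psd_on_def)
  have nn: "0 \<le> 2 * s * b + s\<^sup>2 * A i i" for s
    using psd_on_nonneg[OF I(2), of "\<lambda>k. x k + (if k = i then s else 0)"]
    unfolding quad_form_add_unit[OF I(1) sym I(3)] x b_def by simp
  \<comment> \<open>The step \<open>- b / c\<close> is short enough for the linear term to win;
    adding 1 makes \<open>c\<close> positive and larger than \<open>A i i\<close>.\<close>
  define c where "c = \<bar>A i i\<bar> + 1"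
  have c: "c > 0" "A i i < c" by (simp_all add: c_def)
  have "0 \<le> 2 * (- b / c) * b + (- b / c)\<^sup>2 * A i i" by (rule nn)
  also have "\<dots> = (b\<^sup>2 / c) * (A i i / c - 2)"
    using c by (simp add: power2_eq_square field_simps)
  also have "\<dots> < 0"
    using b c by (intro mult_pos_neg) (simp_all add: field_simps)
  finally show False by simp
qed

lemma psd_on_zero_row:
  assumes I: "finite I" "psd_on I A" "v \<in> I" "j \<in> I" "A v v = 0"
  shows "A v j = 0" "A j v = 0"
proof -
  have d: "(\<Sum>l\<in>I. A k l * (if l = v then 1 else 0)) = A k v" for k
    using I by (simp add: if_distrib cong: if_cong)
  have "quad_form I A (\<lambda>k. if k = v then 1 else 0) = (\<Sum>k\<in>I. if k = v then A k v else 0)"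
    unfolding quad_form_altdef d by (intro sum.cong) auto
  then have "quad_form I A (\<lambda>k. if k = v then 1 else 0) = 0" using I by simp
  from psd_on_kernel[OF I(1,2,4) this] show "A j v = 0" by (simp add: d)
  then show "A v j = 0" using I by (simp add: psd_on_def symmetric_on_def)
qed

lemma psd_on_diagonal:
  assumes I: "finite I" "psd_on I A" "v \<in> I"
  shows "0 \<le> A v v"
proof -
  have "quad_form I A (\<lambda>k. 0 + (if k = v then 1 else 0)) = A v v"
    using I by (subst quad_form_add_unit) (simp_all add: psd_on_def, simp add: quad_form_def)
  then show ?thesis using psd_on_nonneg[OF I(2)] by metis
qed

lemma quad_form_insert:
  assumes "finite V" "v \<notin> V" "symmetric_on (insert v V) A"
  shows "quad_form (insert v V) A x =
    quad_form V A x + 2 * x v * (\<Sum>j\<in>V. A v j * x j) + (x v)\<^sup>2 * A v v"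
proof -
  have "x i * A i v = A v i * x i" if "i \<in> V" for i
    using symmetric_onD[OF assms(3), of i v] that by simp
  then have "(\<Sum>i\<in>V. x i * A i v) = (\<Sum>j\<in>V. A v j * x j)" by (intro sum.cong refl)
  then have *: "(\<Sum>i\<in>V. x i * (A i v * x v)) = (\<Sum>j\<in>V. A v j * x j) * x v"
    by (simp add: mult.assoc[symmetric] sum_distrib_right[symmetric])
  have "quad_form (insert v V) A x = x v * (A v v * x v + (\<Sum>j\<in>V. A v j * x j)) +
    ((\<Sum>i\<in>V. x i * (A i v * x v)) + quad_form V A x)"
    using assms(1,2) by (simp add: quad_form_altdef distrib_left sum.distrib)
  then show ?thesis unfolding * by (simp add: power2_eq_square distrib_left)
qed

lemma psd_on_subset:
  assumes "finite V" "v \<notin> V" "psd_on (insert v V) A"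
  shows "psd_on V A"
proof -
  have sym: "symmetric_on (insert v V) A" using assms(3) by (simp add: psd_on_def)
  have "0 \<le> quad_form V A x" for x
    using psd_on_nonneg[OF assms(3), of "x(v := 0)"]
      quad_form_cong[of V x "x(v := 0)" A] assms(2)
    by (simp add: quad_form_insert[OF assms(1,2) sym]) (metis fun_upd_other quad_form_cong)
  moreover have "symmetric_on V A" using sym unfolding symmetric_on_def by blast
  ultimately show ?thesis by (simp add: psd_on_def)
qed

text \<open>What symmetric Gaussian elimination of \<open>v\<close> leaves on the other
  indices.\<close>

definition schur :: "'v \<Rightarrow> ('v \<Rightarrow> 'v \<Rightarrow> real) \<Rightarrow> 'v \<Rightarrow> 'v \<Rightarrow> real" where
  "schur v A i j = A i j - A i v * A v j / A v v"

lemma psd_on_schur: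
  assumes "finite V" "v \<notin> V" "psd_on (insert v V) A" "0 < A v v"
  shows "psd_on V (schur v A)"
proof -
  have sym: "symmetric_on (insert v V) A" using assms(3) by (simp add: psd_on_def)
  have "0 \<le> quad_form V (schur v A) x" for x
  proof -
    define b where "b = (\<Sum>j\<in>V. A v j * x j)"
    have "x i * A i v = A v i * x i" if "i \<in> V" for i
      using symmetric_onD[OF sym, of i v] that by simp
    then have b': "(\<Sum>i\<in>V. x i * A i v) = b" unfolding b_def by (intro sum.cong refl)
    \<comment> \<open>The value at \<open>v\<close> that minimizes the form of \<open>A\<close> with
      \<open>x\<close> fixed on \<open>V\<close>; the minimum is the form of the Schur
      complement.\<close>
    define y where "y = x(v := - b / A v v)"
    have yV: "y i = x i" if "i \<in> V" for i using that assms(2) by (auto simp: y_def)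
    have "quad_form (insert v V) A y = quad_form V A x + 2 * y v * b + (y v)\<^sup>2 * A v v"
      unfolding quad_form_insert[OF assms(1,2) sym] b_def
      using yV quad_form_cong[of V y x A] by simp
    also have "\<dots> = quad_form V A x - b * b / A v v"
      using assms(4) by (simp add: y_def power2_eq_square)
    also have "\<dots> = quad_form V (schur v A) x"
    proof -
      have "(\<Sum>j\<in>V. schur v A i j * x j) = (\<Sum>j\<in>V. A i j * x j) - A i v * b / A v v" for i
        by (simp add: schur_def b_def left_diff_distrib sum_subtractf sum_distrib_left sum_divide_distrib mult.assoc)
      then have "quad_form V (schur v A) x = quad_form V A x - (\<Sum>i\<in>V. x i * (A i v * b / A v v))"
        by (simp add: quad_form_altdef right_diff_distrib sum_subtractf)
      also have "(\<Sum>i\<in>V. x i * (A i v * b / A v v)) = (\<Sum>i\<in>V. x i * A i v) * b / A v v"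
        by (simp add: sum_distrib_right sum_divide_distrib mult.assoc)
      finally show ?thesis using b' by simp
    qed
    finally show ?thesis using psd_on_nonneg[OF assms(3), of y] by simp
  qed
  moreover have "symmetric_on V (schur v A)"
    unfolding symmetric_on_def
  proof (intro ballI)
    fix i j assume "i \<in> V" "j \<in> V"
    then show "schur v A i j = schur v A j i"
      using symmetric_onD[OF sym, of i j] symmetric_onD[OF sym, of i v] symmetric_onD[OF sym, of v j]
      by (simp add: schur_def)
  qed
  ultimately show ?thesis by (simp add: psd_on_def)
qed

definition sparse_on :: "('v \<Rightarrow> 'v \<Rightarrow> bool) \<Rightarrow> 'v set \<Rightarrow> ('v \<Rightarrow> 'v \<Rightarrow> real) \<Rightarrow> bool" where
  "sparse_on adj V A \<longleftrightarrow> (\<forall>i\<in>V. \<forall>j\<in>V. i \<noteq> j \<and> \<not> adj i j \<longrightarrow> A i j = 0)"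

lemma sparse_onD: "sparse_on adj V A \<Longrightarrow> i \<in> V \<Longrightarrow> j \<in> V \<Longrightarrow> i \<noteq> j \<Longrightarrow> \<not> adj i j \<Longrightarrow> A i j = 0"
  by (simp add: sparse_on_def)

text \<open>No fill-in: a correction at \<open>i\<close> and \<open>j\<close> requires both to be
  neighbours of \<open>v\<close>, and neighbours of a simplicial vertex are already
  adjacent.\<close>

lemma sparse_on_schur:
  assumes "sparse_on adj (insert v V) A" "v \<notin> V" "cliq adj {u\<in>V. adj v u}" "symp adj"
  shows "sparse_on adj V (schur v A)"
  unfolding sparse_on_def
proof (intro ballI impI)
  fix i j assume ij: "i \<in> V" "j \<in> V" "i \<noteq> j \<and> \<not> adj i j"
  have "A i j = 0" using sparse_onD[OF assms(1)] ij by simp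
  moreover have "A i v * A v j = 0"
  proof (rule ccontr)
    assume n: "A i v * A v j \<noteq> 0"
    have "adj i v" using n sparse_onD[OF assms(1), of i v] ij assms(2) by auto
    then have "adj v i" using assms(4) by (simp add: symp_def)
    moreover have "adj v j" using n sparse_onD[OF assms(1), of v j] ij assms(2) by auto
    ultimately show False using cliqD[OF assms(3), of i j] ij by simp
  qed
  ultimately show "schur v A i j = 0" by (simp add: schur_def)
qed

text \<open>Cholesky factorization along the elimination order. As there is no fill-in, the column
  split off at \<open>v\<close> lives on \<open>v\<close> and its neighbours among the remaining
  vertices, which form a clique.\<close>

lemma psd_clique_decomposition:
  assumes "elim_from adj {} V" "psd_on V A" "sparse_on adj V A" and sym: "symp adj"
  shows "\<exists>w :: 'v \<Rightarrow> 'v \<Rightarrow> real. (\<forall>v\<in>V. cliq adj {i\<in>V. w v i \<noteq> 0}) \<and>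
    (\<forall>i\<in>V. \<forall>j\<in>V. A i j = (\<Sum>v\<in>V. w v i * w v j))"
  using assms(1-3)
proof (induction arbitrary: A rule: elim_from.induct)
  case base
  show ?case by simp
next
  case (step V v)
  have fin: "finite V" using elim_from_finite[OF step.hyps(1)] by simp
  have symA: "symmetric_on (insert v V) A" using step.prems(1) by (simp add: psd_on_def)
  define a where "a = sqrt (A v v)"
  define B where "B = (if A v v = 0 then A else schur v A)"
  have pos: "0 \<le> A v v" using psd_on_diagonal[OF _ step.prems(1), of v] fin by simp
  have row: "A v j = 0" if "A v v = 0" "j \<in> insert v V" for j
    using psd_on_zero_row(1)[OF _ step.prems(1) _ that(2,1)] fin by simp
  have B1: "psd_on V B"
    using psd_on_subset[OF fin step.hyps(2) step.prems(1)] psd_on_schur[OF fin step.hyps(2) step.prems(1)] pos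
    by (simp add: B_def)
  have B2: "sparse_on adj V B"
    using sparse_on_schur[OF step.prems(2) step.hyps(2,3) sym] step.prems(2)
    by (simp add: B_def sparse_on_def)
  from step.IH[OF B1 B2] obtain w :: "'v \<Rightarrow> 'v \<Rightarrow> real" where
    "(\<forall>v\<in>V. cliq adj {i\<in>V. w v i \<noteq> 0}) \<and> (\<forall>i\<in>V. \<forall>j\<in>V. B i j = (\<Sum>v\<in>V. w v i * w v j))"
    by (elim exE)
  then have w: "\<And>v. v \<in> V \<Longrightarrow> cliq adj {i\<in>V. w v i \<noteq> 0}"
    "\<And>i j. i \<in> V \<Longrightarrow> j \<in> V \<Longrightarrow> B i j = (\<Sum>v\<in>V. w v i * w v j)"
    by simp_all
  define z where "z t i = (if t = v then A v i / a else if i = v then 0 else w t i)" for t i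
  have zV: "z t i = w t i" if "t \<in> V" "i \<in> V" for t i using that step.hyps(2) by (auto simp: z_def)
  have zv0: "z t v = 0" if "t \<in> V" for t using that step.hyps(2) by (auto simp: z_def)
  have zv: "z v i = A v i / a" for i by (simp add: z_def)
  have "cliq adj {i\<in>insert v V. z t i \<noteq> 0}" if t: "t \<in> insert v V" for t
  proof (cases "t = v")
    case True
    show ?thesis
    proof (rule cliqI)
      fix i j assume "i \<in> {i \<in> insert v V. z t i \<noteq> 0}" "j \<in> {i \<in> insert v V. z t i \<noteq> 0}" and ne: "i \<noteq> j"
      then have ij: "i \<in> insert v V" "A v i \<noteq> 0" "j \<in> insert v V" "A v j \<noteq> 0" using True zv by auto
      have "i = v \<or> i \<in> {u\<in>V. adj v u}" "j = v \<or> j \<in> {u\<in>V. adj v u}"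
        using ij sparse_onD[OF step.prems(2), of v] by auto
      then show "adj i j"
        using ne cliqD[OF step.hyps(3), of i j] sympD[OF sym, of v i] by auto
    qed
  next
    case False
    then have "t \<in> V" using t by simp
    have "{i\<in>insert v V. z t i \<noteq> 0} = {i\<in>V. w t i \<noteq> 0}"
      using zV[OF \<open>t \<in> V\<close>] zv0[OF \<open>t \<in> V\<close>] by auto
    then show ?thesis using w(1)[OF \<open>t \<in> V\<close>] by simp
  qed
  moreover have "A i j = (\<Sum>t\<in>insert v V. z t i * z t j)" if ij: "i \<in> insert v V" "j \<in> insert v V" for i j
  proof -
    have symij: "A i v = A v i" using symA ij(1) unfolding symmetric_on_def by blast
    \<comment> \<open>For \<open>A v v = 0\<close> both sides are 0, as division by zero yields
      0.\<close>
    have zz: "z v i * z v j = A v i * A v j / A v v"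
      using pos by (simp add: zv a_def)
    have s: "(\<Sum>t\<in>insert v V. z t i * z t j) = A v i * A v j / A v v + (\<Sum>t\<in>V. z t i * z t j)"
      using fin step.hyps(2) zz by simp
    show ?thesis
    proof (cases "i = v \<or> j = v")
      case True
      then have "(\<Sum>t\<in>V. z t i * z t j) = 0" using zv0 by auto
      then show ?thesis unfolding s
        using True symij row[OF _ ij(1)] row[OF _ ij(2)] by (cases "A v v = 0") auto
    next
      case False
      then have ijV: "i \<in> V" "j \<in> V" using ij by auto
      then have "(\<Sum>t\<in>V. z t i * z t j) = B i j" unfolding w(2)[OF ijV] using zV by simp
      then show ?thesis unfolding s using symij by (simp add: B_def schur_def)
    qed
  qed
  ultimately show ?case by (intro exI[of _ z]) simp
qed

section \<open>The strong Arnold property under elimination\<close>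

definition sap_on :: "('v \<Rightarrow> 'v \<Rightarrow> bool) \<Rightarrow> 'v set \<Rightarrow> ('v \<Rightarrow> 'v \<Rightarrow> real) \<Rightarrow> bool" where
  "sap_on adj V A \<longleftrightarrow> (\<forall>X. symmetric_on V X \<longrightarrow> (\<forall>i\<in>V. \<forall>j\<in>V. (\<Sum>k\<in>V. X i k * A k j) = 0) \<longrightarrow>
     (\<forall>i\<in>V. \<forall>j\<in>V. i = j \<or> adj i j \<longrightarrow> X i j = 0) \<longrightarrow> (\<forall>i\<in>V. \<forall>j\<in>V. X i j = 0))"

lemma sap_onD:
  assumes "sap_on adj V A" "symmetric_on V X"
    "\<And>i j. i \<in> V \<Longrightarrow> j \<in> V \<Longrightarrow> (\<Sum>k\<in>V. X i k * A k j) = 0"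
    "\<And>i j. i \<in> V \<Longrightarrow> j \<in> V \<Longrightarrow> i = j \<or> adj i j \<Longrightarrow> X i j = 0" "i \<in> V" "j \<in> V"
  shows "X i j = 0"
  using assms(1)[unfolded sap_on_def, rule_format, of X i j] assms(2-) by blast

lemma SAP_iff: "SAP G A \<longleftrightarrow> sap_on (adjacent G) (verts G) A"
proof
  assume S: "SAP G A"
  show "sap_on (adjacent G) (verts G) A"
    unfolding sap_on_def
  proof (intro allI impI ballI, rule ccontr)
    fix X i j
    assume X: "symmetric_on (verts G) X"
      "\<forall>i\<in>verts G. \<forall>j\<in>verts G. (\<Sum>k\<in>verts G. X i k * A k j) = 0"
      "\<forall>i\<in>verts G. \<forall>j\<in>verts G. i = j \<or> adjacent G i j \<longrightarrow> X i j = 0"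
      and ij: "i \<in> verts G" "j \<in> verts G" "X i j \<noteq> 0"
    have "nonzero_on (verts G) X" unfolding nonzero_on_def using ij by blast
    with S X show False
      unfolding SAP_def by (elim notE) (intro exI[of _ X] conjI)
  qed
next
  assume S: "sap_on (adjacent G) (verts G) A"
  show "SAP G A"
    unfolding SAP_def
  proof (rule notI, elim exE conjE)
    fix X
    assume X: "symmetric_on (verts G) X" "nonzero_on (verts G) X"
      "\<forall>i\<in>verts G. \<forall>j\<in>verts G. (\<Sum>k\<in>verts G. X i k * A k j) = 0"
      "\<forall>i\<in>verts G. \<forall>j\<in>verts G. i = j \<or> adjacent G i j \<longrightarrow> X i j = 0"
    then obtain i j where ij: "i \<in> verts G" "j \<in> verts G" "X i j \<noteq> 0"
      unfolding nonzero_on_def by blast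
    have "X i j = 0" by (rule sap_onD[OF S X(1) _ _ ij(1,2)]) (use X(3,4) in blast)+
    then show False using ij(3) by simp
  qed
qed

text \<open>A matrix \<open>X'\<close> that annihilates the Schur complement lifts to
  \<open>X = P X' P^T\<close>, where \<open>P\<close> is the identity with the extra row
  \<open>g\<close> for \<open>v\<close>. Elimination turns this into \<open>X A = 0\<close>. The
  zero pattern survives because \<open>g\<close> lives on the neighbours of \<open>v\<close>, a
  clique, on which \<open>X'\<close> vanishes.\<close>

lemma sap_on_schur:
  assumes fin: "finite V" "v \<notin> V" and cl: "cliq adj {u\<in>V. adj v u}" and sym: "symp adj"
    and A: "symmetric_on (insert v V) A" "sparse_on adj (insert v V) A" "A v v \<noteq> 0"
    and sap: "sap_on adj (insert v V) A"
  shows "sap_on adj V (schur v A)"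
  unfolding sap_on_def
proof (intro allI impI ballI)
  fix X' i0 j0
  assume X: "symmetric_on V X'"
    and X0: "\<forall>i\<in>V. \<forall>j\<in>V. (\<Sum>k\<in>V. X' i k * schur v A k j) = 0"
    and Xadj: "\<forall>i\<in>V. \<forall>j\<in>V. i = j \<or> adj i j \<longrightarrow> X' i j = 0" and ij0: "i0 \<in> V" "j0 \<in> V"
  have Xadj': "X' i j = 0" if "i \<in> V" "j \<in> V" "i = j \<or> adj i j" for i j
    using Xadj that by blast
  have symX: "X' i j = X' j i" if "i \<in> V" "j \<in> V" for i j using X that by (simp add: symmetric_on_def)
  have symA: "A k v = A v k" if "k \<in> V" for k
    using symmetric_onD[OF A(1), of k v] that by simp
  define g where "g k = - A v k / A v v" for k
  define h where "h j = (\<Sum>k\<in>V. g k * X' k j)" for j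
  define X where "X i j = (if i = v then if j = v then (\<Sum>l\<in>V. g l * h l) else h j
    else if j = v then h i else X' i j)" for i j
  have XV: "X i j = X' i j" if "i \<in> V" "j \<in> V" for i j using that fin(2) by (auto simp: X_def)
  have Xv: "X v j = h j" "X j v = h j" if "j \<in> V" for j using that fin(2) by (auto simp: X_def)
  have Xvv: "X v v = (\<Sum>l\<in>V. g l * h l)" by (simp add: X_def)
  \<comment> \<open>Adding multiples of row \<open>v\<close> clears column \<open>v\<close>; this is
    how \<open>X\<close> times \<open>A\<close> reduces to \<open>X'\<close> times the Schur
    complement.\<close>
  have B: "A k j + g k * A v j = (if j = v then 0 else schur v A k j)" if "k \<in> V" for k j
    using A(3) symA[OF that] by (simp add: g_def schur_def)
  have hB: "(\<Sum>k\<in>V. h k * schur v A k j) = 0" if "j \<in> V" for j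
  proof -
    have "(\<Sum>k\<in>V. h k * schur v A k j) = (\<Sum>k\<in>V. \<Sum>l\<in>V. g l * (X' l k * schur v A k j))"
      by (simp add: h_def sum_distrib_right mult.assoc)
    also have "\<dots> = (\<Sum>l\<in>V. g l * (\<Sum>k\<in>V. X' l k * schur v A k j))"
      by (subst sum.swap) (simp add: sum_distrib_left)
    finally show ?thesis using X0 that by simp
  qed
  have hsym: "h i = (\<Sum>k\<in>V. X' i k * g k)" if "i \<in> V" for i
    unfolding h_def using symX that by (intro sum.cong) (auto simp: mult.commute)
  have gN: "k \<in> {u\<in>V. adj v u}" if "k \<in> V" "g k \<noteq> 0" for k
    using that sparse_onD[OF A(2), of v k] fin(2) by (auto simp: g_def)
  have hN: "h j = 0" if "j \<in> V" "adj v j" for j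
    unfolding h_def
  proof (rule sum.neutral, rule ballI)
    fix k assume k: "k \<in> V"
    show "g k * X' k j = 0"
    proof (cases "g k = 0")
      case False
      then have "k = j \<or> adj k j" using gN[OF k] cliqD[OF cl, of k j] that by auto
      then show ?thesis using Xadj'[OF k that(1)] by simp
    qed simp
  qed
  have Xvv0: "X v v = 0"
    unfolding Xvv
  proof (rule sum.neutral, rule ballI)
    fix l assume "l \<in> V"
    then show "g l * h l = 0" using gN[of l] hN[of l] by auto
  qed
  have "X i0 j0 = 0"
  proof (rule sap_onD[OF sap])
    show "symmetric_on (insert v V) X"
      unfolding symmetric_on_def using XV Xv symX by auto
  next
    fix i j assume ij: "i \<in> insert v V" "j \<in> insert v V"
    have split: "(\<Sum>k\<in>insert v V. X i k * A k j) = X i v * A v j + (\<Sum>k\<in>V. X i k * A k j)"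
      using fin by simp
    show "(\<Sum>k\<in>insert v V. X i k * A k j) = 0"
    proof (cases "i = v")
      case True
      have "(\<Sum>k\<in>insert v V. X i k * A k j) = (\<Sum>k\<in>V. g k * h k) * A v j + (\<Sum>k\<in>V. h k * A k j)"
        unfolding split using True Xv by (simp add: Xvv)
      also have "\<dots> = (\<Sum>k\<in>V. h k * (A k j + g k * A v j))"
        unfolding sum_distrib_right sum.distrib[symmetric]
        by (intro sum.cong refl) (simp add: algebra_simps)
      also have "\<dots> = (\<Sum>k\<in>V. h k * (if j = v then 0 else schur v A k j))" using B by simp
      also have "\<dots> = 0" using hB ij(2) by (cases "j = v") simp_all
      finally show ?thesis .
    next
      case False
      then have i: "i \<in> V" using ij by simp
      have "(\<Sum>k\<in>insert v V. X i k * A k j) = (\<Sum>k\<in>V. X' i k * g k) * A v j + (\<Sum>k\<in>V. X' i k * A k j)"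
        unfolding split using Xv(2)[OF i] hsym[OF i] XV[OF i] by simp
      also have "\<dots> = (\<Sum>k\<in>V. X' i k * (A k j + g k * A v j))"
        unfolding sum_distrib_right sum.distrib[symmetric]
        by (intro sum.cong refl) (simp add: algebra_simps)
      also have "\<dots> = (\<Sum>k\<in>V. X' i k * (if j = v then 0 else schur v A k j))" using B by simp
      also have "\<dots> = 0" using X0 i ij(2) by (cases "j = v") simp_all
      finally show ?thesis .
    qed
  next
    fix i j assume ij: "i \<in> insert v V" "j \<in> insert v V" "i = j \<or> adj i j"
    consider "i = v" "j = v" | "i = v" "j \<in> V" "adj v j" | "j = v" "i \<in> V" "adj v i" | "i \<in> V" "j \<in> V"
      using ij fin(2) sympD[OF sym, of i j] by auto
    then show "X i j = 0"
      using Xvv0 Xv hN XV Xadj'[OF _ _ ij(3)] by cases simp_all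
  qed (use ij0 in auto)
  then show "X' i0 j0 = 0" using XV ij0 by simp
qed

text \<open>Positive semidefiniteness makes row \<open>v\<close> zero, so the unit vector at
  \<open>v\<close> is a kernel vector, like \<open>x\<close>. Their symmetric product
  \<open>X\<close> annihilates \<open>A\<close>, and it vanishes on the diagonal and on edges
  because \<open>x\<close> vanishes at \<open>v\<close> and at its neighbours.\<close>

lemma sap_zero_diagonal:
  assumes fin: "finite V" "v \<notin> V" and sym: "symp adj"
    and A: "psd_on (insert v V) A" "A v v = 0"
    and sap: "sap_on adj (insert v V) A"
    and x: "\<And>i. i \<in> insert v V \<Longrightarrow> (\<Sum>j\<in>insert v V. A i j * x j) = 0"
      "x v = 0" "\<And>i. i \<in> V \<Longrightarrow> adj v i \<Longrightarrow> x i = 0" and i: "i0 \<in> insert v V"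
  shows "x i0 = 0"
proof (cases "i0 = v")
  case False
  then have i0: "i0 \<in> V" using i by simp
  define X where "X i j = (if i = v then x j else 0) + (if j = v then x i else 0)" for i j
  have finI: "finite (insert v V)" using fin by simp
  have row: "A v j = 0" if "j \<in> insert v V" for j
    using psd_on_zero_row(1)[OF finI A(1) _ that A(2)] by simp
  have symA: "A k j = A j k" if "k \<in> insert v V" "j \<in> insert v V" for k j
    using A(1) that unfolding psd_on_def symmetric_on_def by blast
  have "X v i0 = 0"
  proof (rule sap_onD[OF sap])
    show "symmetric_on (insert v V) X" by (simp add: symmetric_on_def X_def)
  next
    fix i j assume ij: "i \<in> insert v V" "j \<in> insert v V"
    have "(\<Sum>k\<in>insert v V. X i k * A k j) =
      (\<Sum>k\<in>insert v V. (if i = v then A j k * x k else 0) + (if k = v then x i * A v j else 0))"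
      using symA[OF _ ij(2)] by (intro sum.cong refl) (auto simp: X_def algebra_simps)
    also have "\<dots> = (if i = v then (\<Sum>k\<in>insert v V. A j k * x k) else 0) + x i * A v j"
      using finI by (simp add: sum.distrib)
    also have "\<dots> = 0" using x(1)[OF ij(2)] row[OF ij(2)] by simp
    finally show "(\<Sum>k\<in>insert v V. X i k * A k j) = 0" .
  next
    fix i j assume ij: "i \<in> insert v V" "j \<in> insert v V" "i = j \<or> adj i j"
    then show "X i j = 0"
      using x(2,3) sympD[OF sym, of i j] by (auto simp: X_def)
  qed (use i0 in auto)
  then show ?thesis using False by (simp add: X_def x(2))
qed (simp add: x(2))

text \<open>Eliminating a vertex \<open>v\<close> with \<open>A v v \<noteq> 0\<close> preserves both the strong Arnold property and the
  kernel; if \<open>A v v = 0\<close>, the property itself makes the neighbourhood of \<open>v\<close> determine the kernel.\<close>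

lemma sap_kernel_determined_by_clique:
  assumes "elim_from adj {} V" "psd_on V A" "sparse_on adj V A" "sap_on adj V A" and sym: "symp adj"
  shows "\<exists>C\<subseteq>V. cliq adj C \<and> (\<forall>x. (\<forall>i\<in>V. (\<Sum>j\<in>V. A i j * x j) = 0) \<longrightarrow>
    (\<forall>i\<in>C. x i = 0) \<longrightarrow> (\<forall>i\<in>V. x i = 0))"
  using assms(1-4)
proof (induction arbitrary: A rule: elim_from.induct)
  case base
  show ?case by (simp add: cliq_def)
next
  case (step V v)
  have fin: "finite V" using elim_from_finite[OF step.hyps(1)] by simp
  have symA: "symmetric_on (insert v V) A" using step.prems(1) by (simp add: psd_on_def)
  show ?case
  proof (cases "A v v = 0")
    case True
    define C where "C = insert v {u\<in>V. adj v u}"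
    have "cliq adj C"
    proof (rule cliqI)
      fix i j assume "i \<in> C" "j \<in> C" "i \<noteq> j"
      then show "adj i j"
        using cliqD[OF step.hyps(3), of i j] sympD[OF sym, of v i] by (auto simp: C_def)
    qed
    moreover have "x i = 0" if "\<forall>i\<in>insert v V. (\<Sum>j\<in>insert v V. A i j * x j) = 0"
      "\<forall>i\<in>C. x i = 0" "i \<in> insert v V" for x i
      using sap_zero_diagonal[OF fin step.hyps(2) sym step.prems(1) True step.prems(3), of x i] that
      by (simp add: C_def)
    moreover have "C \<subseteq> insert v V" by (auto simp: C_def)
    ultimately show ?thesis by (intro exI[of _ C]) simp
  next
    case False
    then have pos: "0 < A v v" using psd_on_diagonal[OF _ step.prems(1), of v] fin by simp
    have S1: "psd_on V (schur v A)" by (rule psd_on_schur[OF fin step.hyps(2) step.prems(1) pos])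
    have S2: "sparse_on adj V (schur v A)"
      by (rule sparse_on_schur[OF step.prems(2) step.hyps(2,3) sym])
    have S3: "sap_on adj V (schur v A)"
      by (rule sap_on_schur[OF fin step.hyps(2,3) sym symA step.prems(2) False step.prems(3)])
    from step.IH[OF S1 S2 S3] obtain C where "C \<subseteq> V \<and> cliq adj C \<and>
      (\<forall>x. (\<forall>i\<in>V. (\<Sum>j\<in>V. schur v A i j * x j) = 0) \<longrightarrow> (\<forall>i\<in>C. x i = 0) \<longrightarrow> (\<forall>i\<in>V. x i = 0))"
      by (elim exE)
    then have C: "C \<subseteq> V" "cliq adj C" and ker: "\<And>x. \<forall>i\<in>V. (\<Sum>j\<in>V. schur v A i j * x j) = 0 \<Longrightarrow>
      \<forall>i\<in>C. x i = 0 \<Longrightarrow> \<forall>i\<in>V. x i = 0" by simp_all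
    have "\<forall>i\<in>insert v V. x i = 0"
      if x: "\<forall>i\<in>insert v V. (\<Sum>j\<in>insert v V. A i j * x j) = 0" "\<forall>i\<in>C. x i = 0" for x
    proof -
      have r: "A i v * x v + (\<Sum>j\<in>V. A i j * x j) = 0" if "i \<in> insert v V" for i
      proof -
        have "(\<Sum>j\<in>insert v V. A i j * x j) = 0" using x(1) that by blast
        then show ?thesis using fin step.hyps(2) by simp
      qed
      \<comment> \<open>Row \<open>v\<close> eliminates \<open>x v\<close>, so kernel vectors of
        \<open>A\<close> restrict to kernel vectors of the Schur complement.\<close>
      have "(\<Sum>j\<in>V. schur v A i j * x j) = 0" if "i \<in> V" for i
      proof -
        have "(\<Sum>j\<in>V. schur v A i j * x j) = (\<Sum>j\<in>V. A i j * x j) - A i v / A v v * (\<Sum>j\<in>V. A v j * x j)"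
          by (simp add: schur_def left_diff_distrib sum_subtractf sum_distrib_left mult.assoc)
        also have "(\<Sum>j\<in>V. A i j * x j) = - (A i v * x v)" using r[of i] that by simp
        also have "(\<Sum>j\<in>V. A v j * x j) = - (A v v * x v)" using r[of v] by simp
        finally show ?thesis using False by simp
      qed
      then have "\<forall>i\<in>V. x i = 0" using ker x(2) by blast
      moreover from this have "x v = 0" using r[of v] False by simp
      ultimately show ?thesis by simp
    qed
    then show ?thesis using C by (intro exI[of _ C]) auto
  qed
qed

lemma subspace_matrix_kernel: "fun_space.subspace (matrix_kernel I A)"
  unfolding fun_space.subspace_def matrix_kernel_def
  by (auto simp: coord_space_def scale_fun_def distrib_left sum.distrib
      mult.left_commute[of _ "_ :: real"] sum_distrib_left[symmetric])

text \<open>If a summand that is nonzero at \<open>u\<close> and \<open>v\<close> lived inside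
  \<open>C\<close>, it would impose a linear relation on the values of kernel vectors on
  \<open>C\<close>. Then \<open>C - {u}\<close> would determine the kernel, and the corank would be
  below \<open>card C\<close>.\<close>

lemma (in multigraph) psd_sap_corank:
  assumes ch: "chordal G" and A: "A \<in> A_star G" "psd_on (verts G) A" "SAP G A"
  shows "\<exists>C. clique G C \<and> corank_on (verts G) A \<le> card C \<and> (corank_on (verts G) A = card C \<longrightarrow>
    (\<forall>u\<in>C. \<forall>v\<in>C. u \<noteq> v \<longrightarrow> parallel G u v \<or> (\<exists>D. maximal_clique G D \<and> D \<noteq> C \<and> {u, v} \<subseteq> D)))"
proof -
  define V where "V = verts G"
  note fin = finite_verts[folded V_def]
  have el: "elim_from (adjacent G) {} V"
    using chordal_elim[OF ch, of "{}"] by (simp add: clique_def V_def)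
  have sp: "sparse_on (adjacent G) V A" using A(1) by (simp add: A_star_def sparse_on_def V_def)
  note psd = A(2)[folded V_def]
  obtain C where "C \<subseteq> V \<and> cliq (adjacent G) C \<and> (\<forall>x. (\<forall>i\<in>V. (\<Sum>j\<in>V. A i j * x j) = 0) \<longrightarrow>
    (\<forall>i\<in>C. x i = 0) \<longrightarrow> (\<forall>i\<in>V. x i = 0))"
    using sap_kernel_determined_by_clique[OF el psd sp _ symp_adjacent] A(3) unfolding SAP_iff V_def by blast
  then have C: "C \<subseteq> V" "cliq (adjacent G) C" and det: "\<And>x. \<forall>i\<in>V. (\<Sum>j\<in>V. A i j * x j) = 0 \<Longrightarrow>
    \<forall>i\<in>C. x i = 0 \<Longrightarrow> \<forall>i\<in>V. x i = 0" by simp_all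
  have finC: "finite C" using C(1) fin finite_subset by blast
  have clC: "clique G C" using C by (simp add: clique_iff V_def)
  define M where "M = matrix_kernel V A"
  have M: "x \<in> coord_space V" "\<forall>i\<in>V. (\<Sum>j\<in>V. A i j * x j) = 0" if "x \<in> M" for x
    using that by (simp_all add: M_def matrix_kernel_def)
  have det': "x = 0" if "x \<in> M" "\<And>i. i \<in> C \<Longrightarrow> x i = 0" for x
    using det[OF M(2)[OF that(1)]] that(2) M(1)[OF that(1)] by (auto simp: coord_space_def fun_eq_iff)
  have bound: "corank_on V A \<le> card K"
    if "K \<subseteq> C" "\<And>x. x \<in> M \<Longrightarrow> (\<And>i. i \<in> K \<Longrightarrow> x i = 0) \<Longrightarrow> x = 0" for K
    unfolding corank_on_def
    by (rule dim_le_card_restriction[OF finite_subset[OF that(1) finC] subspace_matrix_kernel subset_refl])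
      (use that(2) M_def in blast)
  have le: "corank_on V A \<le> card C" using bound[of C] det' by blast
  have "parallel G u v \<or> (\<exists>D. maximal_clique G D \<and> D \<noteq> C \<and> {u, v} \<subseteq> D)"
    if eq: "corank_on V A = card C" and uv: "u \<in> C" "v \<in> C" "u \<noteq> v" for u v
  proof (cases "parallel G u v")
    case False
    obtain w :: "'v \<Rightarrow> 'v \<Rightarrow> real" where "(\<forall>v\<in>V. cliq (adjacent G) {i\<in>V. w v i \<noteq> 0}) \<and>
      (\<forall>i\<in>V. \<forall>j\<in>V. A i j = (\<Sum>v\<in>V. w v i * w v j))"
      using psd_clique_decomposition[OF el psd sp symp_adjacent] by blast
    then have w: "\<And>v. v \<in> V \<Longrightarrow> cliq (adjacent G) {i\<in>V. w v i \<noteq> 0}"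
      "\<And>i j. i \<in> V \<Longrightarrow> j \<in> V \<Longrightarrow> A i j = (\<Sum>v\<in>V. w v i * w v j)" by simp_all
    have uvV: "u \<in> V" "v \<in> V" using uv C by auto
    have "adjacent G u v" using cliqD[OF C(2) uv] .
    then have "card (joining G u v) \<noteq> 0" using finite_joining by (simp add: adjacent_def)
    then have "card (joining G u v) = 1" using False by (simp add: parallel_def)
    \<comment> \<open>A single edge forces a nonzero entry, so some summand is nonzero at both
      ends.\<close>
    then have "A u v \<noteq> 0" using A(1) uvV uv(3) by (simp add: A_star_def V_def)
    then obtain t where t: "t \<in> V" "w t u * w t v \<noteq> 0"
      unfolding w(2)[OF uvV] by (meson sum.not_neutral_contains_not_neutral)
    define S where "S = {i\<in>V. w t i \<noteq> 0}"
    have "clique G S" using w(1)[OF t(1)] by (auto simp: clique_iff S_def V_def)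
    then obtain D where D: "maximal_clique G D" "S \<subseteq> D" using maximal_clique_extension by blast
    have uvS: "u \<in> S" "v \<in> S" using t uvV by (auto simp: S_def)
    have "\<not> S \<subseteq> C"
    proof
      assume SC: "S \<subseteq> C"
      have "x = 0" if x: "x \<in> M" "\<And>i. i \<in> C - {u} \<Longrightarrow> x i = 0" for x
      proof -
        \<comment> \<open>On a kernel vector the form is a sum of squares equal to 0, so each vector
          \<open>w s\<close> is orthogonal to it.\<close>
        have "quad_form V A x = 0" using M(2)[OF x(1)] by (simp add: quad_form_altdef)
        also have "quad_form V A x = (\<Sum>i\<in>V. \<Sum>j\<in>V. \<Sum>s\<in>V. (w s i * x i) * (w s j * x j))"
          unfolding quad_form_def
          by (intro sum.cong refl) (simp add: w(2) sum_distrib_left sum_distrib_right algebra_simps)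
        also have "\<dots> = (\<Sum>i\<in>V. \<Sum>s\<in>V. \<Sum>j\<in>V. (w s i * x i) * (w s j * x j))"
          by (intro sum.cong refl sum.swap)
        also have "\<dots> = (\<Sum>s\<in>V. \<Sum>i\<in>V. \<Sum>j\<in>V. (w s i * x i) * (w s j * x j))"
          by (rule sum.swap)
        also have "\<dots> = (\<Sum>s\<in>V. (\<Sum>i\<in>V. w s i * x i)\<^sup>2)"
          by (simp add: power2_eq_square sum_product)
        finally have "(\<Sum>i\<in>V. w t i * x i) = 0"
          using t(1) fin by (simp add: sum_nonneg_eq_0_iff)
        also have "(\<Sum>i\<in>V. w t i * x i) = (\<Sum>i\<in>V. if i = u then w t u * x u else 0)"
          using SC x(2) by (intro sum.cong refl) (auto simp: S_def)
        finally have "x u = 0" using fin uvV t(2) by simp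
        then show ?thesis using det'[OF x(1)] x(2) by blast
      qed
      then have "corank_on V A \<le> card (C - {u})" by (intro bound) auto
      also have "\<dots> < card C" using finC uv(1) by (meson card_Diff1_less)
      finally show False using eq by simp
    qed
    then have "D \<noteq> C" using D(2) by blast
    then show ?thesis using D uvS by blast
  qed simp
  then show ?thesis using clC le unfolding V_def by blast
qed

section \<open>Rigidity of super stable tensegrities\<close>

lemma (in multigraph) ends_pairE:
  assumes "e \<in> edges G"
  obtains a b where "ends G e = {a, b}" "a \<noteq> b" "a \<in> verts G" "b \<in> verts G"
proof -
  obtain a b where "ends G e = {a, b}" "a \<noteq> b"
    using loopfree[OF assms] by (meson card_2_iff)
  then show ?thesis using that ends_subset[OF assms] by simp
qed

text \<open>Both sums are row \<open>i\<close> of the matrix of one edge applied to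
  \<open>x\<close>. Comparing them passes from the entries of \<open>laplacian\<close> to the sums
  over \<open>joining\<close> in \<open>equilibrium_stress\<close>.\<close>

lemma (in multigraph) edge_laplacian_row:
  assumes e: "e \<in> edges G" "ends G e = {a, b}" and i: "i \<in> verts G"
  shows "(\<Sum>j\<in>verts G. (if i \<in> ends G e \<and> j \<in> ends G e then (if i = j then 1 else -1) else 0) * x j)
    = (if i = a then x a - x b else if i = b then x b - x a else (0 :: real))"
    "(\<Sum>j\<in>verts G. if ends G e = {i, j} then x i - x j else 0)
    = (if i = a then x a - x b else if i = b then x b - x a else 0)"
proof -
  have ab: "a \<noteq> b" "a \<in> verts G" "b \<in> verts G"
    using loopfree[OF e(1)] ends_subset[OF e(1)] e(2) by (auto simp: card_2_iff)
  have "(\<Sum>j\<in>verts G. (if i \<in> ends G e \<and> j \<in> ends G e then (if i = j then 1 else -1) else 0) * x j)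
    = (\<Sum>j\<in>verts G. (if j = a then (if i = a then x a else if i = b then - x a else 0) else 0)
      + (if j = b then (if i = a then - x b else if i = b then x b else 0) else 0))"
    using ab by (intro sum.cong refl) (auto simp: e(2))
  also have "\<dots> = (if i = a then x a - x b else if i = b then x b - x a else 0)"
    using ab finite_verts by (simp add: sum.distrib)
  finally show "(\<Sum>j\<in>verts G. (if i \<in> ends G e \<and> j \<in> ends G e then (if i = j then 1 else -1) else 0) * x j)
    = (if i = a then x a - x b else if i = b then x b - x a else 0)" .
  have "(\<Sum>j\<in>verts G. if ends G e = {i, j} then x i - x j else 0)
    = (\<Sum>j\<in>verts G. (if j = b then (if i = a then x a - x b else 0) else 0)
      + (if j = a then (if i = b then x b - x a else 0) else 0))"
    using ab by (intro sum.cong refl) (auto simp: e(2) doubleton_eq_iff)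
  also have "\<dots> = (if i = a then x a - x b else if i = b then x b - x a else 0)"
    using ab finite_verts by (simp add: sum.distrib)
  finally show "(\<Sum>j\<in>verts G. if ends G e = {i, j} then x i - x j else 0)
    = (if i = a then x a - x b else if i = b then x b - x a else 0)" .
qed

lemma (in multigraph) laplacian_row:
  "(\<Sum>j\<in>verts G. laplacian G \<omega> i j * x j) = (\<Sum>e\<in>edges G. \<omega> e *
    (\<Sum>j\<in>verts G. (if i \<in> ends G e \<and> j \<in> ends G e then (if i = j then 1 else -1) else 0) * x j))"
  unfolding laplacian_def sum_distrib_right sum_distrib_left
  by (subst sum.swap) (simp add: mult.assoc)

lemma (in multigraph) laplacian_apply:
  assumes i: "i \<in> verts G"
  shows "(\<Sum>j\<in>verts G. laplacian G \<omega> i j * x j) =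
    (\<Sum>j\<in>verts G. \<Sum>e\<in>joining G i j. \<omega> e * (x i - x j))"
proof -
  have "(\<Sum>j\<in>verts G. laplacian G \<omega> i j * x j) = (\<Sum>e\<in>edges G. \<omega> e *
    (\<Sum>j\<in>verts G. if ends G e = {i, j} then x i - x j else 0))"
    unfolding laplacian_row
  proof (intro sum.cong refl)
    fix e assume e: "e \<in> edges G"
    obtain a b where "ends G e = {a, b}" using ends_pairE[OF e] .
    from edge_laplacian_row[OF e this i, of x]
    show "\<omega> e * (\<Sum>j\<in>verts G. (if i \<in> ends G e \<and> j \<in> ends G e then (if i = j then 1 else -1) else 0) * x j)
      = \<omega> e * (\<Sum>j\<in>verts G. if ends G e = {i, j} then x i - x j else 0)" by (simp only:)
  qed
  also have "\<dots> = (\<Sum>j\<in>verts G. \<Sum>e\<in>edges G. if ends G e = {i, j} then \<omega> e * (x i - x j) else 0)"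
    unfolding sum_distrib_left by (subst sum.swap) (intro sum.cong refl, simp)
  also have "\<dots> = (\<Sum>j\<in>verts G. \<Sum>e\<in>joining G i j. \<omega> e * (x i - x j))"
    unfolding joining_def using finite_edges
    by (intro sum.cong refl sum.inter_filter[symmetric])
  finally show ?thesis .
qed

lemma (in multigraph) equilibrium_stress_iff:
  "equilibrium_stress G m p \<omega> \<longleftrightarrow>
    (\<forall>i\<in>verts G. \<forall>k<m. (\<Sum>j\<in>verts G. laplacian G \<omega> i j * p j k) = 0)"
proof -
  have "(\<Sum>j\<in>verts G. \<Sum>e\<in>joining G i j. \<omega> e * (p j k - p i k)) =
    - (\<Sum>j\<in>verts G. laplacian G \<omega> i j * p j k)" if "i \<in> verts G" for i k
    unfolding laplacian_apply[OF that, of _ "\<lambda>j. p j k"] sum_negf[symmetric]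
    by (intro sum.cong refl) (simp add: algebra_simps)
  then show ?thesis by (simp add: equilibrium_stress_def)
qed

lemma (in multigraph) laplacian_const: "i \<in> verts G \<Longrightarrow> (\<Sum>j\<in>verts G. laplacian G \<omega> i j * c) = 0"
  using laplacian_apply[of i \<omega> "\<lambda>_. c"] by simp

lemma (in multigraph) laplacian_quad_form:
  assumes ab: "\<And>e. e \<in> edges G \<Longrightarrow> ends G e = {a e, b e}"
  shows "quad_form (verts G) (laplacian G \<omega>) x = (\<Sum>e\<in>edges G. \<omega> e * (x (a e) - x (b e))\<^sup>2)"
proof -
  have "quad_form (verts G) (laplacian G \<omega>) x = (\<Sum>i\<in>verts G. x i * (\<Sum>e\<in>edges G. \<omega> e *
    (if i = a e then x (a e) - x (b e) else if i = b e then x (b e) - x (a e) else 0)))"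
    unfolding quad_form_altdef laplacian_row
    by (intro sum.cong refl arg_cong[of _ _ "(*) _"] edge_laplacian_row(1) ab) simp_all
  also have "\<dots> = (\<Sum>e\<in>edges G. \<omega> e * (\<Sum>i\<in>verts G. x i *
    (if i = a e then x (a e) - x (b e) else if i = b e then x (b e) - x (a e) else 0)))"
    unfolding sum_distrib_left by (subst sum.swap) (simp add: mult.left_commute)
  also have "\<dots> = (\<Sum>e\<in>edges G. \<omega> e * (x (a e) - x (b e))\<^sup>2)"
  proof (intro sum.cong refl arg_cong[of _ _ "(*) _"])
    fix e assume e: "e \<in> edges G"
    have v: "a e \<noteq> b e" "a e \<in> verts G" "b e \<in> verts G"
      using loopfree[OF e] ends_subset[OF e] ab[OF e] by (auto simp: card_2_iff)
    have "(\<Sum>i\<in>verts G. x i * (if i = a e then x (a e) - x (b e) else if i = b e then x (b e) - x (a e) else 0))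
      = (\<Sum>i\<in>verts G. (if i = a e then x (a e) * (x (a e) - x (b e)) else 0) +
        (if i = b e then x (b e) * (x (b e) - x (a e)) else 0))"
      using v by (intro sum.cong refl) auto
    also have "\<dots> = (x (a e) - x (b e))\<^sup>2"
      using v finite_verts by (simp add: sum.distrib power2_eq_square algebra_simps)
    finally show "(\<Sum>i\<in>verts G. x i * (if i = a e then x (a e) - x (b e)
      else if i = b e then x (b e) - x (a e) else 0)) = (x (a e) - x (b e))\<^sup>2" .
  qed
  finally show ?thesis .
qed

text \<open>Otherwise all differences of points lie in the hyperplane normal to \<open>c\<close>,
  whose vectors are determined by their coordinates other than \<open>k0\<close>, and the dimension
  would be below \<open>d\<close>.\<close>

lemma affine_dim_eq_full:
  assumes pE: "p ` V \<subseteq> coord_space {..<d}" and dim: "affine_dim (p ` V) = d"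
    and const: "\<And>i j. i \<in> V \<Longrightarrow> j \<in> V \<Longrightarrow> (\<Sum>k<d. c k * (p i k - p j k)) = 0" and k0: "k0 < d"
  shows "c k0 = 0"
proof (rule ccontr)
  assume n: "c k0 \<noteq> 0"
  define M where "M = {x \<in> coord_space {..<d}. (\<Sum>k<d. c k * x k) = 0}"
  have "fun_space.dim {x - y | x y. x \<in> p ` V \<and> y \<in> p ` V} \<le> card ({..<d} - {k0})"
  proof (rule dim_le_card_restriction)
    show "fun_space.subspace M"
      by (auto simp: M_def fun_space.subspace_def coord_space_def scale_fun_def distrib_left
          sum.distrib mult.left_commute[of _ "_ :: real"] sum_distrib_left[symmetric])
    show "{x - y | x y. x \<in> p ` V \<and> y \<in> p ` V} \<subseteq> M"
    proof
      fix z assume "z \<in> {x - y | x y. x \<in> p ` V \<and> y \<in> p ` V}"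
      then obtain i j where ij: "i \<in> V" "j \<in> V" "z = p i - p j" by auto
      have "z \<in> coord_space {..<d}"
        unfolding ij(3) using pE ij by (intro fun_space.subspace_diff[OF subspace_coord_space]) auto
      then show "z \<in> M" using const[OF ij(1,2)] by (simp add: M_def ij(3))
    qed
  next
    fix x assume x: "x \<in> M" "\<And>i. i \<in> {..<d} - {k0} \<Longrightarrow> x i = 0"
    have "0 = (\<Sum>k<d. c k * x k)" using x(1) by (simp add: M_def)
    also have "\<dots> = (\<Sum>k<d. if k = k0 then c k0 * x k0 else 0)"
      using x(2) by (intro sum.cong refl) auto
    also have "\<dots> = c k0 * x k0" using k0 by simp
    finally have "x k0 = 0" using n by simp
    show "x = 0"
    proof
      fix i
      show "x i = 0 i"
        using x \<open>x k0 = 0\<close> by (cases "i < d"; cases "i = k0") (auto simp: M_def coord_space_def)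
    qed
  qed simp
  then show False using dim k0 by (simp add: affine_dim_def)
qed

text \<open>Connelly's energy argument. The stress energy of \<open>q\<close> is at most that of
  \<open>p\<close>, which is 0, and it is nonnegative. So all edge lengths are kept and the
  coordinates of \<open>q\<close> lie in the kernel, which makes \<open>q\<close> an affine image of
  \<open>p\<close>; the condition on \<open>S\<close> in \<open>super_stable\<close> forces its
  linear part to be orthogonal.\<close>

lemma (in multigraph) super_stable_rigid:
  assumes ss: "super_stable d G \<sigma> p" and q: "deformation G d \<sigma> p q"
  shows "d \<le> affine_dim (q ` verts G)"
proof -
  define V where "V = verts G"
  note fin = finite_verts[folded V_def]
  have T: "\<And>e. e \<in> edges G \<Longrightarrow> \<sigma> e \<in> {1, -1}" "\<And>v. v \<in> V \<Longrightarrow> p v \<in> coord_space {..<d}"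
    and dimp: "affine_dim (p ` V) = d"
    using ss by (auto simp: super_stable_def tensegrity_def V_def)
  obtain \<omega> where eq: "equilibrium_stress G d p \<omega>" and pr: "strictly_proper G \<sigma> \<omega>"
    and psd: "psd_on V (laplacian G \<omega>)" and cor: "corank_on V (laplacian G \<omega>) = d + 1"
    using ss unfolding super_stable_def V_def by blast
  have conic: "\<not> (\<exists>S. symmetric_on {..<d} S \<and> nonzero_on {..<d} S \<and>
        (\<forall>i j. adjacent G i j \<longrightarrow> quad_form {..<d} S (p j - p i) = 0))"
    using ss unfolding super_stable_def by blast
  define L where "L = laplacian G \<omega>"
  have "\<forall>e\<in>edges G. \<exists>a b. ends G e = {a, b}" using ends_pairE by meson
  then obtain a b where ab: "\<And>e. e \<in> edges G \<Longrightarrow> ends G e = {a e, b e}" by metis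
  have abJ: "e \<in> joining G (a e) (b e)" if "e \<in> edges G" for e using that ab by (simp add: joining_def)
  have qE: "q v \<in> coord_space {..<d}" if "v \<in> V" for v using q that by (simp add: deformation_def V_def)
  have Lp: "(\<Sum>j\<in>V. L i j * p j k) = 0" if "i \<in> V" "k < d" for i k
    using eq that unfolding equilibrium_stress_iff V_def L_def by blast
  \<comment> \<open>The energy, once by coordinates and once by edges.\<close>
  have sumq: "(\<Sum>k<d. quad_form V L (\<lambda>v. r v k)) = (\<Sum>e\<in>edges G. \<omega> e * sqd d (r (a e)) (r (b e)))" for r
  proof -
    have "(\<Sum>k<d. quad_form V L (\<lambda>v. r v k)) = (\<Sum>k<d. \<Sum>e\<in>edges G. \<omega> e * (r (a e) k - r (b e) k)\<^sup>2)"
      unfolding V_def L_def using laplacian_quad_form[OF ab] by simp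
    also have "\<dots> = (\<Sum>e\<in>edges G. \<omega> e * sqd d (r (a e)) (r (b e)))"
      by (subst sum.swap) (simp add: sqd_def sum_distrib_left)
    finally show ?thesis .
  qed
  have "quad_form V L (\<lambda>v. p v k) = 0" if "k < d" for k
    using Lp that by (simp add: quad_form_altdef)
  then have p0: "(\<Sum>e\<in>edges G. \<omega> e * sqd d (p (a e)) (p (b e))) = 0"
    using sumq[of p] by simp
  have qnn: "0 \<le> quad_form V L (\<lambda>v. q v k)" for k
    using psd_on_nonneg[OF psd] by (simp add: L_def)
  have edge: "\<omega> e * sqd d (q (a e)) (q (b e)) \<le> \<omega> e * sqd d (p (a e)) (p (b e))" "\<omega> e \<noteq> 0"
    if e: "e \<in> edges G" for e
  proof -
    have pe: "\<sigma> e * \<omega> e > 0" using pr e by (simp add: strictly_proper_def)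
    have d: "\<sigma> e = 1 \<Longrightarrow> sqd d (q (a e)) (q (b e)) \<le> sqd d (p (a e)) (p (b e))"
      "\<sigma> e = -1 \<Longrightarrow> sqd d (p (a e)) (p (b e)) \<le> sqd d (q (a e)) (q (b e))"
      using q abJ[OF e] unfolding deformation_def point_dist_sqd real_sqrt_le_iff by blast+
    show "\<omega> e \<noteq> 0" using pe by auto
    show "\<omega> e * sqd d (q (a e)) (q (b e)) \<le> \<omega> e * sqd d (p (a e)) (p (b e))"
    proof (cases "\<sigma> e = 1")
      case True
      then show ?thesis using pe d(1) by (intro mult_left_mono) auto
    next
      case False
      then have "\<sigma> e = -1" using T(1)[OF e] by simp
      then show ?thesis using pe d(2) by (intro mult_left_mono_neg) auto
    qed
  qed
  have "(\<Sum>e\<in>edges G. \<omega> e * sqd d (q (a e)) (q (b e))) \<le>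
    (\<Sum>e\<in>edges G. \<omega> e * sqd d (p (a e)) (p (b e)))" by (intro sum_mono edge(1))
  then have "(\<Sum>e\<in>edges G. \<omega> e * sqd d (q (a e)) (q (b e))) \<le> 0" using p0 by simp
  then have "(\<Sum>k<d. quad_form V L (\<lambda>v. q v k)) \<le> 0" using sumq[of q] by simp
  moreover have "(\<Sum>k<d. quad_form V L (\<lambda>v. q v k)) \<ge> 0" using qnn by (simp add: sum_nonneg)
  ultimately have q0: "(\<Sum>k<d. quad_form V L (\<lambda>v. q v k)) = 0" by simp
  then have qk0: "quad_form V L (\<lambda>v. q v k) = 0" if "k < d" for k
    using that qnn by (simp add: sum_nonneg_eq_0_iff)
  have Lq: "(\<Sum>j\<in>V. L i j * q j k) = 0" if "i \<in> V" "k < d" for i k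
    using psd_on_kernel[OF fin psd that(1), of "\<lambda>v. q v k"] qk0[OF that(2)] by (simp add: L_def)
  have "(\<Sum>e\<in>edges G. \<omega> e * sqd d (p (a e)) (p (b e)) - \<omega> e * sqd d (q (a e)) (q (b e))) = 0"
    using p0 q0 sumq[of q] by (simp add: sum_subtractf)
  then have edge_eq: "sqd d (q (a e)) (q (b e)) = sqd d (p (a e)) (p (b e))" if "e \<in> edges G" for e
    using that edge finite_edges by (simp add: sum_nonneg_eq_0_iff)
  define M where "M = matrix_kernel V L"
  \<comment> \<open>The \<open>d\<close> coordinates of \<open>p\<close> and, at index
    \<open>d\<close>, the all-ones vector. They are independent since \<open>p\<close> spans
    \<open>d\<close> dimensions, so by the corank \<open>d + 1\<close> they span the kernel.\<close>
  define P where "P k = (\<lambda>v. if v \<in> V then if k < d then p v k else 1 else 0)" for k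
  have PM: "P k \<in> M" for k
    using Lp laplacian_const[of _ \<omega> 1]
    by (cases "k < d") (auto simp: P_def M_def matrix_kernel_def coord_space_def L_def V_def)
  have ind: "c l = 0" if c: "(\<Sum>k\<le>d. scale_fun (c k) (P k)) = 0" and l: "l \<le> d" for c l
  proof -
    have s: "(\<Sum>k<d. c k * p v k) + c d = 0" if "v \<in> V" for v
    proof -
      have "0 = (\<Sum>k\<le>d. scale_fun (c k) (P k)) v" using c by simp
      also have "\<dots> = (\<Sum>k<d. c k * p v k) + c d"
        using that by (simp add: sum_fun_apply scale_fun_def P_def lessThan_Suc_atMost[symmetric])
      finally show ?thesis by simp
    qed
    have "(\<Sum>k<d. c k * (p i k - p j k)) = 0" if "i \<in> V" "j \<in> V" for i j
      using s[OF that(1)] s[OF that(2)] by (simp add: right_diff_distrib sum_subtractf)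
    then have "c k = 0" if "k < d" for k
      using affine_dim_eq_full[OF _ dimp _ that, of c] T(2) by blast
    moreover from this have "c d = 0" using s verts_nonempty unfolding V_def by fastforce
    ultimately show ?thesis using l by (cases "l = d") auto
  qed
  have "M \<subseteq> fun_space.span (P ` {..d})"
  proof (rule subset_span_if_card_eq_dim[OF fin])
    show "fun_space.subspace M" unfolding M_def by (rule subspace_matrix_kernel)
    show "x = 0" if "x \<in> M" "\<And>i. i \<in> V \<Longrightarrow> x i = 0" for x
      using that by (auto simp: M_def matrix_kernel_def coord_space_def fun_eq_iff)
    show "P ` {..d} \<subseteq> M" using PM by blast
    show "fun_space.independent (P ` {..d})" by (rule independent_family(1)) (use ind in auto)
    have "card (P ` {..d}) = card {..d}"
      by (rule card_image, rule independent_family(2)) (use ind in auto)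
    then show "card (P ` {..d}) = fun_space.dim M" using cor by (simp add: corank_on_def M_def L_def)
  qed simp
  moreover have "(\<lambda>v. if v \<in> V then q v k else 0) \<in> M" if "k < d" for k
    using Lq that by (simp add: M_def matrix_kernel_def coord_space_def)
  ultimately have "\<exists>u. (\<lambda>v. if v \<in> V then q v k else 0) = (\<Sum>x\<in>P ` {..d}. scale_fun (u x) x)" if "k < d" for k
    using that by (auto simp: fun_space.span_finite)
  then obtain u where u: "\<And>k. k < d \<Longrightarrow>
    (\<lambda>v. if v \<in> V then q v k else 0) = (\<Sum>x\<in>P ` {..d}. scale_fun (u k x) x)" by metis
  define m where "m k l = u k (P l)" for k l
  have qp: "q v k = (\<Sum>l<d. m k l * p v l) + m k d" if v: "v \<in> V" and k: "k < d" for v k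
  proof -
    have "q v k = (\<Sum>x\<in>P ` {..d}. scale_fun (u k x) x) v" using fun_cong[OF u[OF k], of v] v by simp
    also have "\<dots> = (\<Sum>l\<le>d. m k l * P l v)"
      unfolding sum_fun_apply scale_fun_def m_def
      by (subst sum.reindex[OF independent_family(2)]) (use ind in auto)
    also have "\<dots> = (\<Sum>l<d. m k l * p v l) + m k d"
      using v by (simp add: P_def lessThan_Suc_atMost[symmetric])
    finally show ?thesis .
  qed
  have diff: "q i k - q j k = (\<Sum>l<d. m k l * (p i l - p j l))" if "i \<in> V" "j \<in> V" "k < d" for i j k
    using qp that by (simp add: right_diff_distrib sum_subtractf)
  \<comment> \<open>\<open>S\<close> is \<open>M^T M - I\<close> for the linear part
    \<open>M\<close> with entries \<open>m\<close>. Its form measures the change of squared length,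
    which is 0 along edges.\<close>
  define S where "S l l' = (\<Sum>k<d. m k l * m k l') - (if l = l' then 1 else 0)" for l l'
  have quadS: "quad_form {..<d} S z = (\<Sum>k<d. (\<Sum>l<d. m k l * z l)\<^sup>2) - (\<Sum>l<d. (z l)\<^sup>2)" for z
  proof -
    have "quad_form {..<d} S z = (\<Sum>l<d. \<Sum>l'<d. (\<Sum>k<d. (m k l * z l) * (m k l' * z l')) -
        (if l = l' then z l * z l' else 0))"
      unfolding quad_form_def S_def
      by (intro sum.cong refl) (simp add: sum_distrib_left sum_distrib_right algebra_simps)
    also have "\<dots> = (\<Sum>l<d. \<Sum>l'<d. \<Sum>k<d. (m k l * z l) * (m k l' * z l')) - (\<Sum>l<d. (z l)\<^sup>2)"
      by (simp add: sum_subtractf power2_eq_square)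
    also have "(\<Sum>l<d. \<Sum>l'<d. \<Sum>k<d. (m k l * z l) * (m k l' * z l')) =
        (\<Sum>l<d. \<Sum>k<d. \<Sum>l'<d. (m k l * z l) * (m k l' * z l'))"
      by (intro sum.cong refl sum.swap)
    also have "\<dots> = (\<Sum>k<d. \<Sum>l<d. \<Sum>l'<d. (m k l * z l) * (m k l' * z l'))" by (rule sum.swap)
    also have "\<dots> = (\<Sum>k<d. (\<Sum>l<d. m k l * z l)\<^sup>2)" by (simp add: power2_eq_square sum_product)
    finally show ?thesis .
  qed
  have "quad_form {..<d} S (p j - p i) = 0" if adj: "adjacent G i j" for i j
  proof -
    note v = adjacentD[OF adj, folded V_def]
    obtain e where e: "e \<in> edges G" "ends G e = {i, j}" using adj by (auto simp: adjacent_def joining_def)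
    then have "a e = i \<and> b e = j \<or> a e = j \<and> b e = i" using ab[OF e(1)] by (simp add: doubleton_eq_iff)
    then have eq': "sqd d (q j) (q i) = sqd d (p j) (p i)"
      using edge_eq[OF e(1)] by (auto simp: sqd_commute)
    have "(\<Sum>k<d. (\<Sum>l<d. m k l * (p j - p i) l)\<^sup>2) = sqd d (q j) (q i)"
      unfolding sqd_def using diff[OF v(2,1)] by simp
    then show ?thesis unfolding quadS eq' by (simp add: sqd_def)
  qed
  moreover have "symmetric_on {..<d} S" by (simp add: symmetric_on_def S_def mult.commute eq_commute)
  ultimately have "\<not> nonzero_on {..<d} S" using conic by blast
  then have orth: "(\<Sum>k<d. m k l * m k l') = (if l = l' then 1 else 0)" if "l < d" "l' < d" for l l'
    using that by (auto simp: nonzero_on_def S_def)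
  \<comment> \<open>The transpose of the linear part, which inverts it on differences because its
    columns are orthonormal.\<close>
  define \<phi> :: "(nat \<Rightarrow> real) \<Rightarrow> nat \<Rightarrow> real"
    where "\<phi> y = (\<lambda>l. if l < d then \<Sum>k<d. m k l * y k else 0)" for y
  have lin: "Vector_Spaces.linear scale_fun scale_fun \<phi>"
    by unfold_locales
      (auto simp: \<phi>_def scale_fun_def fun_eq_iff algebra_simps sum.distrib sum_distrib_left)
  have inv: "p i - p j = \<phi> (q i - q j)" if "i \<in> V" "j \<in> V" for i j
  proof
    fix l
    show "(p i - p j) l = \<phi> (q i - q j) l"
    proof (cases "l < d")
      case True
      have "(\<Sum>k<d. m k l * (q i - q j) k) = (\<Sum>k<d. \<Sum>l'<d. (p i l' - p j l') * (m k l * m k l'))"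
        using diff[OF that] by (simp add: sum_distrib_left mult.left_commute mult.commute)
      also have "\<dots> = (\<Sum>l'<d. (p i l' - p j l') * (\<Sum>k<d. m k l * m k l'))"
        by (subst sum.swap) (simp add: sum_distrib_left)
      also have "\<dots> = (\<Sum>l'<d. if l' = l then p i l - p j l else 0)"
        using orth True by (intro sum.cong refl) auto
      finally show ?thesis using True by (simp add: \<phi>_def)
    next
      case False
      then show ?thesis using T(2)[OF that(1)] T(2)[OF that(2)] by (simp add: \<phi>_def coord_space_def)
    qed
  qed
  have "fun_space.dim {x - y | x y. x \<in> p ` V \<and> y \<in> p ` V} \<le>
    fun_space.dim {x - y | x y. x \<in> q ` V \<and> y \<in> q ` V}"
  proof (rule dim_linear_image_le[OF lin, of _ "{..<d}"])
    show "{x - y | x y. x \<in> q ` V \<and> y \<in> q ` V} \<subseteq> coord_space {..<d}"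
      using qE by (auto intro!: fun_space.subspace_diff[OF subspace_coord_space])
    show "{x - y | x y. x \<in> p ` V \<and> y \<in> p ` V} \<subseteq> \<phi> ` {x - y | x y. x \<in> q ` V \<and> y \<in> q ` V}"
    proof
      fix z assume "z \<in> {x - y | x y. x \<in> p ` V \<and> y \<in> p ` V}"
      then obtain i j where ij: "i \<in> V" "j \<in> V" "z = p i - p j" by auto
      then have "z = \<phi> (q i - q j)" using inv by simp
      then show "z \<in> \<phi> ` {x - y | x y. x \<in> q ` V \<and> y \<in> q ` V}" using ij by auto
    qed
  qed simp
  then show ?thesis using dimp unfolding affine_dim_def V_def by simp
qed

section \<open>Lower bounds from induced subgraphs\<close>

lemma affine_dim_mono:
  fixes S :: "(nat \<Rightarrow> real) set"
  assumes "S' \<subseteq> S" "S \<subseteq> coord_space {..<d}"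
  shows "affine_dim S' \<le> affine_dim S"
  unfolding affine_dim_def
proof (rule dim_linear_image_le)
  show "Vector_Spaces.linear scale_fun scale_fun (\<lambda>x :: nat \<Rightarrow> real. x)"
    by unfold_locales simp_all
  show "{x - y | x y. x \<in> S \<and> y \<in> S} \<subseteq> coord_space {..<d}"
    using assms(2) by (auto intro!: fun_space.subspace_diff[OF subspace_coord_space])
qed (use assms(1) in auto)

lemma joining_induced:
  "i \<in> U \<Longrightarrow> j \<in> U \<Longrightarrow> joining (induced G U) i j = joining G i j"
  by (auto simp: joining_def induced_def)

lemma (in multigraph) multigraph_induced:
  assumes "verts G \<inter> U \<noteq> {}"
  shows "multigraph (induced G U)"
proof
  show "finite (verts (induced G U))" using finite_verts by (simp add: induced_def)
  show "finite (edges (induced G U))" using finite_edges by (simp add: induced_def)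
  show "verts (induced G U) \<noteq> {}" using assms by (simp add: induced_def)
  fix e assume "e \<in> edges (induced G U)"
  then show "ends (induced G U) e \<subseteq> verts (induced G U)" "card (ends (induced G U) e) = 2"
    using ends_subset[of e] loopfree[of e] by (auto simp: induced_def)
qed

lemma (in multigraph) super_stable_induced_le:
  assumes U: "verts G \<inter> U \<noteq> {}" and ss: "super_stable d (induced G U) \<sigma> p" and D: "d_realizable D G"
  shows "d \<le> D"
proof -
  define H where "H = induced G U"
  interpret H: multigraph H unfolding H_def by (rule multigraph_induced[OF U])
  have VH: "verts H = verts G \<inter> U" and EH: "edges H \<subseteq> edges G" by (auto simp: H_def induced_def)
  \<comment> \<open>Outside \<open>H\<close> signs and points are arbitrary; 1 and 0 keep the
    tensegrity well formed.\<close>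
  define \<sigma>' where "\<sigma>' e = (if e \<in> edges H then \<sigma> e else 1)" for e
  define p' where "p' v = (if v \<in> verts H then p v else 0)" for v
  have T: "tensegrity H d \<sigma> p" using ss by (simp add: super_stable_def H_def)
  have "(0 :: nat \<Rightarrow> real) \<in> coord_space {..<d}" by (simp add: coord_space_def)
  then have "tensegrity G d \<sigma>' p'" using T by (auto simp: tensegrity_def \<sigma>'_def p'_def)
  then obtain q where q: "deformation G d \<sigma>' p' q" "affine_dim (q ` verts G) \<le> D"
    using D unfolding d_realizable_def by blast
  have "deformation H d \<sigma> p q"
    unfolding deformation_def
  proof (intro conjI ballI allI)
    show "q v \<in> coord_space {..<d}" if "v \<in> verts H" for v
      using q(1) that VH by (simp add: deformation_def)
    fix i j e assume e: "e \<in> joining H i j"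
    have ij: "i \<in> verts H" "j \<in> verts H" "e \<in> edges H" using H.joiningD[OF e] by simp_all
    have "e \<in> joining G i j" using e ij VH by (simp add: H_def joining_induced)
    then have "(\<sigma>' e = 1 \<longrightarrow> point_dist d (q i) (q j) \<le> point_dist d (p' i) (p' j)) \<and>
      (\<sigma>' e = -1 \<longrightarrow> point_dist d (p' i) (p' j) \<le> point_dist d (q i) (q j))"
      using q(1) by (simp add: deformation_def)
    then show "\<sigma> e = 1 \<longrightarrow> point_dist d (q i) (q j) \<le> point_dist d (p i) (p j)"
      "\<sigma> e = -1 \<longrightarrow> point_dist d (p i) (p j) \<le> point_dist d (q i) (q j)"
      using ij by (simp_all add: \<sigma>'_def p'_def)
  qed
  then have "d \<le> affine_dim (q ` verts H)"
    using H.super_stable_rigid ss unfolding H_def by blast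
  also have "\<dots> \<le> affine_dim (q ` verts G)"
    by (rule affine_dim_mono[of _ _ d]) (use q(1) VH in \<open>auto simp: deformation_def\<close>)
  finally show ?thesis using q(2) by simp
qed

section \<open>Matrices with a clique as core\<close>

text \<open>The two kernel clauses say that the kernel restricts bijectively to the functions on
  \<open>K\<close>, so the corank is \<open>card K\<close>. Row sums are claimed only in the
  connected case with \<open>K\<close> nonempty: a vertex added without neighbours is forced to 0 in
  the kernel, which excludes constants.\<close>

definition core_matrix :: "('v \<Rightarrow> 'v \<Rightarrow> bool) \<Rightarrow> 'v set \<Rightarrow> 'v set \<Rightarrow> ('v \<Rightarrow> 'v \<Rightarrow> real) \<Rightarrow> bool" where
  "core_matrix adj K V L \<longleftrightarrow> symmetric_on V L \<and> (\<forall>x. 0 \<le> quad_form V L x) \<and> sparse_on adj V L \<and>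
    (\<forall>i\<in>V. \<forall>j\<in>V. i \<noteq> j \<and> adj i j \<and> L i j = 0 \<longrightarrow>
       i \<in> K \<and> j \<in> K \<and> (\<forall>v\<in>V - K. \<not> (adj v i \<and> adj v j))) \<and>
    (\<forall>y. \<exists>x. (\<forall>i\<in>K. x i = y i) \<and> (\<forall>i\<in>V. (\<Sum>j\<in>V. L i j * x j) = 0)) \<and>
    (\<forall>x. (\<forall>i\<in>V. (\<Sum>j\<in>V. L i j * x j) = 0) \<longrightarrow> (\<forall>i\<in>K. x i = 0) \<longrightarrow> (\<forall>i\<in>V. x i = 0)) \<and>
    (cut_connected adj V \<and> K \<noteq> {} \<longrightarrow> (\<forall>i\<in>V. (\<Sum>j\<in>V. L i j) = 0))"

lemma core_matrixD:
  assumes "core_matrix adj K V L"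
  shows "symmetric_on V L" "\<And>x. 0 \<le> quad_form V L x" "sparse_on adj V L"
    "\<And>i j. i \<in> V \<Longrightarrow> j \<in> V \<Longrightarrow> i \<noteq> j \<Longrightarrow> adj i j \<Longrightarrow> L i j = 0 \<Longrightarrow>
       i \<in> K \<and> j \<in> K \<and> (\<forall>v\<in>V - K. \<not> (adj v i \<and> adj v j))"
    "\<And>y. \<exists>x. (\<forall>i\<in>K. x i = y i) \<and> (\<forall>i\<in>V. (\<Sum>j\<in>V. L i j * x j) = 0)"
    "\<And>x i. \<forall>i\<in>V. (\<Sum>j\<in>V. L i j * x j) = 0 \<Longrightarrow> \<forall>i\<in>K. x i = 0 \<Longrightarrow> i \<in> V \<Longrightarrow> x i = 0"
    "\<And>i. cut_connected adj V \<Longrightarrow> K \<noteq> {} \<Longrightarrow> i \<in> V \<Longrightarrow> (\<Sum>j\<in>V. L i j) = 0"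
proof -
  note D = assms[unfolded core_matrix_def]
  show "symmetric_on V L" by (rule D[THEN conjunct1])
  show "0 \<le> quad_form V L x" for x by (rule D[THEN conjunct2, THEN conjunct1, THEN spec])
  show "sparse_on adj V L" by (rule D[THEN conjunct2, THEN conjunct2, THEN conjunct1])
  show "i \<in> K \<and> j \<in> K \<and> (\<forall>v\<in>V - K. \<not> (adj v i \<and> adj v j))"
    if "i \<in> V" "j \<in> V" "i \<noteq> j" "adj i j" "L i j = 0" for i j
    by (rule D[THEN conjunct2, THEN conjunct2, THEN conjunct2, THEN conjunct1, THEN bspec, THEN bspec, THEN mp]) (intro that conjI)+
  show "\<exists>x. (\<forall>i\<in>K. x i = y i) \<and> (\<forall>i\<in>V. (\<Sum>j\<in>V. L i j * x j) = 0)" for y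
    by (rule D[THEN conjunct2, THEN conjunct2, THEN conjunct2, THEN conjunct2, THEN conjunct1, THEN spec])
  show "x i = 0" if "\<forall>i\<in>V. (\<Sum>j\<in>V. L i j * x j) = 0" "\<forall>i\<in>K. x i = 0" "i \<in> V" for x i
    by (rule D[THEN conjunct2, THEN conjunct2, THEN conjunct2, THEN conjunct2, THEN conjunct2, THEN conjunct1, THEN spec, THEN mp, THEN mp, THEN bspec]) (fact that)+
  show "(\<Sum>j\<in>V. L i j) = 0" if "cut_connected adj V" "K \<noteq> {}" "i \<in> V" for i
    by (rule D[THEN conjunct2, THEN conjunct2, THEN conjunct2, THEN conjunct2, THEN conjunct2, THEN conjunct2, THEN mp, THEN bspec]) (intro that conjI)+
qed

text \<open>A vertex \<open>v\<close> is added as the average of its neighbours: the rank one matrix of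
  \<open>\<e>\<^sub>v - (\<Sum>j\<in>N. \<e>\<^sub>j) / |N|\<close> is added with a generic positive weight, so that no nonzero entry
  vanishes.\<close>

lemma core_matrix_exists:
  assumes "elim_from adj K V" "finite K" and sym: "symp adj"
  shows "\<exists>L. core_matrix adj K V L"
  using assms(1)
proof (induction rule: elim_from.induct)
  case base
  show ?case
    by (intro exI[of _ "\<lambda>_ _. 0"])
      (auto simp: core_matrix_def symmetric_on_def quad_form_def sparse_on_def)
next
  case (step V v)
  then obtain L where L: "core_matrix adj K V L" by blast
  note D = core_matrixD[OF L]
  have fin: "finite V" using elim_from_finite[OF step.hyps(1) assms(2)] .
  have KV: "K \<subseteq> V" using elim_from_subset[OF step.hyps(1)] .
  then have vK: "v \<notin> K" using step.hyps(2) by blast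
  define N where "N = {u\<in>V. adj v u}"
  have N: "finite N" "N \<subseteq> V" "v \<notin> N" using fin step.hyps(2) by (auto simp: N_def)
  define n where "n = real (card N)"
  define w where "w i = (if i = v then 1 else if i \<in> N then - 1 / n else 0)" for i
  \<comment> \<open>If \<open>N\<close> is empty, \<open>av x\<close> is \<open>0 / 0 = 0\<close>,
    and kernel vectors vanish at \<open>v\<close>.\<close>
  define av where "av x = (\<Sum>j\<in>N. x j) / n" for x :: "'a \<Rightarrow> real"
  have n: "n > 0" if "i \<in> N" for i
    using that N(1) by (auto simp: n_def card_gt_0_iff)
  have wv: "w v = 1" by (simp add: w_def)
  have wN: "w j \<noteq> 0" if "j \<in> N" for j using n[OF that] that by (simp add: w_def)
  have wx: "(\<Sum>j\<in>insert v V. w j * x j) = x v - av x" for x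
  proof -
    have "(\<Sum>j\<in>V. w j * x j) = (\<Sum>j\<in>V. if j \<in> N then - (x j / n) else 0)"
      using step.hyps(2) by (intro sum.cong refl) (auto simp: w_def)
    also have "\<dots> = (\<Sum>j\<in>V \<inter> N. - (x j / n))" using fin by (simp add: sum.inter_restrict)
    also have "V \<inter> N = N" using N(2) by blast
    also have "(\<Sum>j\<in>N. - (x j / n)) = - av x"
      by (simp add: av_def sum_divide_distrib sum_negf)
    finally show ?thesis using fin step.hyps(2) by (simp add: w_def)
  qed
  \<comment> \<open>The finitely many weights for which the new term could cancel a nonzero entry of
    \<open>L\<close>.\<close>
  define bad where "bad = (\<lambda>(i, j). - L i j / (w i * w j)) ` (V \<times> V)"
  have "finite bad" using fin by (simp add: bad_def)
  then have "infinite ({0<..} - bad)" using infinite_Ioi by (rule Diff_infinite_finite)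
  then obtain \<epsilon> :: real where "\<epsilon> \<in> {0<..} - bad" using infinite_imp_nonempty by blast
  then have \<epsilon>: "\<epsilon> > 0" "\<epsilon> \<notin> bad" by auto
  have gen: "L i j + \<epsilon> * (w i * w j) \<noteq> 0" if "i \<in> V" "j \<in> V" "L i j \<noteq> 0" for i j
  proof
    assume eq: "L i j + \<epsilon> * (w i * w j) = 0"
    then have "w i * w j \<noteq> 0" using that(3) by auto
    then have "\<epsilon> = - L i j / (w i * w j)" using eq by (simp add: field_simps)
    then have "\<epsilon> \<in> bad" using that by (auto simp: bad_def)
    then show False using \<epsilon> by blast
  qed
  define L' where "L' i j = (if i = v \<or> j = v then 0 else L i j) + \<epsilon> * (w i * w j)" for i j
  have L'V: "L' i j = L i j + \<epsilon> * (w i * w j)" if "i \<in> V" "j \<in> V" for i j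
    using that step.hyps(2) by (auto simp: L'_def)
  have row: "(\<Sum>j\<in>insert v V. L' i j * x j) =
    (if i = v then 0 else \<Sum>j\<in>V. L i j * x j) + \<epsilon> * w i * (x v - av x)" for i x
  proof -
    have "(\<Sum>j\<in>insert v V. L' i j * x j) =
      (\<Sum>j\<in>insert v V. (if i = v \<or> j = v then 0 else L i j) * x j) + \<epsilon> * w i * (\<Sum>j\<in>insert v V. w j * x j)"
      unfolding L'_def sum_distrib_left sum.distrib[symmetric]
      by (intro sum.cong refl) (simp add: algebra_simps)
    also have "(\<Sum>j\<in>insert v V. (if i = v \<or> j = v then 0 else L i j) * x j) =
      (\<Sum>j\<in>V. (if i = v then 0 else L i j * x j))"
      using fin step.hyps(2) by (simp, intro sum.cong refl) auto
    also have "\<dots> = (if i = v then 0 else \<Sum>j\<in>V. L i j * x j)" by simp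
    finally show ?thesis by (simp only: wx)
  qed
  have kerD: "x v = av x" "\<forall>i\<in>V. (\<Sum>j\<in>V. L i j * x j) = 0"
    if x: "\<forall>i\<in>insert v V. (\<Sum>j\<in>insert v V. L' i j * x j) = 0" for x
  proof -
    have "(\<Sum>j\<in>insert v V. L' v j * x j) = 0" using x by blast
    then show xv: "x v = av x" using \<epsilon>(1) unfolding row by (simp add: w_def)
    show "\<forall>i\<in>V. (\<Sum>j\<in>V. L i j * x j) = 0"
    proof
      fix i assume i: "i \<in> V"
      then have "(\<Sum>j\<in>insert v V. L' i j * x j) = 0" using x by blast
      moreover have "i \<noteq> v" using i step.hyps(2) by blast
      ultimately show "(\<Sum>j\<in>V. L i j * x j) = 0" unfolding row using xv by simp
    qed
  qed
  have f1: "symmetric_on (insert v V) L'"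
    unfolding symmetric_on_def
  proof (intro ballI)
    fix i j assume "i \<in> insert v V" "j \<in> insert v V"
    then show "L' i j = L' j i"
      using symmetric_onD[OF D(1), of i j] by (auto simp: L'_def mult.commute)
  qed
  have f2: "0 \<le> quad_form (insert v V) L' x" for x
  proof -
    have "quad_form (insert v V) L' x = (\<Sum>i\<in>insert v V. x i * (if i = v then 0 else \<Sum>j\<in>V. L i j * x j))
      + (\<epsilon> * (x v - av x)) * (\<Sum>i\<in>insert v V. w i * x i)"
      unfolding quad_form_altdef row sum_distrib_left[of "\<epsilon> * (x v - av x)"] sum.distrib[symmetric]
      by (intro sum.cong refl) (simp add: algebra_simps)
    also have "(\<Sum>i\<in>insert v V. x i * (if i = v then 0 else \<Sum>j\<in>V. L i j * x j)) =
      (\<Sum>i\<in>V. x i * (\<Sum>j\<in>V. L i j * x j))"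
      using fin step.hyps(2) by (simp, intro sum.cong refl) auto
    also have "(\<epsilon> * (x v - av x)) * (\<Sum>i\<in>insert v V. w i * x i) = \<epsilon> * (x v - av x)\<^sup>2"
      unfolding wx by (simp add: power2_eq_square)
    finally show ?thesis using D(2)[of x] \<epsilon>(1) by (simp add: quad_form_altdef)
  qed
  have f3: "sparse_on adj (insert v V) L'"
    unfolding sparse_on_def
  proof (intro ballI impI)
    fix i j assume ij: "i \<in> insert v V" "j \<in> insert v V" "i \<noteq> j \<and> \<not> adj i j"
    have "(if i = v \<or> j = v then 0 else L i j) = 0"
      using ij sparse_onD[OF D(3), of i j] by auto
    moreover have "w i * w j = 0"
    proof (rule ccontr)
      assume "w i * w j \<noteq> 0"
      then have wij: "i = v \<or> i \<in> N" "j = v \<or> j \<in> N" by (auto simp: w_def split: if_splits)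
      have "\<not> (i \<in> N \<and> j \<in> N)"
        using cliqD[OF step.hyps(3), of i j] ij(3) by (auto simp: N_def)
      then show False using wij ij(3) sympD[OF sym, of v i] by (auto simp: N_def)
    qed
    ultimately show "L' i j = 0" by (simp only: L'_def)
  qed
  \<comment> \<open>Entries between \<open>v\<close> and its neighbours are nonzero. A zero
    elsewhere was already zero in \<open>L\<close> by the choice of \<open>\<epsilon>\<close> and
    received no new term, so \<open>v\<close> is not a common neighbour.\<close>
  have f4: "i \<in> K \<and> j \<in> K \<and> (\<forall>u\<in>insert v V - K. \<not> (adj u i \<and> adj u j))"
    if ij: "i \<in> insert v V" "j \<in> insert v V" "i \<noteq> j" "adj i j" "L' i j = 0" for i j
  proof -
    have nv: "i \<noteq> v"
    proof
      assume "i = v"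
      then have "j \<in> N" using ij by (auto simp: N_def)
      then have "L' i j \<noteq> 0" using wN \<epsilon>(1) \<open>i = v\<close> by (simp add: L'_def wv)
      then show False using ij(5) by simp
    qed
    have nv': "j \<noteq> v"
    proof
      assume "j = v"
      then have "i \<in> N" using ij nv sympD[OF sym, of i v] by (auto simp: N_def)
      then have "L' i j \<noteq> 0" using wN \<epsilon>(1) \<open>j = v\<close> by (simp add: L'_def wv)
      then show False using ij(5) by simp
    qed
    have V: "i \<in> V" "j \<in> V" using ij nv nv' by auto
    have L0: "L i j = 0" using gen[OF V] ij(5) L'V[OF V] by auto
    then have "w i * w j = 0" using ij(5) L'V[OF V] \<epsilon>(1) by simp
    then have "i \<notin> N \<or> j \<notin> N" using wN by auto
    then have "\<not> (adj v i \<and> adj v j)" using V by (auto simp: N_def)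
    then show ?thesis using D(4)[OF V ij(3,4) L0] by auto
  qed
  have f5: "\<exists>x. (\<forall>i\<in>K. x i = y i) \<and> (\<forall>i\<in>insert v V. (\<Sum>j\<in>insert v V. L' i j * x j) = 0)" for y
  proof -
    obtain x where x: "\<forall>i\<in>K. x i = y i" "\<forall>i\<in>V. (\<Sum>j\<in>V. L i j * x j) = 0" using D(5)[of y] by blast
    define z where "z = x(v := av x)"
    have zV: "z i = x i" if "i \<in> V" for i using that step.hyps(2) by (auto simp: z_def)
    have "av z = av x" unfolding av_def using zV N(2) by (intro arg_cong[of _ _ "\<lambda>s. s / n"] sum.cong) auto
    then have "z v - av z = 0" by (simp add: z_def)
    moreover have "(\<Sum>j\<in>V. L i j * z j) = (\<Sum>j\<in>V. L i j * x j)" for i using zV by simp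
    ultimately have "\<forall>i\<in>insert v V. (\<Sum>j\<in>insert v V. L' i j * z j) = 0"
      using x(2) by (simp only: row) auto
    moreover have "\<forall>i\<in>K. z i = y i" using x(1) zV KV by auto
    ultimately show ?thesis by blast
  qed
  have f6: "x i = 0" if x: "\<forall>i\<in>insert v V. (\<Sum>j\<in>insert v V. L' i j * x j) = 0" "\<forall>i\<in>K. x i = 0"
    and i: "i \<in> insert v V" for x i
  proof -
    have xV: "x i = 0" if "i \<in> V" for i using D(6)[OF kerD(2)[OF x(1)] x(2) that] .
    have "av x = 0" unfolding av_def using xV N(2) by (simp add: sum.neutral subset_iff)
    then show ?thesis using xV i kerD(1)[OF x(1)] by auto
  qed
  have f7: "(\<Sum>j\<in>insert v V. L' i j) = 0"
    if cc: "cut_connected adj (insert v V)" "K \<noteq> {}" and i: "i \<in> insert v V" for i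
  proof -
    have "V \<noteq> {}" using cc(2) KV by blast
    \<comment> \<open>Connectedness provides a neighbour, so a constant equals its average over
      \<open>N\<close>.\<close>
    then obtain u where "u \<in> N" using cut_connected_neighbour[OF cc(1) step.hyps(2)] by (auto simp: N_def)
    then have "av (\<lambda>_. 1) = 1" using n[of u] by (simp add: av_def n_def)
    moreover have "(\<Sum>j\<in>V. L i j) = 0" if "i \<in> V" for i
      using D(7)[OF cut_connected_remove[OF cc(1) step.hyps(2,3) sym] cc(2) that] .
    ultimately show ?thesis using row[of i "\<lambda>_. 1"] i by auto
  qed
  have "core_matrix adj K (insert v V) L'"
    unfolding core_matrix_def
  proof (intro conjI)
    show "\<forall>i\<in>insert v V. \<forall>j\<in>insert v V. i \<noteq> j \<and> adj i j \<and> L' i j = 0 \<longrightarrow>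
       i \<in> K \<and> j \<in> K \<and> (\<forall>u\<in>insert v V - K. \<not> (adj u i \<and> adj u j))"
      by (intro ballI impI, elim conjE, rule f4; assumption)
    show "\<forall>x. (\<forall>i\<in>insert v V. (\<Sum>j\<in>insert v V. L' i j * x j) = 0) \<longrightarrow>
      (\<forall>i\<in>K. x i = 0) \<longrightarrow> (\<forall>i\<in>insert v V. x i = 0)"
      by (intro allI impI, rule ballI, rule f6; assumption)
    show "cut_connected adj (insert v V) \<and> K \<noteq> {} \<longrightarrow>
      (\<forall>i\<in>insert v V. (\<Sum>j\<in>insert v V. L' i j) = 0)"
      by (intro impI, elim conjE, rule ballI, rule f7; assumption)
  qed (rule f1 f3 allI[OF f2] allI[OF f5])+
  then show ?case by blast
qed

text \<open>The kernel basis dual to \<open>K\<close>; its values at a vertex later serve as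
  coordinates of that vertex.\<close>

lemma core_matrix_dual_family:
  assumes L: "core_matrix adj K V L" and KV: "K \<subseteq> V"
  shows "\<exists>\<beta>. \<forall>k\<in>K. \<beta> k \<in> matrix_kernel V L \<and> (\<forall>l\<in>K. \<beta> k l = (if k = l then 1 else 0))"
proof -
  have "\<exists>x. x \<in> matrix_kernel V L \<and> (\<forall>l\<in>K. x l = (if k = l then 1 else 0))" for k
  proof -
    obtain x where x: "\<forall>l\<in>K. x l = (if k = l then 1 else 0)" "\<forall>i\<in>V. (\<Sum>j\<in>V. L i j * x j) = 0"
      using core_matrixD(5)[OF L, of "\<lambda>l. if k = l then 1 else 0"] by blast
    define z where "z i = (if i \<in> V then x i else 0)" for i
    have "z \<in> matrix_kernel V L"
      using x(2) by (simp add: z_def matrix_kernel_def coord_space_def)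
    moreover have "\<forall>l\<in>K. z l = (if k = l then 1 else 0)" using x(1) KV by (auto simp: z_def)
    ultimately show ?thesis by blast
  qed
  then show ?thesis by meson
qed

lemma core_matrix_corank:
  assumes L: "core_matrix adj K V L" and KV: "K \<subseteq> V" "finite V"
  shows "corank_on V L = card K"
proof -
  obtain \<beta> where \<beta>: "\<forall>k\<in>K. \<beta> k \<in> matrix_kernel V L \<and> (\<forall>l\<in>K. \<beta> k l = (if k = l then 1 else 0))"
    using core_matrix_dual_family[OF L KV(1)] by blast
  show ?thesis
    unfolding corank_on_def
  proof (rule dim_eq_card_restriction[where \<beta> = \<beta>, OF _ subspace_matrix_kernel subset_refl])
    show "finite K" using KV finite_subset by blast
    fix x assume x: "x \<in> matrix_kernel V L" "\<And>i. i \<in> K \<Longrightarrow> x i = 0"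
    have "x i = 0" if "i \<in> V" for i
      by (rule core_matrixD(6)[OF L _ _ that]) (use x in \<open>auto simp: matrix_kernel_def\<close>)
    then show "x = 0" using x(1) by (auto simp: matrix_kernel_def coord_space_def fun_eq_iff)
  qed (use \<beta> in auto)
qed

lemma core_matrix_psd: "core_matrix adj K V L \<Longrightarrow> psd_on V L"
  using core_matrixD(1,2)[of adj K V L] by (simp add: psd_on_def)

text \<open>Rows of \<open>X\<close> are kernel vectors. A row indexed by \<open>K\<close> vanishes
  on the clique \<open>K\<close>, hence everywhere; by symmetry every row then vanishes on
  \<open>K\<close>, hence everywhere.\<close>

lemma core_matrix_sap:
  assumes L: "core_matrix adj K V L" and K: "K \<subseteq> V" "cliq adj K"
  shows "sap_on adj V L"
  unfolding sap_on_def
proof (intro allI impI ballI)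
  fix X i j
  assume X: "symmetric_on V X" and X0: "\<forall>i\<in>V. \<forall>j\<in>V. (\<Sum>k\<in>V. X i k * L k j) = 0"
    and Xadj: "\<forall>i\<in>V. \<forall>j\<in>V. i = j \<or> adj i j \<longrightarrow> X i j = 0" and ij: "i \<in> V" "j \<in> V"
  have ker: "\<forall>j\<in>V. (\<Sum>k\<in>V. L j k * X i k) = 0" if "i \<in> V" for i
  proof
    fix j assume j: "j \<in> V"
    have "(\<Sum>k\<in>V. L j k * X i k) = (\<Sum>k\<in>V. X i k * L k j)"
      using symmetric_onD[OF core_matrixD(1)[OF L] j] by (intro sum.cong refl) simp
    then show "(\<Sum>k\<in>V. L j k * X i k) = 0" using X0 that j by simp
  qed
  have KX: "X k j = 0" if "k \<in> K" "j \<in> V" for k j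
  proof (rule core_matrixD(6)[OF L ker _ that(2)])
    show "k \<in> V" using that K by blast
    show "\<forall>l\<in>K. X k l = 0"
    proof
      fix l assume "l \<in> K"
      then have "k = l \<or> adj k l" using cliqD[OF K(2) that(1)] by blast
      then show "X k l = 0" using Xadj that K(1) \<open>l \<in> K\<close> by blast
    qed
  qed
  show "X i j = 0"
  proof (rule core_matrixD(6)[OF L ker[OF ij(1)] _ ij(2)])
    show "\<forall>k\<in>K. X i k = 0"
    proof
      fix k assume k: "k \<in> K"
      then show "X i k = 0" using KX[OF k ij(1)] symmetric_onD[OF X ij(1), of k] K(1) by auto
    qed
  qed
qed

section \<open>Stresses and realizations from thick cliques\<close>

definition thick_clique :: "('v, 'e) pre_multigraph \<Rightarrow> 'v set \<Rightarrow> bool" where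
  "thick_clique G K \<longleftrightarrow> clique G K \<and> (\<forall>u\<in>K. \<forall>v\<in>K. u \<noteq> v \<longrightarrow>
     parallel G u v \<or> (\<exists>w\<in>verts G - K. adjacent G w u \<and> adjacent G w v))"

lemma (in multigraph) core_matrix_single_edge:
  assumes L: "core_matrix (adjacent G) K (verts G) L" and K: "thick_clique G K"
    and ij: "i \<in> verts G" "j \<in> verts G" "i \<noteq> j" "adjacent G i j" "\<not> parallel G i j"
  shows "L i j \<noteq> 0"
proof
  assume "L i j = 0"
  from core_matrixD(4)[OF L ij(1-4) this]
  have "i \<in> K" "j \<in> K" "\<forall>v\<in>verts G - K. \<not> (adjacent G v i \<and> adjacent G v j)" by simp_all
  then show False using K ij(3,5) unfolding thick_clique_def by blast
qed

lemma (in multigraph) thick_clique_corank: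
  assumes "chordal G" and K: "thick_clique G K"
  shows "\<exists>A \<in> A_star G. psd_on (verts G) A \<and> SAP G A \<and> corank_on (verts G) A = card K"
proof -
  have clK: "clique G K" using K by (simp add: thick_clique_def)
  then have KV: "K \<subseteq> verts G" "cliq (adjacent G) K" by (simp_all add: clique_iff)
  obtain L where L: "core_matrix (adjacent G) K (verts G) L"
    using core_matrix_exists[OF chordal_elim[OF assms(1) clK] clique_finite[OF clK] symp_adjacent] by blast
  have "L i j \<noteq> 0" if ij: "i \<in> verts G" "j \<in> verts G" "i \<noteq> j" "card (joining G i j) = 1" for i j
  proof (rule core_matrix_single_edge[OF L K ij(1-3)])
    show "adjacent G i j" using ij(4) by (auto simp: adjacent_def)
    show "\<not> parallel G i j" using ij(4) by (simp add: parallel_def)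
  qed
  then have "L \<in> A_star G"
    using core_matrixD(1,3)[OF L] by (simp add: A_star_def sparse_on_def)
  then show ?thesis
    using core_matrix_psd[OF L] core_matrix_sap[OF L KV] core_matrix_corank[OF L KV(1) finite_verts]
    unfolding SAP_iff by blast
qed

text \<open>Distributes a matrix entry over a class of parallel edges without a zero stress; a class
  of two or more edges can even share the total 0.\<close>

lemma nonzero_weights:
  assumes "finite E" "E \<noteq> {}" "2 \<le> card E \<or> s \<noteq> 0"
  shows "\<exists>f. (\<forall>e\<in>E. f e \<noteq> (0 :: real)) \<and> sum f E = s"
proof -
  obtain e0 where e0: "e0 \<in> E" using assms(2) by blast
  define n where "n = card (E - {e0})"
  have cE: "card E = Suc n" by (simp only: n_def card_Suc_Diff1[OF assms(1) e0])
  show ?thesis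
  proof (cases "n = 0")
    case True
    then have "E = {e0}" using cE e0 by (metis One_nat_def card_1_singletonE singletonD)
    then show ?thesis using True cE assms(3) by (intro exI[of _ "\<lambda>_. s"]) auto
  next
    case False
    \<comment> \<open>Avoiding \<open>s / n\<close> keeps the remaining weight
      \<open>s - n * c\<close> of \<open>e0\<close> nonzero.\<close>
    obtain c :: real where c: "c \<noteq> 0" "c \<noteq> s / n"
      using ex_new_if_finite[OF infinite_UNIV_char_0, of "{0, s / n}"] by auto
    define f where "f e = (if e = e0 then s - n * c else c)" for e
    have "sum f E = f e0 + sum f (E - {e0})" using assms(1) e0 by (simp add: sum.remove)
    also have "sum f (E - {e0}) = n * c" by (simp add: f_def n_def)
    finally have "sum f E = s" by (simp add: f_def)
    moreover have "s - n * c \<noteq> 0" using c(2) False by (auto simp: field_simps)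
    ultimately show ?thesis using c(1) by (intro exI[of _ f]) (auto simp: f_def)
  qed
qed

lemma (in multigraph) laplacian_off_diagonal:
  assumes "i \<noteq> j"
  shows "laplacian G \<omega> i j = - (\<Sum>e\<in>joining G i j. \<omega> e)"
proof -
  have "(if i \<in> ends G e \<and> j \<in> ends G e then (if i = j then 1 else -1) else 0) =
    (if ends G e = {i, j} then -1 else (0 :: real))" if e: "e \<in> edges G" for e
  proof -
    obtain a b where "ends G e = {a, b}" using ends_pairE[OF e] .
    then show ?thesis using assms by auto
  qed
  then have "laplacian G \<omega> i j = (\<Sum>e\<in>edges G. if ends G e = {i, j} then - \<omega> e else 0)"
    unfolding laplacian_def by (intro sum.cong refl) simp
  also have "\<dots> = (\<Sum>e\<in>joining G i j. - \<omega> e)"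
    unfolding joining_def by (rule sum.inter_filter[symmetric, OF finite_edges])
  finally show ?thesis by (simp add: sum_negf)
qed

text \<open>Each off-diagonal entry is distributed over its parallel class. The diagonal then agrees
  because both matrices have zero row sums.\<close>

lemma (in multigraph) stress_of_matrix:
  assumes L: "symmetric_on (verts G) L" "sparse_on (adjacent G) (verts G) L"
    and row: "\<And>i. i \<in> verts G \<Longrightarrow> (\<Sum>j\<in>verts G. L i j) = 0"
    and single: "\<And>i j. i \<in> verts G \<Longrightarrow> j \<in> verts G \<Longrightarrow> i \<noteq> j \<Longrightarrow> adjacent G i j \<Longrightarrow>
      \<not> parallel G i j \<Longrightarrow> L i j \<noteq> 0"
  shows "\<exists>\<omega>. (\<forall>e\<in>edges G. \<omega> e \<noteq> 0) \<and> (\<forall>i\<in>verts G. \<forall>j\<in>verts G. laplacian G \<omega> i j = L i j)"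
proof -
  \<comment> \<open>The choice is made per end pair \<open>a\<close>, so it does not depend on the
    order of \<open>i\<close> and \<open>j\<close>.\<close>
  have "\<exists>f. (\<forall>e\<in>edges G. ends G e = a \<longrightarrow> f e \<noteq> 0) \<and>
    (\<forall>i j. a = {i, j} \<longrightarrow> (\<Sum>e\<in>joining G i j. f e) = - L i j)" if a: "a \<in> ends G ` edges G" for a
  proof -
    obtain e0 where e0: "e0 \<in> edges G" "a = ends G e0" using a by blast
    obtain i j where ij: "a = {i, j}" "i \<noteq> j" "i \<in> verts G" "j \<in> verts G"
      using ends_pairE[OF e0(1)] e0(2) by metis
    have e0J: "e0 \<in> joining G i j" using e0 ij by (simp add: joining_def)
    then have "2 \<le> card (joining G i j) \<or> - L i j \<noteq> 0"
      using single[OF ij(3,4,2)] by (auto simp: parallel_def adjacent_def)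
    then obtain f where f: "\<forall>e\<in>joining G i j. f e \<noteq> 0" "sum f (joining G i j) = - L i j"
      using nonzero_weights[OF finite_joining, of i j] e0J by blast
    have "(\<Sum>e\<in>joining G i' j'. f e) = - L i' j'" if "a = {i', j'}" for i' j'
    proof -
      have "joining G i' j' = joining G i j" using that ij(1) by (simp add: joining_def)
      moreover have "L i' j' = L i j"
        using that ij symmetric_onD[OF L(1) ij(3,4)] by (auto simp: doubleton_eq_iff)
      ultimately show ?thesis using f(2) by simp
    qed
    then show ?thesis using f(1) ij(1) by (intro exI[of _ f]) (auto simp: joining_def)
  qed
  then obtain F where F: "\<And>a. a \<in> ends G ` edges G \<Longrightarrow> (\<forall>e\<in>edges G. ends G e = a \<longrightarrow> F a e \<noteq> 0) \<and>
    (\<forall>i j. a = {i, j} \<longrightarrow> (\<Sum>e\<in>joining G i j. F a e) = - L i j)" by metis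
  define \<omega> where "\<omega> e = F (ends G e) e" for e
  have nz: "\<omega> e \<noteq> 0" if "e \<in> edges G" for e
    using F[of "ends G e"] that by (simp add: \<omega>_def)
  have off: "laplacian G \<omega> i j = L i j" if ij: "i \<in> verts G" "j \<in> verts G" "i \<noteq> j" for i j
  proof (cases "adjacent G i j")
    case True
    then obtain e0 where e0: "e0 \<in> edges G" "ends G e0 = {i, j}" by (auto simp: adjacent_def joining_def)
    then have "{i, j} \<in> ends G ` edges G" by (metis imageI)
    then have "(\<Sum>e\<in>joining G i j. F {i, j} e) = - L i j" using F by blast
    moreover have "(\<Sum>e\<in>joining G i j. \<omega> e) = (\<Sum>e\<in>joining G i j. F {i, j} e)"
      by (intro sum.cong refl) (simp add: \<omega>_def joining_def)
    ultimately show ?thesis unfolding laplacian_off_diagonal[OF ij(3)] by simp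
  next
    case False
    then have "joining G i j = {}" by (simp add: adjacent_def)
    then show ?thesis unfolding laplacian_off_diagonal[OF ij(3)]
      using sparse_onD[OF L(2) ij False] by simp
  qed
  have "laplacian G \<omega> i j = L i j" if ij: "i \<in> verts G" "j \<in> verts G" for i j
  proof (cases "i = j")
    case True
    have "laplacian G \<omega> i i + (\<Sum>j\<in>verts G - {i}. laplacian G \<omega> i j) = 0"
      using laplacian_const[OF ij(1), of \<omega> 1] sum.remove[OF finite_verts ij(1), of "laplacian G \<omega> i"] by simp
    moreover have "L i i + (\<Sum>j\<in>verts G - {i}. L i j) = 0"
      using row[OF ij(1)] sum.remove[OF finite_verts ij(1), of "L i"] by simp
    moreover have "(\<Sum>j\<in>verts G - {i}. laplacian G \<omega> i j) = (\<Sum>j\<in>verts G - {i}. L i j)"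
      using off ij(1) by (intro sum.cong refl) auto
    ultimately show ?thesis using True by simp
  qed (use off ij in simp)
  then show ?thesis using nz by blast
qed

text \<open>Together with the values at unit vectors this recovers every entry of \<open>S\<close>;
  both kinds of vectors are edge directions of a simplex with one vertex at the origin.\<close>

lemma quad_form_difference_units:
  fixes d :: nat
  assumes S: "symmetric_on {..<d} S" "k < d" "l < d" "k \<noteq> l"
  shows "quad_form {..<d} S (\<lambda>i. (if i = k then 1 else 0) - (if i = l then 1 else 0)) =
    S k k - 2 * S k l + S l l"
proof -
  have r: "(\<Sum>j<d. S i j * ((if j = k then 1 else 0) - (if j = l then 1 else 0))) = S i k - S i l" for i
  proof -
    have "S i j * ((if j = k then 1 else 0) - (if j = l then 1 else 0)) =
      (if j = k then S i k else 0) - (if j = l then S i l else 0)" for j by simp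
    then show ?thesis using S by (simp add: sum_subtractf)
  qed
  have "quad_form {..<d} S (\<lambda>i. (if i = k then 1 else 0) - (if i = l then 1 else 0)) =
    (\<Sum>i<d. (if i = k then S i k - S i l else 0) - (if i = l then S i k - S i l else 0))"
    unfolding quad_form_altdef r using S(4) by (intro sum.cong refl) auto
  also have "\<dots> = (S k k - S k l) - (S l k - S l l)" using S by (simp add: sum_subtractf)
  finally show ?thesis using symmetric_onD[OF S(1), of l k] S by simp
qed

lemma quad_form_unit:
  fixes d :: nat
  assumes "k < d"
  shows "quad_form {..<d} S (\<lambda>i. if i = k then 1 else 0) = S k k"
proof -
  have r: "(\<Sum>j<d. S i j * (if j = k then 1 else 0)) = S i k" for i
    using assms by (simp add: if_distrib cong: if_cong)
  have "quad_form {..<d} S (\<lambda>i. if i = k then 1 else 0) = (\<Sum>i<d. if i = k then S i k else 0)"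
    unfolding quad_form_altdef r by (intro sum.cong refl) auto
  then show ?thesis using assms by simp
qed

text \<open>Kernel vectors dual to \<open>K\<close> are taken as coordinates, which makes
  equilibrium automatic. They place \<open>K\<close> as a simplex; all its directions are edges of
  \<open>G\<close>, so no nonzero \<open>S\<close> vanishes on them.\<close>

lemma (in multigraph) thick_clique_super_stable:
  assumes el: "elim_from (adjacent G) K (verts G)" and conn: "cut_connected (adjacent G) (verts G)"
    and K: "thick_clique G K" "card K = Suc d"
  shows "\<exists>\<sigma> p. super_stable d G \<sigma> p"
proof -
  define V where "V = verts G"
  note fin = finite_verts[folded V_def]
  have clK: "clique G K" using K by (simp add: thick_clique_def)
  have KV: "K \<subseteq> V" "cliq (adjacent G) K" using clK by (simp_all add: clique_iff V_def)
  have finK: "finite K" by (rule clique_finite[OF clK])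
  have Kne: "K \<noteq> {}" using K(2) by auto
  obtain L where L: "core_matrix (adjacent G) K V L"
    using core_matrix_exists[OF el finK symp_adjacent] unfolding V_def by blast
  have "\<exists>\<omega>. (\<forall>e\<in>edges G. \<omega> e \<noteq> 0) \<and> (\<forall>i\<in>verts G. \<forall>j\<in>verts G. laplacian G \<omega> i j = L i j)"
  proof (rule stress_of_matrix)
    show "symmetric_on (verts G) L" "sparse_on (adjacent G) (verts G) L"
      using core_matrixD(1,3)[OF L] by (simp_all add: V_def)
    show "(\<Sum>j\<in>verts G. L i j) = 0" if "i \<in> verts G" for i
      using core_matrixD(7)[OF L conn[folded V_def] Kne] that by (simp add: V_def)
  qed (rule core_matrix_single_edge[OF L[unfolded V_def] K(1)])
  then obtain \<omega> where \<omega>: "\<And>e. e \<in> edges G \<Longrightarrow> \<omega> e \<noteq> 0"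
    "\<And>i j. i \<in> V \<Longrightarrow> j \<in> V \<Longrightarrow> laplacian G \<omega> i j = L i j"
    unfolding V_def by blast
  have Lap: "(\<Sum>j\<in>V. laplacian G \<omega> i j * x j) = (\<Sum>j\<in>V. L i j * x j)" if "i \<in> V" for i x
    using \<omega>(2) that by (intro sum.cong refl) simp
  have quadLap: "quad_form V (laplacian G \<omega>) x = quad_form V L x" for x
    unfolding quad_form_altdef using Lap by (intro sum.cong refl) simp
  have psd: "psd_on V (laplacian G \<omega>)"
    using core_matrix_psd[OF L] \<omega>(2) quadLap by (simp add: psd_on_def symmetric_on_def)
  have "matrix_kernel V (laplacian G \<omega>) = matrix_kernel V L"
    unfolding matrix_kernel_def using Lap by (intro Collect_cong) auto
  then have cor: "corank_on V (laplacian G \<omega>) = d + 1"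
    using core_matrix_corank[OF L KV(1) fin] K(2) by (simp add: corank_on_def)
  obtain \<kappa> where "bij_betw \<kappa> {..<Suc d} K"
    using ex_bij_betw_nat_finite[OF finK] K(2) by (metis atLeast0LessThan)
  then have \<kappa>K: "\<kappa> k \<in> K" if "k \<le> d" for k using that by (auto simp: bij_betw_def)
  have \<kappa>inj: "\<kappa> k = \<kappa> l \<longleftrightarrow> k = l" if "k \<le> d" "l \<le> d" for k l
    using \<open>bij_betw \<kappa> {..<Suc d} K\<close> that by (auto simp: bij_betw_def inj_on_def)
  obtain \<beta> where \<beta>: "\<forall>k\<in>K. \<beta> k \<in> matrix_kernel V L \<and> (\<forall>l\<in>K. \<beta> k l = (if k = l then 1 else 0))"
    using core_matrix_dual_family[OF L KV(1)] by blast
  \<comment> \<open>Only \<open>d\<close> of the \<open>d + 1\<close> dual vectors become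
    coordinates. This puts \<open>\<kappa> d\<close> at the origin and the other vertices of
    \<open>K\<close> at the unit vectors.\<close>
  define p where "p v = (\<lambda>k. if k < d then \<beta> (\<kappa> k) v else 0)" for v
  have pE: "p v \<in> coord_space {..<d}" for v by (simp add: p_def coord_space_def)
  have p\<kappa>: "p (\<kappa> l) k = (if k < d \<and> k = l then 1 else 0)" if "l \<le> d" for k l
    using \<beta> \<kappa>K \<kappa>inj that by (auto simp: p_def)
  have eq: "equilibrium_stress G d p \<omega>"
    unfolding equilibrium_stress_iff V_def[symmetric]
  proof (intro ballI allI impI)
    fix i k assume ik: "i \<in> V" "k < d"
    have "\<beta> (\<kappa> k) \<in> matrix_kernel V L" using \<beta> \<kappa>K[of k] ik by simp
    then show "(\<Sum>j\<in>V. laplacian G \<omega> i j * p j k) = 0"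
      unfolding Lap[OF ik(1)] using ik by (simp add: p_def matrix_kernel_def)
  qed
  define \<sigma> where "\<sigma> e = sgn (\<omega> e)" for e
  have T: "tensegrity G d \<sigma> p"
    using pE \<omega>(1) by (auto simp: tensegrity_def \<sigma>_def sgn_if)
  have pr: "strictly_proper G \<sigma> \<omega>"
    by (simp add: strictly_proper_def \<sigma>_def mult.commute[of "sgn _"] abs_sgn[symmetric] \<omega>(1))
  have dim: "affine_dim (p ` V) = d"
  proof -
    define \<epsilon> where "\<epsilon> k = p (\<kappa> k) - p (\<kappa> d)" for k
    have "fun_space.dim {x - y | x y. x \<in> p ` V \<and> y \<in> p ` V} = card {..<d}"
    proof (rule dim_eq_card_restriction[of _ "coord_space {..<d}" _ \<epsilon>])
      show "{x - y | x y. x \<in> p ` V \<and> y \<in> p ` V} \<subseteq> coord_space {..<d}"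
        using pE by (auto intro!: fun_space.subspace_diff[OF subspace_coord_space])
      show "fun_space.subspace (coord_space {..<d})" by (rule subspace_coord_space)
      show "\<epsilon> k \<in> {x - y | x y. x \<in> p ` V \<and> y \<in> p ` V}" if "k \<in> {..<d}" for k
      proof -
        have "\<kappa> k \<in> V" "\<kappa> d \<in> V" using \<kappa>K[of k] \<kappa>K[of d] KV(1) that by auto
        then show ?thesis unfolding \<epsilon>_def by blast
      qed
      show "\<epsilon> k l = (if k = l then 1 else 0)" if "k \<in> {..<d}" "l \<in> {..<d}" for k l
        using that p\<kappa>[of k l] p\<kappa>[of d l] by (auto simp: \<epsilon>_def)
    qed (auto simp: coord_space_def fun_eq_iff)
    then show ?thesis by (simp add: affine_dim_def)
  qed
  have conic: "S k l = 0" if S: "symmetric_on {..<d} S"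
    "\<And>i j. adjacent G i j \<Longrightarrow> quad_form {..<d} S (p j - p i) = 0" and kl: "k < d" "l < d" for S k l
  proof -
    have adj: "adjacent G (\<kappa> i) (\<kappa> j)" if "i \<le> d" "j \<le> d" "i \<noteq> j" for i j
      using cliqD[OF KV(2) \<kappa>K[OF that(1)] \<kappa>K[OF that(2)]] \<kappa>inj that by simp
    have diag: "S k k = 0" if "k < d" for k
    proof -
      have "p (\<kappa> k) - p (\<kappa> d) = (\<lambda>i. if i = k then 1 else 0)"
        using p\<kappa>[of k] p\<kappa>[of d] that by (auto simp: fun_eq_iff)
      then show ?thesis
        using S(2)[OF adj[of d k]] quad_form_unit[OF that, of S] that by simp
    qed
    show ?thesis
    proof (cases "k = l")
      case False
      have "p (\<kappa> k) - p (\<kappa> l) = (\<lambda>i. (if i = k then 1 else 0) - (if i = l then 1 else 0))"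
        using p\<kappa>[of k] p\<kappa>[of l] kl by (auto simp: fun_eq_iff)
      then have "S k k - 2 * S k l + S l l = 0"
        using S(2)[OF adj[of l k]] quad_form_difference_units[OF S(1) kl False] kl False by simp
      then show ?thesis using diag kl by simp
    qed (use diag kl in simp)
  qed
  have nc: "\<not> (\<exists>S. symmetric_on {..<d} S \<and> nonzero_on {..<d} S \<and>
        (\<forall>i j. adjacent G i j \<longrightarrow> quad_form {..<d} S (p j - p i) = 0))"
  proof (rule notI, elim exE conjE)
    fix S assume S: "symmetric_on {..<d} S" "nonzero_on {..<d} S"
      "\<forall>i j. adjacent G i j \<longrightarrow> quad_form {..<d} S (p j - p i) = 0"
    obtain k l where kl: "k < d" "l < d" "S k l \<noteq> 0" using S(2) by (auto simp: nonzero_on_def)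
    have "S k l = 0" by (rule conic[OF S(1) _ kl(1,2)]) (use S(3) in blast)
    then show False using kl(3) by simp
  qed
  have "super_stable d G \<sigma> p"
    unfolding super_stable_def V_def[symmetric] using T dim eq pr psd cor nc by blast
  then show ?thesis by blast
qed

section \<open>The three parameters of a chordal multigraph\<close>

lemma chordal_on_cong:
  assumes "chordal_on adj V" "U \<subseteq> V" "\<And>x y. x \<in> U \<Longrightarrow> y \<in> U \<Longrightarrow> adj' x y \<longleftrightarrow> adj x y"
  shows "chordal_on adj' U"
  unfolding chordal_on_def
proof (rule notI, elim exE conjE)
  fix cs
  assume cs: "3 < length cs" "distinct cs" "set cs \<subseteq> U"
    "\<forall>k<length cs. adj' (cs ! k) (cs ! (Suc k mod length cs))"
    "\<forall>k<length cs. \<forall>l<length cs. adj' (cs ! k) (cs ! l) \<longrightarrow>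
       l = Suc k mod length cs \<or> k = Suc l mod length cs"
  have U: "cs ! k \<in> U" if "k < length cs" for k using cs(3) nth_mem[OF that] by blast
  have S: "Suc k mod length cs < length cs" for k by (rule mod_less_divisor) (use cs(1) in linarith)
  have "\<exists>cs. 3 < length cs \<and> distinct cs \<and> set cs \<subseteq> V \<and>
    (\<forall>k<length cs. adj (cs ! k) (cs ! (Suc k mod length cs))) \<and>
    (\<forall>k<length cs. \<forall>l<length cs. adj (cs ! k) (cs ! l) \<longrightarrow>
       l = Suc k mod length cs \<or> k = Suc l mod length cs)"
  proof (intro exI[of _ cs] conjI allI impI)
    show "set cs \<subseteq> V" using cs(3) assms(2) by (rule subset_trans)
    show "adj (cs ! k) (cs ! (Suc k mod length cs))" if "k < length cs" for k
      using cs(4) that assms(3)[OF U[OF that] U[OF S[of k]]] by simp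
    show "l = Suc k mod length cs \<or> k = Suc l mod length cs"
      if "k < length cs" "l < length cs" "adj (cs ! k) (cs ! l)" for k l
      using cs(5) that assms(3)[OF U[OF that(1)] U[OF that(2)]] by simp
  qed (use cs in auto)
  then show False using assms(1) unfolding chordal_on_def by (rule notE[rotated])
qed

lemma rtranclp_adjacent_verts:
  assumes "multigraph G" "(adjacent G)\<^sup>*\<^sup>* u v" "u \<in> verts G"
  shows "v \<in> verts G"
  using assms(2,3)
proof (induction rule: rtranclp_induct)
  case (step y z)
  then show ?case using multigraph.adjacentD[OF assms(1)] by blast
qed

text \<open>\<open>lambda_number\<close> is computed by components. The component of
  \<open>k\<close> contains \<open>K\<close> and every common neighbour that makes \<open>K\<close>
  thick, and its connectedness yields the zero row sums of a stress matrix.\<close>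

lemma (in multigraph) component_thick_clique:
  assumes ch: "chordal G" and K: "thick_clique G K" "card K = Suc d" and k: "k \<in> K"
  shows "\<exists>\<sigma> p. super_stable d (induced G {v. (adjacent G)\<^sup>*\<^sup>* k v}) \<sigma> p"
proof -
  define U where "U = {v. (adjacent G)\<^sup>*\<^sup>* k v}"
  define H where "H = induced G U"
  have clK: "K \<subseteq> verts G" "cliq (adjacent G) K"
    using K(1) by (simp_all add: thick_clique_def clique_iff)
  have kU: "k \<in> verts G" "k \<in> U" using k clK by (auto simp: U_def)
  have UV: "U \<subseteq> verts G"
    using rtranclp_adjacent_verts[OF multigraph_axioms _ kU(1)] by (auto simp: U_def)
  have VH: "verts H = U" using UV by (auto simp: H_def verts_induced)
  interpret H: multigraph H
    unfolding H_def by (rule multigraph_induced) (use kU in blast)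
  have adjH: "adjacent H x y \<longleftrightarrow> adjacent G x y" if "x \<in> U" "y \<in> U" for x y
    using that by (simp add: H_def adjacent_induced)
  have U_step: "y \<in> U" if "x \<in> U" "adjacent G x y" for x y
    using that by (auto simp: U_def intro: rtranclp.rtrancl_into_rtrancl)
  have KU: "K \<subseteq> U"
  proof
    fix x assume x: "x \<in> K"
    show "x \<in> U"
    proof (cases "x = k")
      case False
      then show ?thesis using U_step[OF kU(2)] cliqD[OF clK(2) k x] by blast
    qed (use kU in simp)
  qed
  have clH: "cliq (adjacent H) K"
    using cliqD[OF clK(2)] adjH KU by (intro cliqI) blast
  have parH: "parallel H x y \<longleftrightarrow> parallel G x y" if "x \<in> U" "y \<in> U" for x y
    using that by (simp add: parallel_def H_def joining_induced)
  have thick: "thick_clique H K"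
    unfolding thick_clique_def
  proof (intro conjI ballI impI)
    show "clique H K" using clH KU by (simp add: clique_iff VH)
    fix x y assume xy: "x \<in> K" "y \<in> K" "x \<noteq> y"
    have xyU: "x \<in> U" "y \<in> U" using xy KU by auto
    from K(1) xy have "parallel G x y \<or> (\<exists>w\<in>verts G - K. adjacent G w x \<and> adjacent G w y)"
      unfolding thick_clique_def by blast
    then show "parallel H x y \<or> (\<exists>w\<in>verts H - K. adjacent H w x \<and> adjacent H w y)"
    proof
      assume "\<exists>w\<in>verts G - K. adjacent G w x \<and> adjacent G w y"
      then obtain w where w: "w \<notin> K" "adjacent G w x" "adjacent G w y" by blast
      have "w \<in> U" using U_step[OF xyU(1)] w(2) adjacent_commute by metis
      then show ?thesis using w adjH xyU VH by blast
    qed (use parH xyU in simp)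
  qed
  have "elim_from (adjacent H) K (verts H)"
  proof (rule chordal_elim_from[OF H.finite_verts _ symp_adjacent H.not_adjacent_self])
    show "chordal_on (adjacent H) (verts H)"
      unfolding VH by (rule chordal_on_cong[OF chordal_imp_chordal_on[OF ch] UV adjH])
  qed (use KU clH VH in auto)
  moreover have "cut_connected (adjacent H) (verts H)"
    unfolding VH
  proof (rule cut_connected_weaken)
    show "cut_connected (adjacent G) U"
      unfolding U_def by (rule cut_connected_reachable[OF symp_adjacent])
  qed (simp add: adjH)
  ultimately show ?thesis
    using H.thick_clique_super_stable[OF _ _ thick K(2)] unfolding H_def U_def by blast
qed

lemma (in multigraph) component_super_stable_le:
  assumes "H \<in> graph_components G" "super_stable d H \<sigma> p" "d_realizable D G"
  shows "d \<le> D"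
proof -
  obtain u where u: "u \<in> verts G" "H = induced G {v. (adjacent G)\<^sup>*\<^sup>* u v}"
    using assms(1) by (auto simp: graph_components_def)
  show ?thesis
  proof (rule super_stable_induced_le)
    show "verts G \<inter> {v. (adjacent G)\<^sup>*\<^sup>* u v} \<noteq> {}" using u(1) by blast
  qed (use assms u in auto)
qed

text \<open>The bounds meet at \<open>d\<close>. \<open>K\<close> supplies a matrix of corank
  \<open>Suc d\<close> and a super stable component of dimension \<open>d\<close>; by rigidity
  \<open>real\<close> caps the dimension of every super stable component, while \<open>nu\<close>
  caps the coranks.\<close>

lemma (in multigraph) parameters_eq:
  assumes ch: "chordal G" and real: "d_realizable d G"
    and K: "thick_clique G K" "card K = Suc d"
    and nu: "\<And>A. A \<in> A_star G \<Longrightarrow> psd_on (verts G) A \<Longrightarrow> SAP G A \<Longrightarrow> corank_on (verts G) A \<le> Suc d"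
  shows "lambda_number G = d" "nu_number G = Suc d" "rd G = d"
proof -
  obtain k where k: "k \<in> K" using K(2) by fastforce
  have kV: "k \<in> verts G" using k K(1) by (auto simp: thick_clique_def clique_def)
  define H where "H = induced G {v. (adjacent G)\<^sup>*\<^sup>* k v}"
  have HC: "H \<in> graph_components G" using kV by (simp add: H_def graph_components_def)
  obtain \<sigma> p where ss: "super_stable d H \<sigma> p"
    using component_thick_clique[OF ch K k] unfolding H_def by blast
  \<comment> \<open>\<open>Max\<close> is meaningful only on nonempty sets; a single vertex is a
    thick clique and gives every component a realization of dimension 0.\<close>
  have exists0: "\<exists>\<sigma> p. super_stable 0 H' \<sigma> p" if H': "H' \<in> graph_components G" for H'
  proof -
    obtain u where u: "u \<in> verts G" "H' = induced G {v. (adjacent G)\<^sup>*\<^sup>* u v}"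
      using H' by (auto simp: graph_components_def)
    have "thick_clique G {u}" using u(1) by (simp add: thick_clique_def clique_def)
    then show ?thesis using component_thick_clique[OF ch, of "{u}" 0 u] u(2) by simp
  qed
  have fin: "finite {d. \<exists>\<sigma> p. super_stable d H' \<sigma> p}" and bound: "lambda_connected H' \<le> d"
    if H': "H' \<in> graph_components G" for H'
  proof -
    have le: "d' \<le> d" if "d' \<in> {d. \<exists>\<sigma> p. super_stable d H' \<sigma> p}" for d'
      using component_super_stable_le[OF H' _ real] that by blast
    then show fin: "finite {d. \<exists>\<sigma> p. super_stable d H' \<sigma> p}"
      by (meson finite_nat_set_iff_bounded_le)
    have "{d. \<exists>\<sigma> p. super_stable d H' \<sigma> p} \<noteq> {}" using exists0[OF H'] by blast
    then show "lambda_connected H' \<le> d"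
      unfolding lambda_connected_def using fin le by (intro Max.boundedI)
  qed
  have "d \<le> lambda_connected H"
    unfolding lambda_connected_def using ss by (intro Max_ge[OF fin[OF HC]]) blast
  then have "lambda_connected H = d" using bound[OF HC] by simp
  then show "lambda_number G = d"
    unfolding lambda_number_def using bound HC finite_verts
    by (intro Max_eqI) (auto simp: graph_components_def)
  obtain A where A: "A \<in> A_star G" "psd_on (verts G) A" "SAP G A" "corank_on (verts G) A = Suc d"
    using thick_clique_corank[OF ch K(1)] K(2) by auto
  define S where "S = {corank_on (verts G) A | A. A \<in> A_star G \<and> psd_on (verts G) A \<and> SAP G A}"
  have le: "c \<le> Suc d" if "c \<in> S" for c using that nu unfolding S_def by blast
  show "nu_number G = Suc d"
    unfolding nu_number_def S_def[symmetric]
  proof (rule Max_eqI)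
    show "finite S" using le by (meson finite_nat_set_iff_bounded_le)
    show "Suc d \<in> S" unfolding S_def using A by (intro CollectI exI[of _ A]) simp
  qed (rule le)
  show "rd G = d"
    unfolding rd_def
    \<comment> \<open>Minimality is the rigidity bound, applied to an arbitrary dimension in which
      \<open>G\<close> is realizable.\<close>
    by (rule Least_equality) (rule real component_super_stable_le[OF HC ss], assumption?)+
qed

text \<open>By maximality \<open>D\<close> is not contained in \<open>C\<close>, and any vertex of
  \<open>D\<close> outside \<open>C\<close> serves. This turns the condition of the theorem into
  thickness.\<close>

lemma (in multigraph) common_neighbour_of_maximal_cliques:
  assumes C: "maximal_clique G C" and D: "maximal_clique G D" "D \<noteq> C" "{u, v} \<subseteq> D"
    and uv: "u \<in> C" "v \<in> C"
  shows "\<exists>w\<in>verts G - C. adjacent G w u \<and> adjacent G w v"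
proof -
  have "\<not> D \<subseteq> C"
    using C D(1,2) unfolding maximal_clique_def by blast
  then obtain w where w: "w \<in> D" "w \<notin> C" by blast
  have clD: "D \<subseteq> verts G" "cliq (adjacent G) D"
    using D(1) by (simp_all add: maximal_clique_def clique_iff)
  have "w \<noteq> u" "w \<noteq> v" using w(2) uv by auto
  then show ?thesis using w D(3) clD(1) cliqD[OF clD(2) w(1)] by blast
qed

lemma (in multigraph) maximum_clique_maximal:
  assumes "maximum_clique G C"
  shows "maximal_clique G C"
  unfolding maximal_clique_def
proof (intro conjI allI impI)
  show "clique G C" using assms by (simp add: maximum_clique_def)
  fix D assume D: "clique G D \<and> C \<subseteq> D"
  then have "card D \<le> card C" using assms by (simp add: maximum_clique_def)
  then show "D = C" using card_seteq[OF clique_finite, of D C] D by simp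
qed

theorem theorem6p2:
  fixes G :: "('v, 'e) pre_multigraph"
  assumes "multigraph G"
    and "chordal G"
    and "tw G = 1 \<Longrightarrow> \<exists>u v. parallel G u v"
  shows "int (lambda_number G) = int (nu_number G) - 1
    \<and> int (nu_number G) - 1 = int (rd G)
    \<and> int (rd G) \<in> {int (tw G) - 1, int (tw G)}
    \<and> (rd G = tw G \<longleftrightarrow>
        (\<exists>C. maximum_clique G C \<and>
          (\<forall>u\<in>C. \<forall>v\<in>C. u \<noteq> v \<longrightarrow>
            parallel G u v \<or> (\<exists>D. maximal_clique G D \<and> D \<noteq> C \<and> {u, v} \<subseteq> D))))"
proof -
  interpret multigraph G by (rule assms(1))
  define tight where "tight C \<longleftrightarrow> (\<forall>u\<in>C. \<forall>v\<in>C. u \<noteq> v \<longrightarrow>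
    parallel G u v \<or> (\<exists>D. maximal_clique G D \<and> D \<noteq> C \<and> {u, v} \<subseteq> D))" for C
  define t where "t = tw G"
  obtain C0 where C0: "maximum_clique G C0" using exists_maximum_clique by blast
  have clC0: "clique G C0" using C0 by (simp add: maximum_clique_def)
  obtain r where "r \<in> verts G" using verts_nonempty by blast
  then have "clique G {r}" by (simp add: clique_def)
  then have "1 \<le> card C0" using C0 by (fastforce simp: maximum_clique_def)
  \<comment> \<open>As \<open>C0\<close> is nonempty, the truncated difference
    \<open>card C0 - 1\<close> is exact.\<close>
  then have cC0: "card C0 = Suc t" using chordal_treewidth[OF assms(2) C0] by (simp add: t_def)
  have le: "card C \<le> Suc t" if "clique G C" for C
    using C0 that cC0 by (simp add: maximum_clique_def)
  have maximum: "maximum_clique G C \<longleftrightarrow> clique G C \<and> card C = Suc t" for C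
  proof
    assume C: "maximum_clique G C"
    then have "card C0 \<le> card C" using clC0 by (simp add: maximum_clique_def)
    then show "clique G C \<and> card C = Suc t"
      using C le[of C] cC0 by (simp add: maximum_clique_def)
  next
    assume "clique G C \<and> card C = Suc t"
    then show "maximum_clique G C" using le by (simp add: maximum_clique_def)
  qed
  have corank: "corank_on (verts G) A \<le> Suc t"
    "corank_on (verts G) A = Suc t \<Longrightarrow> \<exists>C. maximum_clique G C \<and> tight C"
    if A: "A \<in> A_star G" "psd_on (verts G) A" "SAP G A" for A
  proof -
    obtain C where C: "clique G C" "corank_on (verts G) A \<le> card C"
      "corank_on (verts G) A = card C \<Longrightarrow> tight C"
      using psd_sap_corank[OF assms(2) A] unfolding tight_def by blast
    show "corank_on (verts G) A \<le> Suc t" using C(2) le[OF C(1)] by simp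
    assume "corank_on (verts G) A = Suc t"
    then show "\<exists>C. maximum_clique G C \<and> tight C"
      using C le[OF C(1)] maximum[of C] by auto
  qed
  \<comment> \<open>\<open>d\<close> is \<open>t\<close> or \<open>t - 1\<close> according to
    whether a tight maximum clique exists; the claim then follows by arithmetic.\<close>
  have "\<exists>d. (d = t \<longleftrightarrow> (\<exists>C. maximum_clique G C \<and> tight C)) \<and> (d = t \<or> Suc d = t) \<and>
    lambda_number G = d \<and> nu_number G = Suc d \<and> rd G = d"
  proof (cases "\<exists>C. maximum_clique G C \<and> tight C")
    case True
    then obtain C where C: "maximum_clique G C" "tight C" by blast
    have "thick_clique G C"
      unfolding thick_clique_def
    proof (intro conjI ballI impI)
      show "clique G C" using C(1) by (simp add: maximum_clique_def)
      fix u v assume "u \<in> C" "v \<in> C" "u \<noteq> v"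
      then show "parallel G u v \<or> (\<exists>w\<in>verts G - C. adjacent G w u \<and> adjacent G w v)"
        using C(2) common_neighbour_of_maximal_cliques[OF maximum_clique_maximal[OF C(1)]]
        unfolding tight_def by meson
    qed
    moreover have "card C = Suc t" using C(1) maximum by simp
    ultimately have "lambda_number G = t" "nu_number G = Suc t" "rd G = t"
      using parameters_eq[OF assms(2) d_realizable_clique_bound[OF assms(2) le]] corank(1) by blast+
    then show ?thesis using True by blast
  next
    case False
    \<comment> \<open>A one-vertex clique is tight vacuously.\<close>
    have "t \<noteq> 0"
    proof
      assume "t = 0"
      then obtain c where "C0 = {c}" using cC0 by (auto simp: card_1_singleton_iff)
      then have "tight C0" by (simp add: tight_def)
      then show False using False C0 by blast
    qed
    \<comment> \<open>For \<open>t = 1\<close> the hypothesis of the theorem yields a parallel pair,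
      which is a tight maximum clique. What remains is \<open>2 \<le> t\<close>, where the hinge for
      folding is nonempty.\<close>
    moreover have "t \<noteq> 1"
    proof
      assume t1: "t = 1"
      then obtain u v where uv: "parallel G u v" using assms(3) by (auto simp: t_def)
      then have "joining G u v \<noteq> {}" by (auto simp: parallel_def)
      then have adj: "adjacent G u v" by (simp add: adjacent_def)
      note D = adjacentD[OF adj]
      have "clique G {u, v}" using adj D adjacent_commute[of G u v] by (auto simp: clique_iff cliq_def)
      then have "maximum_clique G {u, v}" using D(3) t1 by (simp add: maximum)
      moreover have "joining G v u = joining G u v" by (simp add: joining_def insert_commute)
      then have "tight {u, v}" using uv by (simp add: tight_def parallel_def)
      ultimately show False using False by blast
    qed
    ultimately have t2: "2 \<le> t" by simp
    define d where "d = t - 1"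
    have d: "Suc d = t" "1 \<le> d" using t2 by (simp_all add: d_def)
    have real: "d_realizable d G"
    proof (rule d_realizable_loose_cliques[OF assms(2) d(2)])
      show "card C \<le> d + 2" if "clique G C" for C using le[OF that] d(1) by simp
      fix C assume "clique G C" "card C = d + 2"
      then have "maximum_clique G C" using d(1) by (simp add: maximum)
      then have "\<not> tight C" using False by blast
      then obtain u v where uv: "u \<in> C" "v \<in> C" "u \<noteq> v" "\<not> parallel G u v"
        "\<not> (\<exists>D. maximal_clique G D \<and> D \<noteq> C \<and> {u, v} \<subseteq> D)" unfolding tight_def by blast
      have "\<forall>C'. maximal_clique G C' \<and> {u, v} \<subseteq> C' \<longrightarrow> C' = C" using uv(5) by blast
      then show "\<exists>u v. u \<in> C \<and> v \<in> C \<and> u \<noteq> v \<and> \<not> parallel G u v \<and>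
        (\<forall>C'. maximal_clique G C' \<and> {u, v} \<subseteq> C' \<longrightarrow> C' = C)"
        using uv(1-4) by (intro exI[of _ u] exI[of _ v] conjI)
    qed
    obtain c where c: "c \<in> C0" using cC0 by fastforce
    \<comment> \<open>The removed vertex \<open>c\<close> is a common neighbour of every pair in
      \<open>K\<close>.\<close>
    define K where "K = C0 - {c}"
    have KC: "K \<subseteq> C0" by (auto simp: K_def)
    have cK: "card K = Suc d" using c cC0 clique_finite[OF clC0] d(1) by (simp add: K_def)
    have "thick_clique G K"
      unfolding thick_clique_def
    proof (intro conjI ballI impI disjI2)
      show "clique G K" by (rule clique_mono[OF clC0 KC])
      fix u v assume uv: "u \<in> K" "v \<in> K"
      have cl: "cliq (adjacent G) C0" "C0 \<subseteq> verts G" using clC0 by (simp_all add: clique_iff)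
      have "adjacent G c u" "adjacent G c v" using cliqD[OF cl(1) c] uv by (auto simp: K_def)
      then show "\<exists>w\<in>verts G - K. adjacent G w u \<and> adjacent G w v"
        using c cl(2) by (intro bexI[of _ c]) (auto simp: K_def)
    qed
    moreover have "corank_on (verts G) A \<le> Suc d"
      if A: "A \<in> A_star G" "psd_on (verts G) A" "SAP G A" for A
    proof -
      have "corank_on (verts G) A \<noteq> Suc t" using corank(2)[OF A] False by blast
      then show ?thesis using corank(1)[OF A] d(1) by simp
    qed
    ultimately have "lambda_number G = d" "nu_number G = Suc d" "rd G = d"
      using parameters_eq[OF assms(2) real _ cK] by blast+
    then show ?thesis using False d(1) by (intro exI[of _ d]) auto
  qed
  then obtain d where d: "d = t \<longleftrightarrow> (\<exists>C. maximum_clique G C \<and> tight C)" "d = t \<or> Suc d = t"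
    "lambda_number G = d" "nu_number G = Suc d" "rd G = d" by blast
  have "int (rd G) \<in> {int (tw G) - 1, int (tw G)}"
    using d(2,5) by (auto simp: t_def)
  then show ?thesis using d(1,3-5) by (simp add: t_def tight_def)
qed

end
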